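(* Let $X$ be a locally irreducible complex space, let $\psi:\hat X\to X$ be the normalization of $X$, and let $\mathscr{F}$ be a torsion-free coherent analytic sheaf on $\hat X$. Then the canonical morphism $\psi^*\psi_*\mathscr{F}\to\mathscr{F}$ induces an isomorphism $$\psi^T\psi_*\mathscr{F}\cong\mathscr{F}.$$
   Context: Complex spaces are reduced. For a coherent analytic sheaf $\mathscr{S}$ on $X$ and a holomorphic map $\psi:\hat X\to X$, $\psi^T\mathscr{S}:=\psi^*\mathscr{S}/\mathscr{T}(\psi^*\mathscr{S})$ is the torsion-free preimage sheaf, where $\mathscr{T}(\cdot)$ denotes the torsion subsheaf and $\psi^*$ is the analytic inverse image. *)

theory Defs
  imports "HOL-Analysis.Analysis" "HOL-Library.Poly_Mapping" "HOL-Algebra.QuotRing" "HOL-Algebra.Module"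
begin

section \<open>Commutative algebra\<close>

subsection \<open>Total rings of fractions and integral closure\<close>

definition nonzerodivisors :: "('a, 'm) ring_scheme \<Rightarrow> 'a set" where
  "nonzerodivisors R =
     {b \<in> carrier R. \<forall>a \<in> carrier R. a \<otimes>\<^bsub>R\<^esub> b = \<zero>\<^bsub>R\<^esub> \<longrightarrow> a = \<zero>\<^bsub>R\<^esub>}"

text \<open>The fraction \<open>a / b\<close> is the set of all pairs \<open>(c, d)\<close>, \<open>d\<close> a non-zero-divisor, with \<open>a d = c b\<close>.\<close>

definition fraction :: "('a, 'm) ring_scheme \<Rightarrow> 'a \<Rightarrow> 'a \<Rightarrow> ('a \<times> 'a) set" where
  "fraction R a b =
     {(c, d). c \<in> carrier R \<and> d \<in> nonzerodivisors R \<and> a \<otimes>\<^bsub>R\<^esub> d = c \<otimes>\<^bsub>R\<^esub> b}"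

text \<open>Here and below, operations on equivalence classes are written as the union, over all
  representatives, of the (coinciding) result classes; cf. \<open>set_mult\<close> in HOL-Algebra.\<close>

definition total_fractions :: "('a, 'm) ring_scheme \<Rightarrow> ('a \<times> 'a) set ring" where
  "total_fractions R =
     \<lparr>carrier = {fraction R a b | a b. a \<in> carrier R \<and> b \<in> nonzerodivisors R},
      mult = (\<lambda>A B. \<Union>(a, b) \<in> A. \<Union>(c, d) \<in> B. fraction R (a \<otimes>\<^bsub>R\<^esub> c) (b \<otimes>\<^bsub>R\<^esub> d)),
      one = fraction R \<one>\<^bsub>R\<^esub> \<one>\<^bsub>R\<^esub>,
      ring.zero = fraction R \<zero>\<^bsub>R\<^esub> \<one>\<^bsub>R\<^esub>,
      add = (\<lambda>A B. \<Union>(a, b) \<in> A. \<Union>(c, d) \<in> B.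
               fraction R ((a \<otimes>\<^bsub>R\<^esub> d) \<oplus>\<^bsub>R\<^esub> (c \<otimes>\<^bsub>R\<^esub> b)) (b \<otimes>\<^bsub>R\<^esub> d))\<rparr>"

definition to_fraction :: "('a, 'm) ring_scheme \<Rightarrow> 'a \<Rightarrow> ('a \<times> 'a) set" where
  "to_fraction R a = fraction R a \<one>\<^bsub>R\<^esub>"

definition integral_closure :: "('a, 'm) ring_scheme \<Rightarrow> ('a \<times> 'a) set set" where
  "integral_closure R =
     (let Q = total_fractions R in
      {q \<in> carrier Q. \<exists>(n::nat) c. c \<in> {..<n} \<rightarrow> carrier R \<and>
         (q [^]\<^bsub>Q\<^esub> n) \<oplus>\<^bsub>Q\<^esub> (\<Oplus>\<^bsub>Q\<^esub>i \<in> {..<n}. to_fraction R (c i) \<otimes>\<^bsub>Q\<^esub> (q [^]\<^bsub>Q\<^esub> i)) = \<zero>\<^bsub>Q\<^esub>})"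

subsection \<open>Modules\<close>

text \<open>A module record of HOL-Algebra also has the ring fields \<open>mult\<close> and \<open>one\<close>; they carry no
  meaning for a module.\<close>

definition mod_hom ::
  "('r, 'm) ring_scheme \<Rightarrow> ('r, 'a) module \<Rightarrow> ('r, 'b) module \<Rightarrow> ('a \<Rightarrow> 'b) set" where
  "mod_hom R M N =
     {h \<in> carrier M \<rightarrow> carrier N.
        (\<forall>x \<in> carrier M. \<forall>y \<in> carrier M. h (x \<oplus>\<^bsub>M\<^esub> y) = h x \<oplus>\<^bsub>N\<^esub> h y) \<and>
        (\<forall>a \<in> carrier R. \<forall>x \<in> carrier M. h (a \<odot>\<^bsub>M\<^esub> x) = a \<odot>\<^bsub>N\<^esub> h x)}"

definition lin_comb :: "('r, 'a) module \<Rightarrow> nat \<Rightarrow> (nat \<Rightarrow> 'r) \<Rightarrow> (nat \<Rightarrow> 'a) \<Rightarrow> 'a" where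
  "lin_comb M n a s = (\<Oplus>\<^bsub>M\<^esub>i \<in> {..<n}. a i \<odot>\<^bsub>M\<^esub> s i)"

definition torsion_elems :: "('r, 'm) ring_scheme \<Rightarrow> ('r, 'a) module \<Rightarrow> 'a set" where
  "torsion_elems R M = {x \<in> carrier M. \<exists>a \<in> nonzerodivisors R. a \<odot>\<^bsub>M\<^esub> x = \<zero>\<^bsub>M\<^esub>}"

definition quot_mod :: "('r, 'a) module \<Rightarrow> 'a set \<Rightarrow> ('r, 'a set) module" where
  "quot_mod M N =
     \<lparr>carrier = a_rcosets\<^bsub>M\<^esub> N, mult = undefined, one = undefined,
      ring.zero = N, add = (\<lambda>A B. A <+>\<^bsub>M\<^esub> B),
      smult = (\<lambda>r A. \<Union>x \<in> A. N +>\<^bsub>M\<^esub> (r \<odot>\<^bsub>M\<^esub> x))\<rparr>"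

text \<open>The tensor product \<open>M \<otimes>\<^sub>R S\<close> along a ring homomorphism \<open>\<phi> : R \<rightarrow> S\<close>, as an \<open>S\<close>-module: the
  free abelian group on \<open>M \<times> S\<close> modulo the subgroup \<open>tensor_rel R S \<phi> M\<close>.\<close>

inductive_set tensor_rel ::
  "('r, 'm) ring_scheme \<Rightarrow> ('s, 'n) ring_scheme \<Rightarrow> ('r \<Rightarrow> 's) \<Rightarrow> ('r, 'a) module \<Rightarrow>
   ('a \<times> 's \<Rightarrow>\<^sub>0 int) set"
  for R S \<phi> M where
    zero: "0 \<in> tensor_rel R S \<phi> M"
  | diff: "\<lbrakk>f \<in> tensor_rel R S \<phi> M; g \<in> tensor_rel R S \<phi> M\<rbrakk> \<Longrightarrow> f - g \<in> tensor_rel R S \<phi> M"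
  | add_left: "\<lbrakk>x \<in> carrier M; y \<in> carrier M; s \<in> carrier S\<rbrakk> \<Longrightarrow>
      frag_of (x \<oplus>\<^bsub>M\<^esub> y, s) - frag_of (x, s) - frag_of (y, s) \<in> tensor_rel R S \<phi> M"
  | add_right: "\<lbrakk>x \<in> carrier M; s \<in> carrier S; t \<in> carrier S\<rbrakk> \<Longrightarrow>
      frag_of (x, s \<oplus>\<^bsub>S\<^esub> t) - frag_of (x, s) - frag_of (x, t) \<in> tensor_rel R S \<phi> M"
  | balanced: "\<lbrakk>r \<in> carrier R; x \<in> carrier M; s \<in> carrier S\<rbrakk> \<Longrightarrow>
      frag_of (r \<odot>\<^bsub>M\<^esub> x, s) - frag_of (x, \<phi> r \<otimes>\<^bsub>S\<^esub> s) \<in> tensor_rel R S \<phi> M"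

definition tensor_class ::
  "('r, 'm) ring_scheme \<Rightarrow> ('s, 'n) ring_scheme \<Rightarrow> ('r \<Rightarrow> 's) \<Rightarrow> ('r, 'a) module \<Rightarrow>
   ('a \<times> 's \<Rightarrow>\<^sub>0 int) \<Rightarrow> ('a \<times> 's \<Rightarrow>\<^sub>0 int) set" where
  "tensor_class R S \<phi> M f =
     {g. Poly_Mapping.keys g \<subseteq> carrier M \<times> carrier S \<and> g - f \<in> tensor_rel R S \<phi> M}"

definition base_change ::
  "('r, 'm) ring_scheme \<Rightarrow> ('s, 'n) ring_scheme \<Rightarrow> ('r \<Rightarrow> 's) \<Rightarrow> ('r, 'a) module \<Rightarrow>
   ('s, ('a \<times> 's \<Rightarrow>\<^sub>0 int) set) module" where
  "base_change R S \<phi> M =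
     \<lparr>carrier = tensor_class R S \<phi> M ` {f. Poly_Mapping.keys f \<subseteq> carrier M \<times> carrier S},
      mult = undefined, one = undefined,
      ring.zero = tensor_class R S \<phi> M 0,
      add = (\<lambda>A B. \<Union>f \<in> A. \<Union>g \<in> B. tensor_class R S \<phi> M (f + g)),
      smult = (\<lambda>t A. \<Union>f \<in> A.
        tensor_class R S \<phi> M (frag_extend (\<lambda>(x, s). frag_of (x, t \<otimes>\<^bsub>S\<^esub> s)) f))\<rparr>"

section \<open>Presheaves and stalks\<close>

text \<open>The third type parameter is the record type of the objects of sections (rings or modules)
  with elements of type \<open>'s\<close>. Only the values at open sets matter.\<close>

record ('p, 's, 'o) presheaf =
  sect :: "'p set \<Rightarrow> 'o"
  res :: "'p set \<Rightarrow> 'p set \<Rightarrow> 's \<Rightarrow> 's"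

definition germ ::
  "'p topology \<Rightarrow> ('p, 's, ('s, 'm) ring_scheme) presheaf \<Rightarrow> 'p \<Rightarrow> 'p set \<Rightarrow> 's \<Rightarrow> ('p set \<times> 's) set"
where
  "germ T P x U s =
     {(V, t). openin T V \<and> x \<in> V \<and> t \<in> carrier (sect P V) \<and>
        (\<exists>W. openin T W \<and> x \<in> W \<and> W \<subseteq> U \<inter> V \<and> res P U W s = res P V W t)}"

definition stalk ::
  "'p topology \<Rightarrow> ('p, 's, ('s, 'm) ring_scheme) presheaf \<Rightarrow> 'p \<Rightarrow> ('p set \<times> 's) set ring" where
  "stalk T P x =
     \<lparr>carrier = {germ T P x U s | U s. openin T U \<and> x \<in> U \<and> s \<in> carrier (sect P U)},
      mult = (\<lambda>A B. \<Union>(U, s) \<in> A. \<Union>(V, t) \<in> B.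
        germ T P x (U \<inter> V) (res P U (U \<inter> V) s \<otimes>\<^bsub>sect P (U \<inter> V)\<^esub> res P V (U \<inter> V) t)),
      one = germ T P x (topspace T) \<one>\<^bsub>sect P (topspace T)\<^esub>,
      ring.zero = germ T P x (topspace T) \<zero>\<^bsub>sect P (topspace T)\<^esub>,
      add = (\<lambda>A B. \<Union>(U, s) \<in> A. \<Union>(V, t) \<in> B.
        germ T P x (U \<inter> V) (res P U (U \<inter> V) s \<oplus>\<^bsub>sect P (U \<inter> V)\<^esub> res P V (U \<inter> V) t))\<rparr>"

section \<open>Reduced complex spaces\<close>

subsection \<open>Local models\<close>

text \<open>\<open>\<complex>\<^sup>n\<close> as a space of sequences, in analogy with \<^const>\<open>Euclidean_space\<close>.\<close>

definition Cspace :: "nat \<Rightarrow> (nat \<Rightarrow> complex) topology" where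
  "Cspace n = subtopology (product_topology (\<lambda>_. euclidean) UNIV) {z. \<forall>i\<ge>n. z i = 0}"

definition holomorphic_Cspace ::
  "nat \<Rightarrow> (nat \<Rightarrow> complex) set \<Rightarrow> ((nat \<Rightarrow> complex) \<Rightarrow> complex) \<Rightarrow> bool" where
  "holomorphic_Cspace n W f \<longleftrightarrow>
     openin (Cspace n) W \<and> continuous_map (subtopology (Cspace n) W) euclidean f \<and>
     (\<forall>z \<in> W. \<forall>i<n. (\<lambda>w. f (z(i := w))) field_differentiable at (z i))"

text \<open>\<open>A\<close> is an analytic subset of the open set \<open>W\<close>.\<close>

definition analytic_set :: "nat \<Rightarrow> (nat \<Rightarrow> complex) set \<Rightarrow> (nat \<Rightarrow> complex) set \<Rightarrow> bool" where
  "analytic_set n W A \<longleftrightarrow>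
     openin (Cspace n) W \<and> A \<subseteq> W \<and>
     (\<forall>z \<in> W. \<exists>N fs. openin (Cspace n) N \<and> z \<in> N \<and> N \<subseteq> W \<and> finite fs \<and>
        (\<forall>f \<in> fs. holomorphic_Cspace n N f) \<and> A \<inter> N = {w \<in> N. \<forall>f \<in> fs. f w = 0})"

text \<open>Functions on a subset \<open>B\<close> of \<open>\<complex>\<^sup>n\<close> that locally extend to holomorphic functions of the ambient
  space.\<close>

definition holomorphic_model ::
  "nat \<Rightarrow> (nat \<Rightarrow> complex) set \<Rightarrow> ((nat \<Rightarrow> complex) \<Rightarrow> complex) \<Rightarrow> bool" where
  "holomorphic_model n B f \<longleftrightarrow>
     (\<forall>b \<in> B. \<exists>N h. b \<in> N \<and> holomorphic_Cspace n N h \<and> (\<forall>w \<in> N \<inter> B. h w = f w))"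

subsection \<open>Complex spaces\<close>

text \<open>As complex spaces are reduced, the structure sheaf is a sheaf of complex-valued functions:
  \<open>hol X U\<close> is the set of holomorphic functions on the open set \<open>U\<close> (made \<open>undefined\<close> outside \<open>U\<close>).\<close>

record 'p fspace =
  tsp :: "'p topology"
  hol :: "'p set \<Rightarrow> ('p \<Rightarrow> complex) set"

abbreviation pts :: "'p fspace \<Rightarrow> 'p set" where
  "pts X \<equiv> topspace (tsp X)"

definition complex_space :: "'p fspace \<Rightarrow> bool" where
  "complex_space X \<longleftrightarrow>
     Hausdorff_space (tsp X) \<and>
     (\<forall>U V f. openin (tsp X) U \<and> openin (tsp X) V \<and> V \<subseteq> U \<and> f \<in> hol X U \<longrightarrow>
        restrict f V \<in> hol X V) \<and>
     (\<forall>U f. openin (tsp X) U \<and> f \<in> extensional U \<and>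
        (\<forall>x \<in> U. \<exists>V. openin (tsp X) V \<and> x \<in> V \<and> V \<subseteq> U \<and> restrict f V \<in> hol X V) \<longrightarrow>
        f \<in> hol X U) \<and>
     (\<forall>x \<in> pts X. \<exists>U n W A \<phi> \<phi>'.
        openin (tsp X) U \<and> x \<in> U \<and> analytic_set n W A \<and>
        homeomorphic_maps (subtopology (tsp X) U) (subtopology (Cspace n) A) \<phi> \<phi>' \<and>
        (\<forall>V. openin (tsp X) V \<and> V \<subseteq> U \<longrightarrow>
           hol X V = {f \<in> extensional V. holomorphic_model n (\<phi> ` V) (f \<circ> \<phi>')}))"

definition structure_sheaf ::
  "'p fspace \<Rightarrow> ('p, 'p \<Rightarrow> complex, ('p \<Rightarrow> complex) ring) presheaf" where
  "structure_sheaf X =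
     \<lparr>sect = (\<lambda>U. \<lparr>carrier = hol X U,
                   mult = (\<lambda>f g. \<lambda>x\<in>U. f x * g x), one = (\<lambda>x\<in>U. 1),
                   ring.zero = (\<lambda>x\<in>U. 0), add = (\<lambda>f g. \<lambda>x\<in>U. f x + g x)\<rparr>),
      res = (\<lambda>U V f. restrict f V)\<rparr>"

abbreviation germ_fun ::
  "'p fspace \<Rightarrow> 'p \<Rightarrow> 'p set \<Rightarrow> ('p \<Rightarrow> complex) \<Rightarrow> ('p set \<times> ('p \<Rightarrow> complex)) set" where
  "germ_fun X \<equiv> germ (tsp X) (structure_sheaf X)"

abbreviation local_ring :: "'p fspace \<Rightarrow> 'p \<Rightarrow> ('p set \<times> ('p \<Rightarrow> complex)) set ring" where
  "local_ring X \<equiv> stalk (tsp X) (structure_sheaf X)"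

definition locally_irreducible :: "'p fspace \<Rightarrow> bool" where
  "locally_irreducible X \<longleftrightarrow> (\<forall>x \<in> pts X. domain (local_ring X x))"

definition normal_space :: "'p fspace \<Rightarrow> bool" where
  "normal_space X \<longleftrightarrow>
     (\<forall>x \<in> pts X. integral_closure (local_ring X x) =
                   to_fraction (local_ring X x) ` carrier (local_ring X x))"

subsection \<open>Holomorphic maps\<close>

definition preim :: "'q fspace \<Rightarrow> ('q \<Rightarrow> 'p) \<Rightarrow> 'p set \<Rightarrow> 'q set" where
  "preim Y \<psi> U = {y \<in> pts Y. \<psi> y \<in> U}"

definition pull :: "'q fspace \<Rightarrow> ('q \<Rightarrow> 'p) \<Rightarrow> 'p set \<Rightarrow> ('p \<Rightarrow> complex) \<Rightarrow> ('q \<Rightarrow> complex)" where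
  "pull Y \<psi> U f = restrict (f \<circ> \<psi>) (preim Y \<psi> U)"

definition holomorphic_map :: "'q fspace \<Rightarrow> 'p fspace \<Rightarrow> ('q \<Rightarrow> 'p) \<Rightarrow> bool" where
  "holomorphic_map Y X \<psi> \<longleftrightarrow>
     continuous_map (tsp Y) (tsp X) \<psi> \<and>
     (\<forall>U f. openin (tsp X) U \<and> f \<in> hol X U \<longrightarrow> pull Y \<psi> U f \<in> hol Y (preim Y \<psi> U))"

definition finite_map :: "'q fspace \<Rightarrow> 'p fspace \<Rightarrow> ('q \<Rightarrow> 'p) \<Rightarrow> bool" where
  "finite_map Y X \<psi> \<longleftrightarrow>
     closed_map (tsp Y) (tsp X) \<psi> \<and> (\<forall>x \<in> pts X. finite (preim Y \<psi> {x}))"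

text \<open>The homomorphism \<open>\<O>\<^bsub>X,\<psi>(y)\<^esub> \<rightarrow> \<O>\<^bsub>Y,y\<^esub>\<close>.\<close>

definition comorphism ::
  "'q fspace \<Rightarrow> ('q \<Rightarrow> 'p) \<Rightarrow> 'q \<Rightarrow> ('p set \<times> ('p \<Rightarrow> complex)) set \<Rightarrow>
   ('q set \<times> ('q \<Rightarrow> complex)) set" where
  "comorphism Y \<psi> y A = (\<Union>(U, f) \<in> A. germ_fun Y y (preim Y \<psi> U) (pull Y \<psi> U f))"

text \<open>\<open>\<psi>\<^sub>*\<O>\<^sub>Y\<close> as a sheaf of rings on \<open>X\<close>, and the homomorphism \<open>\<O>\<^bsub>X,x\<^esub> \<rightarrow> (\<psi>\<^sub>*\<O>\<^sub>Y)\<^sub>x\<close>.\<close>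

definition direct_structure ::
  "'q fspace \<Rightarrow> ('q \<Rightarrow> 'p) \<Rightarrow> ('p, 'q \<Rightarrow> complex, ('q \<Rightarrow> complex) ring) presheaf" where
  "direct_structure Y \<psi> =
     \<lparr>sect = (\<lambda>U. sect (structure_sheaf Y) (preim Y \<psi> U)),
      res = (\<lambda>U V. res (structure_sheaf Y) (preim Y \<psi> U) (preim Y \<psi> V))\<rparr>"

definition direct_comorphism ::
  "'q fspace \<Rightarrow> 'p fspace \<Rightarrow> ('q \<Rightarrow> 'p) \<Rightarrow> 'p \<Rightarrow> ('p set \<times> ('p \<Rightarrow> complex)) set \<Rightarrow>
   ('p set \<times> ('q \<Rightarrow> complex)) set" where
  "direct_comorphism Y X \<psi> x A =
     (\<Union>(U, f) \<in> A. germ (tsp X) (direct_structure Y \<psi>) x U (pull Y \<psi> U f))"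

text \<open>A normalization of \<open>X\<close> is a finite holomorphic map \<open>\<psi>\<close> from a normal complex space \<open>Y\<close> such
  that \<open>\<psi>\<^sub>*\<O>\<^sub>Y\<close> is, over \<open>\<O>\<^sub>X\<close>, the normalization sheaf, i.e. the integral closure of \<open>\<O>\<^sub>X\<close> in the
  sheaf of meromorphic functions, whose stalks are the total rings of fractions of the local rings.
  An isomorphism over \<open>\<O>\<^bsub>X,x\<^esub>\<close> as below is unique, since every element of the total ring of
  fractions is a quotient of elements of \<open>\<O>\<^bsub>X,x\<^esub>\<close>; hence the isomorphisms of stalks are those of an
  isomorphism of sheaves.\<close>

definition normalization :: "'q fspace \<Rightarrow> 'p fspace \<Rightarrow> ('q \<Rightarrow> 'p) \<Rightarrow> bool" where
  "normalization Y X \<psi> \<longleftrightarrow>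
     complex_space Y \<and> normal_space Y \<and> holomorphic_map Y X \<psi> \<and> finite_map Y X \<psi> \<and>
     (\<forall>x \<in> pts X. \<exists>\<theta>.
        \<theta> \<in> ring_iso (stalk (tsp X) (direct_structure Y \<psi>) x)
              ((total_fractions (local_ring X x))\<lparr>carrier := integral_closure (local_ring X x)\<rparr>) \<and>
        (\<forall>a \<in> carrier (local_ring X x).
           \<theta> (direct_comorphism Y X \<psi> x a) = to_fraction (local_ring X x) a))"

section \<open>Analytic sheaves\<close>

type_synonym ('p, 's) apresheaf = "('p, 's, ('p \<Rightarrow> complex, 's) module) presheaf"

definition analytic_sheaf :: "'p fspace \<Rightarrow> ('p, 's) apresheaf \<Rightarrow> bool" where
  "analytic_sheaf X M \<longleftrightarrow>
     (\<forall>U. openin (tsp X) U \<longrightarrow> Module.module (sect (structure_sheaf X) U) (sect M U)) \<and>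
     (\<forall>U V. openin (tsp X) U \<and> openin (tsp X) V \<and> V \<subseteq> U \<longrightarrow>
        res M U V \<in> carrier (sect M U) \<rightarrow> carrier (sect M V) \<and>
        (\<forall>s \<in> carrier (sect M U). \<forall>t \<in> carrier (sect M U).
           res M U V (s \<oplus>\<^bsub>sect M U\<^esub> t) = res M U V s \<oplus>\<^bsub>sect M V\<^esub> res M U V t) \<and>
        (\<forall>f \<in> hol X U. \<forall>s \<in> carrier (sect M U).
           res M U V (f \<odot>\<^bsub>sect M U\<^esub> s) = restrict f V \<odot>\<^bsub>sect M V\<^esub> res M U V s)) \<and>
     (\<forall>U s. openin (tsp X) U \<and> s \<in> carrier (sect M U) \<longrightarrow> res M U U s = s) \<and>
     (\<forall>U V W s. openin (tsp X) U \<and> openin (tsp X) V \<and> openin (tsp X) W \<and> W \<subseteq> V \<and> V \<subseteq> U \<and>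
        s \<in> carrier (sect M U) \<longrightarrow> res M V W (res M U V s) = res M U W s) \<and>
     (\<forall>\<V>. (\<forall>V \<in> \<V>. openin (tsp X) V) \<longrightarrow>
        (\<forall>s \<in> carrier (sect M (\<Union>\<V>)). \<forall>t \<in> carrier (sect M (\<Union>\<V>)).
           (\<forall>V \<in> \<V>. res M (\<Union>\<V>) V s = res M (\<Union>\<V>) V t) \<longrightarrow> s = t) \<and>
        (\<forall>\<sigma>. (\<forall>V \<in> \<V>. \<sigma> V \<in> carrier (sect M V)) \<and>
           (\<forall>V \<in> \<V>. \<forall>V' \<in> \<V>. res M V (V \<inter> V') (\<sigma> V) = res M V' (V \<inter> V') (\<sigma> V')) \<longrightarrow>
           (\<exists>s \<in> carrier (sect M (\<Union>\<V>)). \<forall>V \<in> \<V>. res M (\<Union>\<V>) V s = \<sigma> V)))"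

definition stalk_mod ::
  "'p fspace \<Rightarrow> ('p, 's) apresheaf \<Rightarrow> 'p \<Rightarrow>
   (('p set \<times> ('p \<Rightarrow> complex)) set, ('p set \<times> 's) set) module" where
  "stalk_mod X M x =
     ring.extend (stalk (tsp X) M x)
       (module.fields (\<lambda>A B. \<Union>(U, f) \<in> A. \<Union>(V, s) \<in> B.
          germ (tsp X) M x (U \<inter> V) (restrict f (U \<inter> V) \<odot>\<^bsub>sect M (U \<inter> V)\<^esub> res M V (U \<inter> V) s)))"

definition sheaf_hom ::
  "'p fspace \<Rightarrow> ('p, 's) apresheaf \<Rightarrow> ('p, 't) apresheaf \<Rightarrow> ('p set \<Rightarrow> 's \<Rightarrow> 't) \<Rightarrow> bool" where
  "sheaf_hom X M N h \<longleftrightarrow>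
     (\<forall>U. openin (tsp X) U \<longrightarrow> h U \<in> mod_hom (sect (structure_sheaf X) U) (sect M U) (sect N U)) \<and>
     (\<forall>U V s. openin (tsp X) U \<and> openin (tsp X) V \<and> V \<subseteq> U \<and> s \<in> carrier (sect M U) \<longrightarrow>
        h V (res M U V s) = res N U V (h U s))"

definition sheaf_iso ::
  "'p fspace \<Rightarrow> ('p, 's) apresheaf \<Rightarrow> ('p, 't) apresheaf \<Rightarrow> ('p set \<Rightarrow> 's \<Rightarrow> 't) \<Rightarrow> bool" where
  "sheaf_iso X M N h \<longleftrightarrow>
     sheaf_hom X M N h \<and>
     (\<forall>U. openin (tsp X) U \<longrightarrow> bij_betw (h U) (carrier (sect M U)) (carrier (sect N U)))"

subsection \<open>Coherence\<close>

definition finite_type :: "'p fspace \<Rightarrow> ('p, 's) apresheaf \<Rightarrow> bool" where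
  "finite_type X M \<longleftrightarrow>
     (\<forall>x \<in> pts X. \<exists>U (n::nat) s. openin (tsp X) U \<and> x \<in> U \<and> s \<in> {..<n} \<rightarrow> carrier (sect M U) \<and>
        (\<forall>z \<in> U. \<forall>m \<in> carrier (stalk_mod X M z). \<exists>a \<in> {..<n} \<rightarrow> carrier (local_ring X z).
           m = lin_comb (stalk_mod X M z) n a (\<lambda>i. germ (tsp X) M z U (s i))))"

text \<open>For all sections \<open>s\<^sub>0, \<dots>, s\<^bsub>n-1\<^esub>\<close> over an open set \<open>U\<close>, the sheaf of relations between them is
  locally generated by finitely many relations \<open>r\<^sub>0, \<dots>, r\<^bsub>k-1\<^esub>\<close>, where \<open>r\<^sub>j\<close> has the components
  \<open>r j i\<close>.\<close>

definition relation_finite :: "'p fspace \<Rightarrow> ('p, 's) apresheaf \<Rightarrow> bool" where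
  "relation_finite X M \<longleftrightarrow>
     (\<forall>U (n::nat) s. openin (tsp X) U \<and> s \<in> {..<n} \<rightarrow> carrier (sect M U) \<longrightarrow>
       (\<forall>x \<in> U. \<exists>W (k::nat) r. openin (tsp X) W \<and> x \<in> W \<and> W \<subseteq> U \<and>
          (\<forall>j<k. r j \<in> {..<n} \<rightarrow> hol X W \<and>
             lin_comb (sect M W) n (r j) (\<lambda>i. res M U W (s i)) = \<zero>\<^bsub>sect M W\<^esub>) \<and>
          (\<forall>z \<in> W. \<forall>a \<in> {..<n} \<rightarrow> carrier (local_ring X z).
             lin_comb (stalk_mod X M z) n a (\<lambda>i. germ (tsp X) M z U (s i)) = \<zero>\<^bsub>stalk_mod X M z\<^esub> \<longrightarrow>
             (\<exists>c \<in> {..<k} \<rightarrow> carrier (local_ring X z). \<forall>i<n.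
                a i = (\<Oplus>\<^bsub>local_ring X z\<^esub>j \<in> {..<k}.
                         c j \<otimes>\<^bsub>local_ring X z\<^esub> germ_fun X z W (r j i))))))"

definition coherent_sheaf :: "'p fspace \<Rightarrow> ('p, 's) apresheaf \<Rightarrow> bool" where
  "coherent_sheaf X M \<longleftrightarrow> analytic_sheaf X M \<and> finite_type X M \<and> relation_finite X M"

subsection \<open>Sheaves of sections in families of modules\<close>

text \<open>Given a module \<open>E y\<close> over \<open>\<O>\<^bsub>Y,y\<^esub>\<close> for each point \<open>y\<close> and sets \<open>\<Gamma> W\<close> of distinguished maps,
  the sheaf of those maps \<open>s\<close> with \<open>s y \<in> E y\<close> that locally coincide with distinguished ones. With
  \<open>\<Gamma>\<close> coming from a presheaf with stalks \<open>E y\<close>, this is the associated sheaf.\<close>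

definition section_sheaf ::
  "'q fspace \<Rightarrow> ('q \<Rightarrow> (('q set \<times> ('q \<Rightarrow> complex)) set, 'e) module) \<Rightarrow> ('q set \<Rightarrow> ('q \<Rightarrow> 'e) set) \<Rightarrow>
   ('q, 'q \<Rightarrow> 'e) apresheaf" where
  "section_sheaf Y E \<Gamma> =
     \<lparr>sect = (\<lambda>V.
        \<lparr>carrier = {s \<in> PiE V (\<lambda>y. carrier (E y)). \<forall>y \<in> V. \<exists>W t.
                     openin (tsp Y) W \<and> y \<in> W \<and> W \<subseteq> V \<and> t \<in> \<Gamma> W \<and> (\<forall>z \<in> W. s z = t z)},
         mult = undefined, one = undefined,
         ring.zero = (\<lambda>y\<in>V. \<zero>\<^bsub>E y\<^esub>),
         add = (\<lambda>s t. \<lambda>y\<in>V. s y \<oplus>\<^bsub>E y\<^esub> t y),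
         smult = (\<lambda>f s. \<lambda>y\<in>V. germ_fun Y y V f \<odot>\<^bsub>E y\<^esub> s y)\<rparr>),
      res = (\<lambda>U V s. restrict s V)\<rparr>"

subsection \<open>Quotients and torsion\<close>

definition sub_stalk ::
  "'p fspace \<Rightarrow> ('p, 's) apresheaf \<Rightarrow> ('p set \<Rightarrow> 's set) \<Rightarrow> 'p \<Rightarrow> ('p set \<times> 's) set set" where
  "sub_stalk X M N x = {germ (tsp X) M x U s | U s. openin (tsp X) U \<and> x \<in> U \<and> s \<in> N U}"

definition quot_proj ::
  "'p fspace \<Rightarrow> ('p, 's) apresheaf \<Rightarrow> ('p set \<Rightarrow> 's set) \<Rightarrow> 'p set \<Rightarrow> 's \<Rightarrow>
   'p \<Rightarrow> ('p set \<times> 's) set set" where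
  "quot_proj X M N U s = (\<lambda>x\<in>U. sub_stalk X M N x +>\<^bsub>stalk_mod X M x\<^esub> germ (tsp X) M x U s)"

definition quot_sheaf ::
  "'p fspace \<Rightarrow> ('p, 's) apresheaf \<Rightarrow> ('p set \<Rightarrow> 's set) \<Rightarrow>
   ('p, 'p \<Rightarrow> ('p set \<times> 's) set set) apresheaf" where
  "quot_sheaf X M N =
     section_sheaf X (\<lambda>x. quot_mod (stalk_mod X M x) (sub_stalk X M N x))
       (\<lambda>W. quot_proj X M N W ` carrier (sect M W))"

definition torsion_sub :: "'p fspace \<Rightarrow> ('p, 's) apresheaf \<Rightarrow> 'p set \<Rightarrow> 's set" where
  "torsion_sub X M U =
     {s \<in> carrier (sect M U).
        \<forall>x \<in> U. germ (tsp X) M x U s \<in> torsion_elems (local_ring X x) (stalk_mod X M x)}"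

definition torsion_free :: "'p fspace \<Rightarrow> ('p, 's) apresheaf \<Rightarrow> bool" where
  "torsion_free X M \<longleftrightarrow>
     (\<forall>x \<in> pts X. torsion_elems (local_ring X x) (stalk_mod X M x) = {\<zero>\<^bsub>stalk_mod X M x\<^esub>})"

subsection \<open>Direct and inverse images\<close>

definition direct_image :: "'q fspace \<Rightarrow> ('q \<Rightarrow> 'p) \<Rightarrow> ('q, 's) apresheaf \<Rightarrow> ('p, 's) apresheaf" where
  "direct_image Y \<psi> M =
     \<lparr>sect = (\<lambda>U. let S = sect M (preim Y \<psi> U) in
        \<lparr>carrier = carrier S, mult = mult S, one = one S, ring.zero = ring.zero S, add = add S,
         smult = (\<lambda>f s. pull Y \<psi> U f \<odot>\<^bsub>S\<^esub> s)\<rparr>),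
      res = (\<lambda>U V. res M (preim Y \<psi> U) (preim Y \<psi> V))\<rparr>"

text \<open>The stalk \<open>G\<^bsub>\<psi>(y)\<^esub> \<otimes> \<O>\<^bsub>Y,y\<^esub>\<close> (over \<open>\<O>\<^bsub>X,\<psi>(y)\<^esub>\<close>) of the analytic inverse image, and its
  elements.\<close>

definition inv_stalk ::
  "'q fspace \<Rightarrow> 'p fspace \<Rightarrow> ('q \<Rightarrow> 'p) \<Rightarrow> ('p, 's) apresheaf \<Rightarrow> 'q \<Rightarrow>
   (('q set \<times> ('q \<Rightarrow> complex)) set,
    (('p set \<times> 's) set \<times> ('q set \<times> ('q \<Rightarrow> complex)) set \<Rightarrow>\<^sub>0 int) set) module" where
  "inv_stalk Y X \<psi> G y =
     base_change (local_ring X (\<psi> y)) (local_ring Y y) (comorphism Y \<psi> y) (stalk_mod X G (\<psi> y))"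

definition inv_class ::
  "'q fspace \<Rightarrow> 'p fspace \<Rightarrow> ('q \<Rightarrow> 'p) \<Rightarrow> ('p, 's) apresheaf \<Rightarrow> 'q \<Rightarrow>
   (('p set \<times> 's) set \<times> ('q set \<times> ('q \<Rightarrow> complex)) set \<Rightarrow>\<^sub>0 int) \<Rightarrow>
   (('p set \<times> 's) set \<times> ('q set \<times> ('q \<Rightarrow> complex)) set \<Rightarrow>\<^sub>0 int) set" where
  "inv_class Y X \<psi> G y =
     tensor_class (local_ring X (\<psi> y)) (local_ring Y y) (comorphism Y \<psi> y) (stalk_mod X G (\<psi> y))"

text \<open>The analytic inverse image \<open>\<psi>\<^sup>*G\<close>, i.e. the inverse image sheaf of \<open>G\<close> tensored with \<open>\<O>\<^sub>Y\<close>: its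
  sections are locally given by finite sums of tensors \<open>g \<otimes> a\<close> with sections \<open>g\<close> of \<open>G\<close> and \<open>a\<close> of
  \<open>\<O>\<^sub>Y\<close>.\<close>

definition inverse_image ::
  "'q fspace \<Rightarrow> 'p fspace \<Rightarrow> ('q \<Rightarrow> 'p) \<Rightarrow> ('p, 's) apresheaf \<Rightarrow>
   ('q, 'q \<Rightarrow> (('p set \<times> 's) set \<times> ('q set \<times> ('q \<Rightarrow> complex)) set \<Rightarrow>\<^sub>0 int) set) apresheaf" where
  "inverse_image Y X \<psi> G =
     section_sheaf Y (inv_stalk Y X \<psi> G)
       (\<lambda>W. {\<lambda>z. inv_class Y X \<psi> G z
                   (\<Sum>(g, a) \<leftarrow> gas. frag_of (germ (tsp X) G (\<psi> z) U g, germ_fun Y z W a)) | U gas.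
              openin (tsp X) U \<and> W \<subseteq> preim Y \<psi> U \<and> set gas \<subseteq> carrier (sect G U) \<times> hol Y W})"

text \<open>The torsion-free preimage \<open>\<psi>\<^sup>TG\<close>.\<close>

definition tf_preimage ::
  "'q fspace \<Rightarrow> 'p fspace \<Rightarrow> ('q \<Rightarrow> 'p) \<Rightarrow> ('p, 's) apresheaf \<Rightarrow>
   ('q, 'q \<Rightarrow> ('q set \<times>
      ('q \<Rightarrow> (('p set \<times> 's) set \<times> ('q set \<times> ('q \<Rightarrow> complex)) set \<Rightarrow>\<^sub>0 int) set)) set set) apresheaf" where
  "tf_preimage Y X \<psi> G =
     quot_sheaf Y (inverse_image Y X \<psi> G) (torsion_sub Y (inverse_image Y X \<psi> G))"

definition tf_proj ::
  "'q fspace \<Rightarrow> 'p fspace \<Rightarrow> ('q \<Rightarrow> 'p) \<Rightarrow> ('p, 's) apresheaf \<Rightarrow> 'q set \<Rightarrow>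
   ('q \<Rightarrow> (('p set \<times> 's) set \<times> ('q set \<times> ('q \<Rightarrow> complex)) set \<Rightarrow>\<^sub>0 int) set) \<Rightarrow>
   'q \<Rightarrow> ('q set \<times>
      ('q \<Rightarrow> (('p set \<times> 's) set \<times> ('q set \<times> ('q \<Rightarrow> complex)) set \<Rightarrow>\<^sub>0 int) set)) set set" where
  "tf_proj Y X \<psi> G =
     quot_proj Y (inverse_image Y X \<psi> G) (torsion_sub Y (inverse_image Y X \<psi> G))"

subsection \<open>The canonical morphism\<close>

text \<open>The map \<open>(\<psi>\<^sub>*F)\<^bsub>\<psi>(y)\<^esub> \<rightarrow> F\<^sub>y\<close>.\<close>

definition direct_stalk_map ::
  "'q fspace \<Rightarrow> ('q \<Rightarrow> 'p) \<Rightarrow> ('q, 's) apresheaf \<Rightarrow> 'q \<Rightarrow> ('p set \<times> 's) set \<Rightarrow> ('q set \<times> 's) set" where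
  "direct_stalk_map Y \<psi> F y A = (\<Union>(U, s) \<in> A. germ (tsp Y) F y (preim Y \<psi> U) s)"

text \<open>On stalks, the canonical morphism \<open>\<psi>\<^sup>*\<psi>\<^sub>*F \<rightarrow> F\<close> sends \<open>m \<otimes> a\<close> to \<open>a\<close> times the image of \<open>m\<close>
  in \<open>F\<^sub>y\<close>.\<close>

definition canonical_stalk ::
  "'q fspace \<Rightarrow> ('q \<Rightarrow> 'p) \<Rightarrow> ('q, 's) apresheaf \<Rightarrow> 'q \<Rightarrow>
   (('p set \<times> 's) set \<times> ('q set \<times> ('q \<Rightarrow> complex)) set \<Rightarrow>\<^sub>0 int) set \<Rightarrow> ('q set \<times> 's) set" where
  "canonical_stalk Y \<psi> F y C =
     (let N = stalk_mod Y F y in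
      the_elem ((\<lambda>f. \<Oplus>\<^bsub>N\<^esub>p \<in> Poly_Mapping.keys f.
                   add_pow N (Poly_Mapping.lookup f p) (snd p \<odot>\<^bsub>N\<^esub> direct_stalk_map Y \<psi> F y (fst p))) ` C))"

definition canonical_morphism ::
  "'q fspace \<Rightarrow> ('q \<Rightarrow> 'p) \<Rightarrow> ('q, 's) apresheaf \<Rightarrow> 'q set \<Rightarrow>
   ('q \<Rightarrow> (('p set \<times> 's) set \<times> ('q set \<times> ('q \<Rightarrow> complex)) set \<Rightarrow>\<^sub>0 int) set) \<Rightarrow> 's" where
  "canonical_morphism Y \<psi> F V s =
     (THE t. t \<in> carrier (sect F V) \<and>
        (\<forall>y \<in> V. germ (tsp Y) F y V t = canonical_stalk Y \<psi> F y (s y)))"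

end

theory Submission
  imports Defs
begin

text \<open>Let \<open>R = \<O>\<^bsub>X,\<psi>(y)\<^esub>\<close>, a domain. The stalk of \<open>\<psi>\<^sub>*\<O>\<^sub>Y\<close> at \<open>\<psi>(y)\<close> is the integral closure of \<open>R\<close> in its field of
  fractions, hence also a domain. Since indicator functions of disjoint parts of a fibre are zero
  divisors, \<open>\<psi>\<close> is injective, and being closed it makes the sets \<open>\<psi>\<^sup>-\<^sup>1(U)\<close> a neighbourhood base at \<open>y\<close>;
  this identifies the stalk of \<open>\<psi>\<^sub>*F\<close> at \<open>\<psi>(y)\<close> with \<open>F\<^sub>y\<close> and that of \<open>\<psi>\<^sub>*\<O>\<^sub>Y\<close> with \<open>\<O>\<^bsub>Y,y\<^esub>\<close>. So \<open>m \<otimes> 1\<close> maps to \<open>m\<close>, and the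
  canonical morphism is locally surjective. A nonzero \<open>b \<in> R\<close> clearing the denominators of the \<open>a\<^sub>i\<close> in
  \<open>\<Sum> m\<^sub>i \<otimes> a\<^sub>i\<close> gives \<open>b \<Sum> m\<^sub>i \<otimes> a\<^sub>i = (b \<Sum> a\<^sub>i m\<^sub>i) \<otimes> 1\<close>, so the kernel consists of torsion; since \<open>F\<close> is torsion-free,
  it is exactly the torsion.\<close>

section \<open>Presheaves and their stalks\<close>

text \<open>The passage between stalks and sheaves shapes the argument. The stalks of the inverse
  image occur in two forms, as tensor products \<open>tstalk y\<close> and as germs of sections of
  \<open>IF\<close>, and torsion is defined by the second. An identity at the single point
  \<open>y\<close> is therefore too weak: clearing denominators must give an equation at all points
  of some \<open>pre V\<close>, while the denominator \<open>b\<close> has to be a nonzero germ at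
  \<psi> y only, because torsion is tested one point at a time.

  A second obstacle is the algebra of sections. The rings of sections on the normalization come with
  the module structure of \<open>F\<close>; on \<open>X\<close> itself products of holomorphic
  functions are constructed through charts. Base change is accordingly developed for an
  \<open>M\<close> that is merely closed under its operations, and the direct image is treated as an
  additive presheaf with a compatible scalar action.

  The isomorphism of sheaves is assembled from stalk maps: a section is determined by its germs, and
  a family of germs that is locally induced by sections comes from a section.\<close>

locale presheaf_on =
  fixes T :: "'p topology" and P :: "('p, 's, ('s, 'm) ring_scheme) presheaf"
  assumes res_closed: "\<lbrakk>openin T U; openin T V; V \<subseteq> U; s \<in> carrier (sect P U)\<rbrakk>
      \<Longrightarrow> res P U V s \<in> carrier (sect P V)"
    and res_res: "\<lbrakk>openin T U; openin T V; openin T W; W \<subseteq> V; V \<subseteq> U; s \<in> carrier (sect P U)\<rbrakk>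
      \<Longrightarrow> res P V W (res P U V s) = res P U W s"
begin

lemma germ_self:
  "\<lbrakk>openin T U; x \<in> U; s \<in> carrier (sect P U)\<rbrakk> \<Longrightarrow> (U, s) \<in> germ T P x U s"
  unfolding germ_def by auto

lemma germ_memD:
  assumes "(V, t) \<in> germ T P x U s"
  obtains W where "openin T V" "x \<in> V" "t \<in> carrier (sect P V)"
    "openin T W" "x \<in> W" "W \<subseteq> U" "W \<subseteq> V" "res P U W s = res P V W t"
  using assms unfolding germ_def by auto

text \<open>A germ is the set of all its representatives, so two inclusions are needed, and they are
  symmetric. A representative that agrees with \<open>s\<close> on \<open>W1\<close> agrees with
  \<open>t\<close> on \<open>W \<inter> W1\<close>.\<close>

lemma germ_eqI:
  assumes "openin T U" "openin T V" "openin T W" "x \<in> W" "W \<subseteq> U" "W \<subseteq> V"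
    and s: "s \<in> carrier (sect P U)" and t: "t \<in> carrier (sect P V)"
    and eq: "res P U W s = res P V W t"
  shows "germ T P x U s = germ T P x V t"
proof -
  have sub: "germ T P x U s \<subseteq> germ T P x V t"
    if "openin T U" "openin T V" "W \<subseteq> U" "W \<subseteq> V"
      "s \<in> carrier (sect P U)" "t \<in> carrier (sect P V)" "res P U W s = res P V W t" for U V s t
  proof (rule subsetI, clarify)
    fix A a assume "(A, a) \<in> germ T P x U s"
    then obtain W1 where W1: "openin T A" "x \<in> A" "a \<in> carrier (sect P A)" "openin T W1" "x \<in> W1"
      "W1 \<subseteq> U" "W1 \<subseteq> A" "res P U W1 s = res P A W1 a"
      by (rule germ_memD)
    let ?W = "W \<inter> W1"
    have "openin T ?W" using assms(3) W1(4) by auto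
    moreover have "res P V ?W t = res P W ?W (res P V W t)"
      using res_res[of V W ?W t] that assms(3) \<open>openin T ?W\<close> by simp
    moreover have "\<dots> = res P U ?W s"
      using res_res[of U W ?W s] that assms(3) \<open>openin T ?W\<close> by simp
    moreover have "\<dots> = res P W1 ?W (res P U W1 s)"
      using res_res[of U W1 ?W s] that W1 \<open>openin T ?W\<close> by simp
    moreover have "\<dots> = res P A ?W a"
      using res_res[of A W1 ?W a] W1 \<open>openin T ?W\<close> by simp
    ultimately show "(A, a) \<in> germ T P x V t"
      unfolding germ_def using W1 assms(4) that by (auto intro!: exI[of _ ?W])
  qed
  show ?thesis
    using sub[of U V s t] sub[of V U t s] assms by auto
qed

lemma germ_eqD:
  assumes "openin T V" "x \<in> V" "t \<in> carrier (sect P V)" "germ T P x U s = germ T P x V t"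
  obtains W where "openin T W" "x \<in> W" "W \<subseteq> U" "W \<subseteq> V" "res P U W s = res P V W t"
  using germ_self[OF assms(1-3)] assms(4) germ_memD by metis

lemma germ_res:
  assumes "openin T U" "openin T V" "V \<subseteq> U" "x \<in> V" "s \<in> carrier (sect P U)"
  shows "germ T P x V (res P U V s) = germ T P x U s"
  using assms res_closed[of U V s] res_res[of U V V s]
  by (intro germ_eqI[where W = V]) auto

lemma germ_closed:
  "\<lbrakk>openin T U; x \<in> U; s \<in> carrier (sect P U)\<rbrakk> \<Longrightarrow> germ T P x U s \<in> carrier (stalk T P x)"
  unfolding stalk_def by auto

lemma stalk_cases:
  assumes "A \<in> carrier (stalk T P x)"
  obtains U s where "openin T U" "x \<in> U" "s \<in> carrier (sect P U)" "A = germ T P x U s"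
  using assms unfolding stalk_def by auto

lemma stalk_cases_within:
  assumes "A \<in> carrier (stalk T P x)" "openin T W" "x \<in> W"
  obtains U s where "openin T U" "x \<in> U" "U \<subseteq> W" "s \<in> carrier (sect P U)" "A = germ T P x U s"
proof -
  obtain U s where U: "openin T U" "x \<in> U" "s \<in> carrier (sect P U)" "A = germ T P x U s"
    using assms(1) by (rule stalk_cases)
  show ?thesis
    using U assms(2,3) that[of "U \<inter> W" "res P U (U \<inter> W) s"] germ_res[of U "U \<inter> W" x s]
      res_closed[of U "U \<inter> W" s]
    by auto
qed

lemma stalk_cases2:
  assumes "A \<in> carrier (stalk T P x)" "B \<in> carrier (stalk T P x)"
  obtains U s t where "openin T U" "x \<in> U" "s \<in> carrier (sect P U)" "t \<in> carrier (sect P U)"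
    "A = germ T P x U s" "B = germ T P x U t"
proof -
  obtain V s where V: "openin T V" "x \<in> V" "s \<in> carrier (sect P V)" "A = germ T P x V s"
    using assms(1) by (rule stalk_cases)
  obtain U t where U: "openin T U" "x \<in> U" "U \<subseteq> V" "t \<in> carrier (sect P U)" "B = germ T P x U t"
    using assms(2) V(1,2) by (rule stalk_cases_within)
  show ?thesis
    using that[of U "res P V U s" t] U V germ_res[of V U x s] res_closed[of V U s] by auto
qed

text \<open>Associativity and distributivity involve three elements. With a common domain, each law
  of the stalk reduces to the same law for sections over one open set.\<close>

lemma stalk_cases3:
  assumes "A \<in> carrier (stalk T P x)" "B \<in> carrier (stalk T P x)" "C \<in> carrier (stalk T P x)"
  obtains U s t u where "openin T U" "x \<in> U" "s \<in> carrier (sect P U)" "t \<in> carrier (sect P U)"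
    "u \<in> carrier (sect P U)" "A = germ T P x U s" "B = germ T P x U t" "C = germ T P x U u"
proof -
  obtain V s t where V: "openin T V" "x \<in> V" "s \<in> carrier (sect P V)" "t \<in> carrier (sect P V)"
    "A = germ T P x V s" "B = germ T P x V t"
    using assms(1,2) by (rule stalk_cases2)
  obtain U u where U: "openin T U" "x \<in> U" "U \<subseteq> V" "u \<in> carrier (sect P U)" "C = germ T P x U u"
    using assms(3) V(1,2) by (rule stalk_cases_within)
  show ?thesis
    using that[of U "res P V U s" "res P V U t" u] U V germ_res[of V U x s] germ_res[of V U x t]
      res_closed[of V U s] res_closed[of V U t] by auto
qed

end

lemma Union_pair_const:
  assumes "(a, b) \<in> A" "\<And>x y. (x, y) \<in> A \<Longrightarrow> f x y = c"
  shows "(\<Union>(x, y) \<in> A. f x y) = c"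
  using assms by (auto split: prod.splits)

text \<open>The two following lemmas evaluate the unions over representatives in terms of which the
  operations on germs are defined.\<close>

lemma germ_map:
  assumes "presheaf_on T P" "presheaf_on S Q"
    and U: "openin T U" "x \<in> U" "s \<in> carrier (sect P U)"
    and p: "\<And>V. openin T V \<Longrightarrow> openin S (p V)" "\<And>V. x \<in> V \<Longrightarrow> y \<in> p V"
      "\<And>V W. W \<subseteq> V \<Longrightarrow> p W \<subseteq> p V"
    and k: "\<And>V t. \<lbrakk>openin T V; t \<in> carrier (sect P V)\<rbrakk> \<Longrightarrow> k V t \<in> carrier (sect Q (p V))"
      "\<And>V W t. \<lbrakk>openin T V; openin T W; W \<subseteq> V; t \<in> carrier (sect P V)\<rbrakk>
        \<Longrightarrow> res Q (p V) (p W) (k V t) = k W (res P V W t)"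
  shows "(\<Union>(V, t) \<in> germ T P x U s. germ S Q y (p V) (k V t)) = germ S Q y (p U) (k U s)"
proof -
  interpret P: presheaf_on T P by fact
  interpret Q: presheaf_on S Q by fact
  have "germ S Q y (p V) (k V t) = germ S Q y (p U) (k U s)" if Vt: "(V, t) \<in> germ T P x U s" for V t
  proof -
    from Vt obtain W where W: "openin T V" "x \<in> V" "t \<in> carrier (sect P V)"
      "openin T W" "x \<in> W" "W \<subseteq> U" "W \<subseteq> V" "res P U W s = res P V W t"
      by (rule P.germ_memD)
    show ?thesis
      using W U p k by (intro Q.germ_eqI[where W = "p W"]) auto
  qed
  then show ?thesis
    using P.germ_self[OF U] by (intro Union_pair_const)
qed

lemma germ_op:
  assumes "presheaf_on T P" "presheaf_on T Q" "presheaf_on T N"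
    and U: "openin T U" "x \<in> U" "s \<in> carrier (sect P U)" "t \<in> carrier (sect Q U)"
    and op: "\<And>V a b. \<lbrakk>openin T V; a \<in> carrier (sect P V); b \<in> carrier (sect Q V)\<rbrakk>
        \<Longrightarrow> f V a b \<in> carrier (sect N V)"
      "\<And>V W a b. \<lbrakk>openin T V; openin T W; W \<subseteq> V; a \<in> carrier (sect P V); b \<in> carrier (sect Q V)\<rbrakk>
        \<Longrightarrow> res N V W (f V a b) = f W (res P V W a) (res Q V W b)"
  shows "(\<Union>(V, a) \<in> germ T P x U s. \<Union>(V', b) \<in> germ T Q x U t.
      germ T N x (V \<inter> V') (f (V \<inter> V') (res P V (V \<inter> V') a) (res Q V' (V \<inter> V') b))) =
    germ T N x U (f U s t)"
proof -
  interpret P: presheaf_on T P by fact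
  interpret Q: presheaf_on T Q by fact
  interpret N: presheaf_on T N by fact
  have *: "germ T N x (V \<inter> V') (f (V \<inter> V') (res P V (V \<inter> V') a) (res Q V' (V \<inter> V') b)) =
      germ T N x U (f U s t)"
    if a: "(V, a) \<in> germ T P x U s" and b: "(V', b) \<in> germ T Q x U t" for V a V' b
  proof -
    from a obtain W where W: "openin T V" "x \<in> V" "a \<in> carrier (sect P V)"
      "openin T W" "x \<in> W" "W \<subseteq> U" "W \<subseteq> V" "res P U W s = res P V W a"
      by (rule P.germ_memD)
    from b obtain W' where W': "openin T V'" "x \<in> V'" "b \<in> carrier (sect Q V')"
      "openin T W'" "x \<in> W'" "W' \<subseteq> U" "W' \<subseteq> V'" "res Q U W' t = res Q V' W' b"
      by (rule Q.germ_memD)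
    let ?V = "V \<inter> V'" and ?W = "W \<inter> W'"
    have op': "openin T ?V" "openin T ?W" using W W' by auto
    have 1: "res P ?V ?W (res P V ?V a) = res P U ?W s"
      using P.res_res[of V ?V ?W a] P.res_res[of V W ?W a] P.res_res[of U W ?W s] W W' U op'
      by (simp add: le_infI1 le_infI2)
    have 2: "res Q ?V ?W (res Q V' ?V b) = res Q U ?W t"
      using Q.res_res[of V' ?V ?W b] Q.res_res[of V' W' ?W b] Q.res_res[of U W' ?W t] W W' U op'
      by (simp add: le_infI1 le_infI2)
    have c: "res P V ?V a \<in> carrier (sect P ?V)" "res Q V' ?V b \<in> carrier (sect Q ?V)"
      using P.res_closed[of V ?V a] Q.res_closed[of V' ?V b] W W' op' by auto
    have sub: "?W \<subseteq> ?V" "?W \<subseteq> U" "x \<in> ?W" using W W' by auto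
    have "res N ?V ?W (f ?V (res P V ?V a) (res Q V' ?V b)) = res N U ?W (f U s t)"
      using op(2)[OF op' sub(1) c] op(2)[OF U(1) op'(2) sub(2) U(3,4)] 1 2 by simp
    then show ?thesis
      using N.germ_eqI[OF op'(1) U(1) op'(2) sub(3) sub(1,2)] op(1)[OF op'(1) c] op(1)[OF U(1,3,4)]
      by simp
  qed
  have U': "(U, s) \<in> germ T P x U s" "(U, t) \<in> germ T Q x U t"
    using U P.germ_self Q.germ_self by auto
  show ?thesis
    by (intro Union_pair_const[OF U'(1)] Union_pair_const[OF U'(2)] *)
qed

section \<open>Stalks of presheaves of abelian groups and of commutative rings\<close>

locale additive_presheaf = presheaf_on +
  assumes abelian_sect: "openin T U \<Longrightarrow> abelian_group (sect P U)"
    and res_add: "\<lbrakk>openin T U; openin T V; V \<subseteq> U; s \<in> carrier (sect P U); t \<in> carrier (sect P U)\<rbrakk>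
      \<Longrightarrow> res P U V (s \<oplus>\<^bsub>sect P U\<^esub> t) = res P U V s \<oplus>\<^bsub>sect P V\<^esub> res P U V t"
begin

lemma add_sect_closed:
  "\<lbrakk>openin T U; s \<in> carrier (sect P U); t \<in> carrier (sect P U)\<rbrakk> \<Longrightarrow> s \<oplus>\<^bsub>sect P U\<^esub> t \<in> carrier (sect P U)"
  by (simp add: abelian_sect abelian_group.axioms(1) abelian_monoid.a_closed)

lemma zero_sect_closed: "openin T U \<Longrightarrow> \<zero>\<^bsub>sect P U\<^esub> \<in> carrier (sect P U)"
  by (simp add: abelian_sect abelian_group.axioms(1) abelian_monoid.zero_closed)

text \<open>Restriction is assumed additive, which makes the restriction of zero idempotent under
  addition; cancellation in the group over \<open>V\<close> then gives zero.\<close>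

lemma res_zero:
  assumes "openin T U" "openin T V" "V \<subseteq> U"
  shows "res P U V \<zero>\<^bsub>sect P U\<^esub> = \<zero>\<^bsub>sect P V\<^esub>"
proof -
  interpret U: abelian_group "sect P U" using assms(1) by (rule abelian_sect)
  interpret V: abelian_group "sect P V" using assms(2) by (rule abelian_sect)
  have "res P U V \<zero>\<^bsub>sect P U\<^esub> \<oplus>\<^bsub>sect P V\<^esub> res P U V \<zero>\<^bsub>sect P U\<^esub> = res P U V \<zero>\<^bsub>sect P U\<^esub>"
    using res_add[OF assms U.zero_closed U.zero_closed] by simp
  then show ?thesis
    using res_closed[OF assms U.zero_closed] by (metis V.add.r_cancel_one)
qed

lemma germ_add:
  assumes "openin T U" "x \<in> U" "s \<in> carrier (sect P U)" "t \<in> carrier (sect P U)"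
  shows "germ T P x U s \<oplus>\<^bsub>stalk T P x\<^esub> germ T P x U t = germ T P x U (s \<oplus>\<^bsub>sect P U\<^esub> t)"
  unfolding stalk_def ring.simps
  using assms presheaf_on_axioms add_sect_closed res_add
  by (intro germ_op[where f = "\<lambda>U. add (sect P U)"]) auto

lemma germ_zero:
  assumes "openin T U" "x \<in> U"
  shows "germ T P x U \<zero>\<^bsub>sect P U\<^esub> = \<zero>\<^bsub>stalk T P x\<^esub>"
proof -
  have "germ T P x U (res P (topspace T) U \<zero>\<^bsub>sect P (topspace T)\<^esub>) = \<zero>\<^bsub>stalk T P x\<^esub>"
    unfolding stalk_def ring.simps using assms
    by (intro germ_res) (auto simp: zero_sect_closed openin_subset)
  then show ?thesis
    using assms res_zero[of "topspace T" U] by (simp add: openin_subset)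
qed

lemma germ_eq_zeroD:
  assumes "germ T P x U s = \<zero>\<^bsub>stalk T P x\<^esub>" "openin T U" "x \<in> U" "s \<in> carrier (sect P U)"
  obtains W where "openin T W" "x \<in> W" "W \<subseteq> U" "res P U W s = \<zero>\<^bsub>sect P W\<^esub>"
proof -
  have "germ T P x U s = germ T P x U \<zero>\<^bsub>sect P U\<^esub>"
    using assms by (simp add: germ_zero)
  then obtain W where "openin T W" "x \<in> W" "W \<subseteq> U" "res P U W s = res P U W \<zero>\<^bsub>sect P U\<^esub>"
    using assms(2,3) zero_sect_closed by (elim germ_eqD[rotated 3]) auto
  then show ?thesis
    using that res_zero assms(2) by metis
qed

lemma stalk_abelian:
  assumes "x \<in> topspace T"
  shows "abelian_group (stalk T P x)"
proof (rule abelian_groupI)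
  fix A B C assume A: "A \<in> carrier (stalk T P x)" and B: "B \<in> carrier (stalk T P x)"
    and C: "C \<in> carrier (stalk T P x)"
  obtain U s t u where U: "openin T U" "x \<in> U" "s \<in> carrier (sect P U)" "t \<in> carrier (sect P U)"
    "u \<in> carrier (sect P U)" "A = germ T P x U s" "B = germ T P x U t" "C = germ T P x U u"
    using A B C by (rule stalk_cases3)
  interpret U: abelian_group "sect P U" using U(1) by (rule abelian_sect)
  show "A \<oplus>\<^bsub>stalk T P x\<^esub> B \<in> carrier (stalk T P x)"
    using U by (simp add: germ_add germ_closed)
  show "A \<oplus>\<^bsub>stalk T P x\<^esub> B \<oplus>\<^bsub>stalk T P x\<^esub> C = A \<oplus>\<^bsub>stalk T P x\<^esub> (B \<oplus>\<^bsub>stalk T P x\<^esub> C)"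
    using U by (simp add: germ_add U.a_assoc)
  show "A \<oplus>\<^bsub>stalk T P x\<^esub> B = B \<oplus>\<^bsub>stalk T P x\<^esub> A"
    using U by (simp add: germ_add U.a_comm)
  show "\<zero>\<^bsub>stalk T P x\<^esub> \<oplus>\<^bsub>stalk T P x\<^esub> A = A"
    using U germ_zero[of U x, symmetric] by (simp add: germ_add)
  show "\<exists>D\<in>carrier (stalk T P x). D \<oplus>\<^bsub>stalk T P x\<^esub> A = \<zero>\<^bsub>stalk T P x\<^esub>"
    using U germ_zero[of U x, symmetric]
    by (intro bexI[of _ "germ T P x U (\<ominus>\<^bsub>sect P U\<^esub> s)"]) (simp_all add: germ_add germ_closed U.l_neg)
next
  show "\<zero>\<^bsub>stalk T P x\<^esub> \<in> carrier (stalk T P x)"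
    using germ_zero[of "topspace T" x] germ_closed[of "topspace T" x] zero_sect_closed assms
    by (metis openin_topspace)
qed

end

text \<open>Products are separated from addition because for the structure sheaf of the base
  \<open>X\<close> it is closure under products that gets established (\<open>hol_mult\<close>).
  This is enough to multiply germs and to form common denominators.\<close>

locale multiplicative_presheaf = presheaf_on +
  assumes mult_sect_closed: "\<lbrakk>openin T U; s \<in> carrier (sect P U); t \<in> carrier (sect P U)\<rbrakk>
      \<Longrightarrow> s \<otimes>\<^bsub>sect P U\<^esub> t \<in> carrier (sect P U)"
    and res_mult: "\<lbrakk>openin T U; openin T V; V \<subseteq> U; s \<in> carrier (sect P U); t \<in> carrier (sect P U)\<rbrakk>
      \<Longrightarrow> res P U V (s \<otimes>\<^bsub>sect P U\<^esub> t) = res P U V s \<otimes>\<^bsub>sect P V\<^esub> res P U V t"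
begin

lemma germ_mult:
  assumes "openin T U" "x \<in> U" "s \<in> carrier (sect P U)" "t \<in> carrier (sect P U)"
  shows "germ T P x U s \<otimes>\<^bsub>stalk T P x\<^esub> germ T P x U t = germ T P x U (s \<otimes>\<^bsub>sect P U\<^esub> t)"
  unfolding stalk_def monoid.simps
  using assms presheaf_on_axioms mult_sect_closed res_mult
  by (intro germ_op[where f = "\<lambda>U. mult (sect P U)"]) auto

end

locale ring_presheaf = additive_presheaf + multiplicative_presheaf +
  assumes cring_sect: "openin T U \<Longrightarrow> cring (sect P U)"
    and res_one: "\<lbrakk>openin T U; openin T V; V \<subseteq> U\<rbrakk> \<Longrightarrow> res P U V \<one>\<^bsub>sect P U\<^esub> = \<one>\<^bsub>sect P V\<^esub>"
begin

lemma one_sect_closed: "openin T U \<Longrightarrow> \<one>\<^bsub>sect P U\<^esub> \<in> carrier (sect P U)"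
  using cring_sect[of U] by (simp add: cring.cring_simprules)

lemma germ_one:
  assumes "openin T U" "x \<in> U"
  shows "germ T P x U \<one>\<^bsub>sect P U\<^esub> = \<one>\<^bsub>stalk T P x\<^esub>"
proof -
  have "germ T P x U (res P (topspace T) U \<one>\<^bsub>sect P (topspace T)\<^esub>) = \<one>\<^bsub>stalk T P x\<^esub>"
    unfolding stalk_def monoid.simps using assms
    by (intro germ_res) (auto simp: one_sect_closed openin_subset)
  then show ?thesis
    using assms res_one[of "topspace T" U] by (simp add: openin_subset)
qed

lemma stalk_cring:
  assumes "x \<in> topspace T"
  shows "cring (stalk T P x)"
proof (rule cringI)
  show "abelian_group (stalk T P x)" using assms by (rule stalk_abelian)
  show "Group.comm_monoid (stalk T P x)"
  proof (rule comm_monoidI)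
    fix A B C assume A: "A \<in> carrier (stalk T P x)" and B: "B \<in> carrier (stalk T P x)"
      and C: "C \<in> carrier (stalk T P x)"
    obtain U s t u where U: "openin T U" "x \<in> U" "s \<in> carrier (sect P U)" "t \<in> carrier (sect P U)"
      "u \<in> carrier (sect P U)" "A = germ T P x U s" "B = germ T P x U t" "C = germ T P x U u"
      using A B C by (rule stalk_cases3)
    interpret U: cring "sect P U" using U(1) by (rule cring_sect)
    show "A \<otimes>\<^bsub>stalk T P x\<^esub> B \<in> carrier (stalk T P x)"
      using U by (simp add: germ_mult germ_closed)
    show "A \<otimes>\<^bsub>stalk T P x\<^esub> B \<otimes>\<^bsub>stalk T P x\<^esub> C = A \<otimes>\<^bsub>stalk T P x\<^esub> (B \<otimes>\<^bsub>stalk T P x\<^esub> C)"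
      using U by (simp add: germ_mult U.m_assoc)
    show "A \<otimes>\<^bsub>stalk T P x\<^esub> B = B \<otimes>\<^bsub>stalk T P x\<^esub> A"
      using U by (simp add: germ_mult U.m_comm)
    show "\<one>\<^bsub>stalk T P x\<^esub> \<otimes>\<^bsub>stalk T P x\<^esub> A = A"
      using U germ_one[of U x, symmetric] by (simp add: germ_mult)
  next
    show "\<one>\<^bsub>stalk T P x\<^esub> \<in> carrier (stalk T P x)"
      using germ_one[of "topspace T" x] germ_closed[of "topspace T" x] one_sect_closed assms
      by (metis openin_topspace)
  qed
  fix A B C assume A: "A \<in> carrier (stalk T P x)" and B: "B \<in> carrier (stalk T P x)"
    and C: "C \<in> carrier (stalk T P x)"
  obtain U s t u where U: "openin T U" "x \<in> U" "s \<in> carrier (sect P U)" "t \<in> carrier (sect P U)"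
    "u \<in> carrier (sect P U)" "A = germ T P x U s" "B = germ T P x U t" "C = germ T P x U u"
    using A B C by (rule stalk_cases3)
  interpret U: cring "sect P U" using U(1) by (rule cring_sect)
  show "(A \<oplus>\<^bsub>stalk T P x\<^esub> B) \<otimes>\<^bsub>stalk T P x\<^esub> C =
      A \<otimes>\<^bsub>stalk T P x\<^esub> C \<oplus>\<^bsub>stalk T P x\<^esub> B \<otimes>\<^bsub>stalk T P x\<^esub> C"
    using U by (simp add: germ_add germ_mult U.l_distr)
qed

end

section \<open>Sheaves of modules\<close>

lemma structure_sheaf_simps [simp]:
  "carrier (sect (structure_sheaf X) U) = hol X U"
  "f \<otimes>\<^bsub>sect (structure_sheaf X) U\<^esub> g = (\<lambda>x\<in>U. f x * g x)"
  "f \<oplus>\<^bsub>sect (structure_sheaf X) U\<^esub> g = (\<lambda>x\<in>U. f x + g x)"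
  "\<one>\<^bsub>sect (structure_sheaf X) U\<^esub> = (\<lambda>x\<in>U. 1)"
  "\<zero>\<^bsub>sect (structure_sheaf X) U\<^esub> = (\<lambda>x\<in>U. 0)"
  "res (structure_sheaf X) U V f = restrict f V"
  by (simp_all add: structure_sheaf_def)

lemma complex_space_Hausdorff: "complex_space X \<Longrightarrow> Hausdorff_space (tsp X)"
  unfolding complex_space_def by (rule conjunct1)

lemma hol_restrict:
  assumes "complex_space X" "openin (tsp X) U" "openin (tsp X) V" "V \<subseteq> U" "f \<in> hol X U"
  shows "restrict f V \<in> hol X V"
  using assms(1)[unfolded complex_space_def, THEN conjunct2, THEN conjunct1] assms(2-5) by blast

lemma hol_local:
  assumes "complex_space X" "openin (tsp X) U" "f \<in> extensional U"
    "\<And>x. x \<in> U \<Longrightarrow> \<exists>V. openin (tsp X) V \<and> x \<in> V \<and> V \<subseteq> U \<and> restrict f V \<in> hol X V"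
  shows "f \<in> hol X U"
  using assms(1)[unfolded complex_space_def, THEN conjunct2, THEN conjunct2, THEN conjunct1] assms(2-4)
  by blast

lemma presheaf_on_structure_sheaf:
  assumes "complex_space X"
  shows "presheaf_on (tsp X) (structure_sheaf X)"
  using hol_restrict[OF assms] by unfold_locales (auto simp: Int_absorb1)

text \<open>The ring structure on sections enters as a hypothesis: \<open>Module.module\<close>
  contains commutativity of its scalar ring, so every analytic sheaf on the space supplies
  it.\<close>

lemma ring_presheaf_structure_sheaf:
  assumes "complex_space X" and cring: "\<And>U. openin (tsp X) U \<Longrightarrow> cring (sect (structure_sheaf X) U)"
  shows "ring_presheaf (tsp X) (structure_sheaf X)"
proof -
  interpret presheaf_on "tsp X" "structure_sheaf X"
    using assms(1) by (rule presheaf_on_structure_sheaf)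
  have mult: "f \<otimes>\<^bsub>sect (structure_sheaf X) U\<^esub> g \<in> carrier (sect (structure_sheaf X) U)"
    if "openin (tsp X) U" "f \<in> carrier (sect (structure_sheaf X) U)"
      "g \<in> carrier (sect (structure_sheaf X) U)" for U f g
    using that cring[OF that(1)] by (intro cring.cring_simprules(5)[of _ f g])
  have abelian: "abelian_group (sect (structure_sheaf X) U)" if "openin (tsp X) U" for U
    using cring[OF that] by (simp add: cring.axioms ring.axioms)
  show ?thesis
    by (intro ring_presheaf.intro additive_presheaf.intro multiplicative_presheaf.intro
        additive_presheaf_axioms.intro multiplicative_presheaf_axioms.intro
        ring_presheaf_axioms.intro presheaf_on_axioms)
      ((rule mult abelian cring; assumption) | (force simp: fun_eq_iff restrict_def))+
qed

lemma stalk_mod_simps [simp]: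
  "carrier (stalk_mod X M x) = carrier (stalk (tsp X) M x)"
  "add (stalk_mod X M x) = add (stalk (tsp X) M x)"
  "\<zero>\<^bsub>stalk_mod X M x\<^esub> = \<zero>\<^bsub>stalk (tsp X) M x\<^esub>"
  by (simp_all add: stalk_mod_def stalk_def ring.defs module.defs)

text \<open>A stalk and its module version, or a direct image and the sections it consists of, are
  different records that share their additive fields.\<close>

lemma abelian_group_cong:
  assumes "carrier A = carrier B" "add A = add B" "\<zero>\<^bsub>A\<^esub> = \<zero>\<^bsub>B\<^esub>" "abelian_group B"
  shows "abelian_group A"
proof -
  interpret B: abelian_group B by fact
  show ?thesis
    by (rule abelian_groupI) (use B.l_neg in \<open>auto simp: assms(1-3) B.a_assoc intro: B.a_comm\<close>)
qed

lemma stalk_smult: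
  "A \<odot>\<^bsub>stalk_mod X M x\<^esub> B = (\<Union>(U, f) \<in> A. \<Union>(V, s) \<in> B.
     germ (tsp X) M x (U \<inter> V) (restrict f (U \<inter> V) \<odot>\<^bsub>sect M (U \<inter> V)\<^esub> res M V (U \<inter> V) s))"
  by (simp add: stalk_mod_def stalk_def ring.defs module.defs)

text \<open>Stated for bare presheaves, since it is applied not only to module presheaves but also
  to the direct image over \<open>X\<close>, where the scalars form a
  \<open>multiplicative_presheaf\<close>.\<close>

lemma germ_smult_gen:
  assumes "presheaf_on (tsp X) (structure_sheaf X)" "presheaf_on (tsp X) M"
    and "openin (tsp X) U" "x \<in> U" "f \<in> hol X U" "s \<in> carrier (sect M U)"
    and "\<And>V f s. \<lbrakk>openin (tsp X) V; f \<in> hol X V; s \<in> carrier (sect M V)\<rbrakk>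
        \<Longrightarrow> f \<odot>\<^bsub>sect M V\<^esub> s \<in> carrier (sect M V)"
      "\<And>V W f s. \<lbrakk>openin (tsp X) V; openin (tsp X) W; W \<subseteq> V; f \<in> hol X V; s \<in> carrier (sect M V)\<rbrakk>
        \<Longrightarrow> res M V W (f \<odot>\<^bsub>sect M V\<^esub> s) = restrict f W \<odot>\<^bsub>sect M W\<^esub> res M V W s"
  shows "germ_fun X x U f \<odot>\<^bsub>stalk_mod X M x\<^esub> germ (tsp X) M x U s =
    germ (tsp X) M x U (f \<odot>\<^bsub>sect M U\<^esub> s)"
  unfolding stalk_smult
  using germ_op[OF assms(1,2,2,3,4) _ assms(6), where f = "\<lambda>U. smult (sect M U)" and s = f]
    assms(5,7,8) by simp

locale module_presheaf =
  O: ring_presheaf "tsp X" "structure_sheaf X" + additive_presheaf "tsp X" M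
  for X :: "'p fspace" and M :: "('p, 's) apresheaf" +
  assumes module_sect: "openin (tsp X) U \<Longrightarrow> Module.module (sect (structure_sheaf X) U) (sect M U)"
    and res_smult: "\<lbrakk>openin (tsp X) U; openin (tsp X) V; V \<subseteq> U; f \<in> hol X U; s \<in> carrier (sect M U)\<rbrakk>
      \<Longrightarrow> res M U V (f \<odot>\<^bsub>sect M U\<^esub> s) = restrict f V \<odot>\<^bsub>sect M V\<^esub> res M U V s"
begin

lemma smult_sect_closed:
  "\<lbrakk>openin (tsp X) U; f \<in> hol X U; s \<in> carrier (sect M U)\<rbrakk> \<Longrightarrow> f \<odot>\<^bsub>sect M U\<^esub> s \<in> carrier (sect M U)"
  using module.smult_closed[OF module_sect] by simp

lemma germ_smult:
  assumes "openin (tsp X) U" "x \<in> U" "f \<in> hol X U" "s \<in> carrier (sect M U)"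
  shows "germ_fun X x U f \<odot>\<^bsub>stalk_mod X M x\<^esub> germ (tsp X) M x U s =
    germ (tsp X) M x U (f \<odot>\<^bsub>sect M U\<^esub> s)"
  using O.presheaf_on_axioms presheaf_on_axioms assms smult_sect_closed res_smult
  by (rule germ_smult_gen)

lemma ring_module_stalk_cases:
  assumes "a \<in> carrier (local_ring X x)" "m \<in> carrier (stalk (tsp X) M x)"
  obtains U f s where "openin (tsp X) U" "x \<in> U" "f \<in> hol X U" "s \<in> carrier (sect M U)"
    "a = germ_fun X x U f" "m = germ (tsp X) M x U s"
proof -
  obtain V f where V: "openin (tsp X) V" "x \<in> V" "f \<in> hol X V" "a = germ_fun X x V f"
    using assms(1) by (rule O.stalk_cases) simp
  obtain U s where U: "openin (tsp X) U" "x \<in> U" "U \<subseteq> V" "s \<in> carrier (sect M U)"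
    "m = germ (tsp X) M x U s"
    using assms(2) V(1,2) by (rule stalk_cases_within)
  show ?thesis
    using that[of U "restrict f U" s] U V O.germ_res[of V U x f] O.res_closed[of V U f] by auto
qed

lemma stalk_module:
  assumes "x \<in> pts X"
  shows "Module.module (local_ring X x) (stalk_mod X M x)"
proof (rule moduleI)
  show "cring (local_ring X x)" using assms by (rule O.stalk_cring)
  show "abelian_group (stalk_mod X M x)"
    by (rule abelian_group_cong[of _ "stalk (tsp X) M x"]) (simp_all add: stalk_abelian assms)
  fix a b m assume a: "a \<in> carrier (local_ring X x)" and m: "m \<in> carrier (stalk_mod X M x)"
  from a m show "a \<odot>\<^bsub>stalk_mod X M x\<^esub> m \<in> carrier (stalk_mod X M x)"
    by (elim ring_module_stalk_cases[of a x m]) (simp_all add: germ_smult germ_closed smult_sect_closed)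
  {
    fix n assume "n \<in> carrier (stalk_mod X M x)"
    then obtain W s' t' where W: "openin (tsp X) W" "x \<in> W" "s' \<in> carrier (sect M W)"
      "t' \<in> carrier (sect M W)" "m = germ (tsp X) M x W s'" "n = germ (tsp X) M x W t'"
      using stalk_cases2[of m x n] m by (metis stalk_mod_simps(1))
    from a obtain U f where U: "openin (tsp X) U" "x \<in> U" "U \<subseteq> W" "f \<in> hol X U" "a = germ_fun X x U f"
      using O.stalk_cases_within[OF _ W(1,2)] by (metis structure_sheaf_simps(1))
    define s t where "s = res M W U s'" and "t = res M W U t'"
    have st: "s \<in> carrier (sect M U)" "t \<in> carrier (sect M U)" "m = germ (tsp X) M x U s"
      "n = germ (tsp X) M x U t"
      using W U by (simp_all add: s_def t_def res_closed germ_res)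
    show "a \<odot>\<^bsub>stalk_mod X M x\<^esub> (m \<oplus>\<^bsub>stalk_mod X M x\<^esub> n) =
        a \<odot>\<^bsub>stalk_mod X M x\<^esub> m \<oplus>\<^bsub>stalk_mod X M x\<^esub> a \<odot>\<^bsub>stalk_mod X M x\<^esub> n"
      using U st module.smult_r_distr[OF module_sect[OF U(1)], of f s t]
      by (simp add: germ_add germ_smult smult_sect_closed add_sect_closed)
  }
  {
    assume "b \<in> carrier (local_ring X x)"
    then obtain W f' g' where W: "openin (tsp X) W" "x \<in> W" "f' \<in> hol X W" "g' \<in> hol X W"
      "a = germ_fun X x W f'" "b = germ_fun X x W g'"
      using O.stalk_cases2[of a x b] a by (metis structure_sheaf_simps(1))
    from m obtain U s where U: "openin (tsp X) U" "x \<in> U" "U \<subseteq> W" "s \<in> carrier (sect M U)"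
      "m = germ (tsp X) M x U s"
      using stalk_cases_within[OF _ W(1,2)] by (metis stalk_mod_simps(1))
    define f g where "f = restrict f' U" and "g = restrict g' U"
    have fg: "f \<in> hol X U" "g \<in> hol X U" "a = germ_fun X x U f" "b = germ_fun X x U g"
      using W U O.res_closed[of W U] O.germ_res[of W U x] by (simp_all add: f_def g_def)
    show "(a \<oplus>\<^bsub>local_ring X x\<^esub> b) \<odot>\<^bsub>stalk_mod X M x\<^esub> m =
        a \<odot>\<^bsub>stalk_mod X M x\<^esub> m \<oplus>\<^bsub>stalk_mod X M x\<^esub> b \<odot>\<^bsub>stalk_mod X M x\<^esub> m"
      using U fg module.smult_l_distr[OF module_sect[OF U(1)], of f g s] O.add_sect_closed[of U f g]
      by (simp add: germ_add germ_smult smult_sect_closed add_sect_closed O.germ_add)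
    show "(a \<otimes>\<^bsub>local_ring X x\<^esub> b) \<odot>\<^bsub>stalk_mod X M x\<^esub> m =
        a \<odot>\<^bsub>stalk_mod X M x\<^esub> (b \<odot>\<^bsub>stalk_mod X M x\<^esub> m)"
      using U fg module.smult_assoc1[OF module_sect[OF U(1)], of f g s] O.mult_sect_closed[of U f g]
      by (simp add: germ_smult smult_sect_closed O.germ_mult)
  }
next
  fix m assume "m \<in> carrier (stalk_mod X M x)"
  then obtain U s where U: "openin (tsp X) U" "x \<in> U" "s \<in> carrier (sect M U)"
    "m = germ (tsp X) M x U s"
    using stalk_cases by (metis stalk_mod_simps(1))
  then show "\<one>\<^bsub>local_ring X x\<^esub> \<odot>\<^bsub>stalk_mod X M x\<^esub> m = m"
    using module.smult_one[OF module_sect[OF U(1)], of s] O.one_sect_closed[of U]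
    by (simp add: O.germ_one[symmetric, OF U(1,2)] germ_smult)
qed

end

lemma analytic_sheaf_imp_module_presheaf:
  assumes "complex_space X" "analytic_sheaf X M"
  shows "module_presheaf X M"
proof -
  have mod: "Module.module (sect (structure_sheaf X) U) (sect M U)" if "openin (tsp X) U" for U
    using assms(2)[unfolded analytic_sheaf_def, THEN conjunct1] that by blast
  interpret O: ring_presheaf "tsp X" "structure_sheaf X"
    using assms(1) mod[THEN module.axioms(1)] by (rule ring_presheaf_structure_sheaf)
  note A = assms(2)[unfolded analytic_sheaf_def, THEN conjunct2]
  show ?thesis
  proof (intro module_presheaf.intro module_presheaf_axioms.intro additive_presheaf.intro
      additive_presheaf_axioms.intro presheaf_on.intro O.ring_presheaf_axioms mod)
    show "abelian_group (sect M U)" if "openin (tsp X) U" for U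
      using mod[OF that] by (rule module.axioms(2))
  next
    fix U V s t f assume *: "openin (tsp X) U" "openin (tsp X) V" "V \<subseteq> U" "s \<in> carrier (sect M U)"
    note B = A[THEN conjunct1, rule_format, of U V, OF conjI[OF *(1) conjI[OF *(2,3)]]]
    show "res M U V s \<in> carrier (sect M V)"
      using B[THEN conjunct1] *(4) by (rule funcset_mem)
    show "res M U V (s \<oplus>\<^bsub>sect M U\<^esub> t) = res M U V s \<oplus>\<^bsub>sect M V\<^esub> res M U V t"
      if "t \<in> carrier (sect M U)"
      using B[THEN conjunct2, THEN conjunct1] *(4) that by metis
    show "res M U V (f \<odot>\<^bsub>sect M U\<^esub> s) = restrict f V \<odot>\<^bsub>sect M V\<^esub> res M U V s"
      if "f \<in> hol X U"
      using B[THEN conjunct2, THEN conjunct2] that *(4) by metis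
  next
    show "res M V W (res M U V s) = res M U W s"
      if "openin (tsp X) U" "openin (tsp X) V" "openin (tsp X) W" "W \<subseteq> V" "V \<subseteq> U"
      "s \<in> carrier (sect M U)" for U V W s
      using A[THEN conjunct2, THEN conjunct2, THEN conjunct1, rule_format, of U V W s] that by simp
  qed
qed

section \<open>Sections of a sheaf and their germs\<close>

locale module_sheaf = module_presheaf X M
  for X :: "'p fspace" and M :: "('p, 's) apresheaf" +
  assumes sheaf_separated: "\<lbrakk>\<And>V. V \<in> \<V> \<Longrightarrow> openin (tsp X) V; s \<in> carrier (sect M (\<Union>\<V>));
      t \<in> carrier (sect M (\<Union>\<V>)); \<And>V. V \<in> \<V> \<Longrightarrow> res M (\<Union>\<V>) V s = res M (\<Union>\<V>) V t\<rbrakk> \<Longrightarrow> s = t"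
    and sheaf_glue: "\<lbrakk>\<And>V. V \<in> \<V> \<Longrightarrow> openin (tsp X) V; \<And>V. V \<in> \<V> \<Longrightarrow> \<sigma> V \<in> carrier (sect M V);
      \<And>V V'. \<lbrakk>V \<in> \<V>; V' \<in> \<V>\<rbrakk> \<Longrightarrow> res M V (V \<inter> V') (\<sigma> V) = res M V' (V \<inter> V') (\<sigma> V')\<rbrakk>
      \<Longrightarrow> \<exists>s \<in> carrier (sect M (\<Union>\<V>)). \<forall>V \<in> \<V>. res M (\<Union>\<V>) V s = \<sigma> V"
begin

text \<open>Equality of germs at \<open>z\<close> means equality on a neighbourhood of
  \<open>z\<close>. The open sets on which \<open>s\<close> and \<open>t\<close> agree therefore
  cover \<open>U\<close>, and separatedness applies.\<close>

lemma section_eqI: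
  assumes "openin (tsp X) U" "s \<in> carrier (sect M U)" "t \<in> carrier (sect M U)"
    and "\<And>z. z \<in> U \<Longrightarrow> germ (tsp X) M z U s = germ (tsp X) M z U t"
  shows "s = t"
proof -
  let ?\<V> = "{W. openin (tsp X) W \<and> W \<subseteq> U \<and> res M U W s = res M U W t}"
  have "\<Union>?\<V> = U"
  proof (intro equalityI subsetI)
    fix z assume z: "z \<in> U"
    obtain W where "openin (tsp X) W" "z \<in> W" "W \<subseteq> U" "res M U W s = res M U W t"
      by (rule germ_eqD[OF assms(1) z assms(3) assms(4)[OF z]])
    then show "z \<in> \<Union>?\<V>" by blast
  qed auto
  then show ?thesis
    using sheaf_separated[of ?\<V> s t] assms(2,3) by simp
qed

text \<open>The cover consists of all open subsets of \<open>V\<close> that carry a section with the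
  prescribed germs, and one such section is chosen on each. The choices agree on overlaps because
  sections are determined by their germs, so they glue. This is the source of all maps into a sheaf
  constructed below.\<close>

lemma section_of_germs:
  assumes "openin (tsp X) V"
    and loc: "\<And>y. y \<in> V \<Longrightarrow> \<exists>W r. openin (tsp X) W \<and> y \<in> W \<and> W \<subseteq> V \<and> r \<in> carrier (sect M W) \<and>
      (\<forall>z \<in> W. germ (tsp X) M z W r = m z)"
  shows "\<exists>!t. t \<in> carrier (sect M V) \<and> (\<forall>z \<in> V. germ (tsp X) M z V t = m z)"
proof (rule ex_ex1I)
  define good where "good W r \<longleftrightarrow> r \<in> carrier (sect M W) \<and> (\<forall>z \<in> W. germ (tsp X) M z W r = m z)" for W r
  define \<V> where "\<V> = {W. openin (tsp X) W \<and> W \<subseteq> V \<and> (\<exists>r. good W r)}"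
  define \<sigma> where "\<sigma> W = (SOME r. good W r)" for W
  have \<sigma>: "good W (\<sigma> W)" if "W \<in> \<V>" for W
    using that unfolding \<V>_def \<sigma>_def by (auto intro: someI_ex)
  have op: "openin (tsp X) W" if "W \<in> \<V>" for W using that unfolding \<V>_def by auto
  have "y \<in> \<Union>\<V>" if y: "y \<in> V" for y
  proof -
    obtain W r where "openin (tsp X) W" "y \<in> W" "W \<subseteq> V" "good W r"
      using loc[OF y] unfolding good_def by metis
    then show ?thesis unfolding \<V>_def by auto
  qed
  then have V: "\<Union>\<V> = V" unfolding \<V>_def by auto
  have "\<exists>s \<in> carrier (sect M (\<Union>\<V>)). \<forall>W \<in> \<V>. res M (\<Union>\<V>) W s = \<sigma> W"
  proof (rule sheaf_glue)
    fix W W' assume W: "W \<in> \<V>" "W' \<in> \<V>"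
    have "openin (tsp X) (W \<inter> W')" using op W by auto
    then show "res M W (W \<inter> W') (\<sigma> W) = res M W' (W \<inter> W') (\<sigma> W')"
      using W op[of W] op[of W'] \<sigma>[of W] \<sigma>[of W']
      by (intro section_eqI) (auto simp: germ_res res_closed good_def)
  qed (use op \<sigma> in \<open>auto simp: good_def\<close>)
  then obtain s where s: "s \<in> carrier (sect M V)" "\<And>W. W \<in> \<V> \<Longrightarrow> res M V W s = \<sigma> W"
    using V by auto
  have "germ (tsp X) M z V s = m z" if z: "z \<in> V" for z
  proof -
    obtain W where W: "W \<in> \<V>" "z \<in> W" using z V by auto
    have "W \<subseteq> V" using W(1) V by blast
    moreover have "germ (tsp X) M z W (res M V W s) = m z"
      using s(2)[OF W(1)] \<sigma>[OF W(1)] W(2) by (simp add: good_def)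
    ultimately show ?thesis
      using germ_res[OF assms(1) op[OF W(1)] _ W(2) s(1)] by simp
  qed
  with s(1) show "\<exists>t. t \<in> carrier (sect M V) \<and> (\<forall>z \<in> V. germ (tsp X) M z V t = m z)" by blast
next
  show "t = t'" if "t \<in> carrier (sect M V) \<and> (\<forall>z\<in>V. germ (tsp X) M z V t = m z)"
    "t' \<in> carrier (sect M V) \<and> (\<forall>z\<in>V. germ (tsp X) M z V t' = m z)" for t t'
    using that assms(1) by (intro section_eqI[of V]) auto
qed

end

lemma analytic_sheaf_imp_module_sheaf:
  assumes "complex_space X" "analytic_sheaf X M"
  shows "module_sheaf X M"
proof -
  interpret module_presheaf X M
    using assms by (rule analytic_sheaf_imp_module_presheaf)
  note A = assms(2)[unfolded analytic_sheaf_def, THEN conjunct2, THEN conjunct2, THEN conjunct2,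
      THEN conjunct2, rule_format]
  show ?thesis
  proof
    show "s = t" if "\<And>V. V \<in> \<V> \<Longrightarrow> openin (tsp X) V" "s \<in> carrier (sect M (\<Union>\<V>))"
      "t \<in> carrier (sect M (\<Union>\<V>))" "\<And>V. V \<in> \<V> \<Longrightarrow> res M (\<Union>\<V>) V s = res M (\<Union>\<V>) V t" for \<V> s t
      using A[of \<V>, THEN conjunct1] that by blast
    show "\<exists>s \<in> carrier (sect M (\<Union>\<V>)). \<forall>V \<in> \<V>. res M (\<Union>\<V>) V s = \<sigma> V"
      if "\<And>V. V \<in> \<V> \<Longrightarrow> openin (tsp X) V" "\<And>V. V \<in> \<V> \<Longrightarrow> \<sigma> V \<in> carrier (sect M V)"
      "\<And>V V'. \<lbrakk>V \<in> \<V>; V' \<in> \<V>\<rbrakk> \<Longrightarrow> res M V (V \<inter> V') (\<sigma> V) = res M V' (V \<inter> V') (\<sigma> V')" for \<V> \<sigma>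
      using A[of \<V>, THEN conjunct2] that by blast
  qed
qed

section \<open>Sheaves of sections\<close>

lemma section_sheaf_simps [simp]:
  "\<zero>\<^bsub>sect (section_sheaf Y E \<Gamma>) V\<^esub> = (\<lambda>y\<in>V. \<zero>\<^bsub>E y\<^esub>)"
  "s \<oplus>\<^bsub>sect (section_sheaf Y E \<Gamma>) V\<^esub> t = (\<lambda>y\<in>V. s y \<oplus>\<^bsub>E y\<^esub> t y)"
  "f \<odot>\<^bsub>sect (section_sheaf Y E \<Gamma>) V\<^esub> s = (\<lambda>y\<in>V. germ_fun Y y V f \<odot>\<^bsub>E y\<^esub> s y)"
  "res (section_sheaf Y E \<Gamma>) U V s = restrict s V"
  by (simp_all add: section_sheaf_def)

lemma section_sheaf_carrier:
  "s \<in> carrier (sect (section_sheaf Y E \<Gamma>) V) \<longleftrightarrow>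
    s \<in> extensional V \<and> (\<forall>y \<in> V. s y \<in> carrier (E y)) \<and>
    (\<forall>y \<in> V. \<exists>W t. openin (tsp Y) W \<and> y \<in> W \<and> W \<subseteq> V \<and> t \<in> \<Gamma> W \<and> (\<forall>z \<in> W. s z = t z))"
  by (auto simp: section_sheaf_def PiE_def)

text \<open>Distinguished maps are total functions, so \<open>loc\<close> asks for a distinguished
  map with the same values on \<open>W'\<close> instead of a literal restriction.\<close>

lemma presheaf_on_section_sheaf:
  assumes loc: "\<And>W W' t. \<lbrakk>openin (tsp Y) W; openin (tsp Y) W'; W' \<subseteq> W; t \<in> \<Gamma> W\<rbrakk> \<Longrightarrow>
    \<exists>t' \<in> \<Gamma> W'. \<forall>z \<in> W'. t' z = t z"
  shows "presheaf_on (tsp Y) (section_sheaf Y E \<Gamma>)"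
proof
  fix U V s assume U: "openin (tsp Y) U" "openin (tsp Y) V" "V \<subseteq> U"
    and s: "s \<in> carrier (sect (section_sheaf Y E \<Gamma>) U)"
  have "\<exists>W t. openin (tsp Y) W \<and> y \<in> W \<and> W \<subseteq> V \<and> t \<in> \<Gamma> W \<and> (\<forall>z \<in> W. restrict s V z = t z)"
    if y: "y \<in> V" for y
  proof -
    obtain W t where W: "openin (tsp Y) W" "y \<in> W" "W \<subseteq> U" "t \<in> \<Gamma> W" "\<forall>z \<in> W. s z = t z"
      using s y U(3) unfolding section_sheaf_carrier by blast
    obtain t' where "t' \<in> \<Gamma> (W \<inter> V)" "\<forall>z \<in> W \<inter> V. t' z = t z"
      using loc[of W "W \<inter> V" t] W U y by auto
    then show ?thesis
      using W U y by (intro exI[of _ "W \<inter> V"] exI[of _ t']) auto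
  qed
  then show "res (section_sheaf Y E \<Gamma>) U V s \<in> carrier (sect (section_sheaf Y E \<Gamma>) V)"
    using s U unfolding section_sheaf_carrier by auto
qed (auto simp: Int_absorb1)

section \<open>Morphisms and isomorphisms given on stalks\<close>

context module_sheaf
begin

text \<open>The \<open>THE\<close> term for \<open>h\<close> is the one in
  \<open>canonical_morphism\<close>, so that the lemma specializes to it directly. Linearity and
  compatibility with restriction hold because both sides have equal germs. The third claim asks of
  \<open>s\<close> only the values \<open>l y (s y)\<close>, not that it be a section.\<close>

lemma sheaf_hom_of_stalk_maps:
  fixes E :: "'p \<Rightarrow> (('p set \<times> ('p \<Rightarrow> complex)) set, 'e) module"
  assumes l: "\<And>z. z \<in> pts X \<Longrightarrow> l z \<in> mod_hom (local_ring X z) (E z) (stalk_mod X M z)"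
    and loc: "\<And>W t y. \<lbrakk>openin (tsp X) W; t \<in> \<Gamma> W; y \<in> W\<rbrakk> \<Longrightarrow>
      \<exists>W' r. openin (tsp X) W' \<and> y \<in> W' \<and> W' \<subseteq> W \<and> r \<in> carrier (sect M W') \<and>
        (\<forall>z \<in> W'. germ (tsp X) M z W' r = l z (t z))"
  defines "h \<equiv> \<lambda>V s. THE t. t \<in> carrier (sect M V) \<and> (\<forall>y \<in> V. germ (tsp X) M y V t = l y (s y))"
  shows "sheaf_hom X (section_sheaf X E \<Gamma>) M h" (is ?hom)
    and "\<And>V s. \<lbrakk>openin (tsp X) V; s \<in> carrier (sect (section_sheaf X E \<Gamma>) V)\<rbrakk> \<Longrightarrow>
      h V s \<in> carrier (sect M V) \<and> (\<forall>y \<in> V. germ (tsp X) M y V (h V s) = l y (s y))"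
    and "\<And>V s t. \<lbrakk>openin (tsp X) V; t \<in> carrier (sect M V);
      \<And>y. y \<in> V \<Longrightarrow> germ (tsp X) M y V t = l y (s y)\<rbrakk> \<Longrightarrow> h V s = t"
proof -
  show spec: "h V s \<in> carrier (sect M V) \<and> (\<forall>y \<in> V. germ (tsp X) M y V (h V s) = l y (s y))"
    if V: "openin (tsp X) V" and s: "s \<in> carrier (sect (section_sheaf X E \<Gamma>) V)" for V s
    unfolding h_def
  proof (rule theI', rule section_of_germs)
    fix y assume "y \<in> V"
    then obtain W t where W: "openin (tsp X) W" "y \<in> W" "W \<subseteq> V" "t \<in> \<Gamma> W" "\<forall>z \<in> W. s z = t z"
      using s unfolding section_sheaf_carrier by blast
    then obtain W' r where "openin (tsp X) W'" "y \<in> W'" "W' \<subseteq> W" "r \<in> carrier (sect M W')"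
      "\<forall>z \<in> W'. germ (tsp X) M z W' r = l z (t z)"
      using loc by meson
    with W show "\<exists>W r. openin (tsp X) W \<and> y \<in> W \<and> W \<subseteq> V \<and> r \<in> carrier (sect M W) \<and>
        (\<forall>z \<in> W. germ (tsp X) M z W r = l z (s z))"
      by (intro exI[of _ W'] exI[of _ r]) auto
  qed (rule V)
  show uniq: "h V s = t" if "openin (tsp X) V" "t \<in> carrier (sect M V)"
    "\<And>y. y \<in> V \<Longrightarrow> germ (tsp X) M y V t = l y (s y)" for V s t
    unfolding h_def using that by (intro the_equality section_eqI[of V]) auto
  note lD = l[unfolded mod_hom_def, simplified]
  have pts: "y \<in> pts X" if "openin (tsp X) V" "y \<in> V" for V y
    using that openin_subset by blast
  show ?hom
    unfolding sheaf_hom_def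
  proof (intro conjI allI impI; (elim conjE)?)
    fix U assume U: "openin (tsp X) U"
    let ?E = "sect (section_sheaf X E \<Gamma>) U"
    have E: "s y \<in> carrier (E y)" if "s \<in> carrier ?E" "y \<in> U" for s y
      using that unfolding section_sheaf_carrier by auto
    show "h U \<in> mod_hom (sect (structure_sheaf X) U) ?E (sect M U)"
      unfolding mod_hom_def
    proof (intro CollectI conjI ballI)
      show "h U \<in> carrier ?E \<rightarrow> carrier (sect M U)" using spec U by auto
    next
      fix s t assume s: "s \<in> carrier ?E" and t: "t \<in> carrier ?E"
      show "h U (s \<oplus>\<^bsub>?E\<^esub> t) = h U s \<oplus>\<^bsub>sect M U\<^esub> h U t"
        using spec[OF U s] spec[OF U t] lD[OF pts[OF U]] E[OF s] E[OF t] U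
        by (intro uniq) (auto simp: add_sect_closed germ_add[symmetric])
    next
      fix f s assume f: "f \<in> carrier (sect (structure_sheaf X) U)" and s: "s \<in> carrier ?E"
      then show "h U (f \<odot>\<^bsub>?E\<^esub> s) = f \<odot>\<^bsub>sect M U\<^esub> h U s"
        using spec[OF U s] lD[OF pts[OF U]] E[OF s] U O.germ_closed[of U _ f]
        by (intro uniq) (auto simp: smult_sect_closed germ_smult[symmetric])
    qed
  next
    fix U V s assume *: "openin (tsp X) U" "openin (tsp X) V" "V \<subseteq> U"
      "s \<in> carrier (sect (section_sheaf X E \<Gamma>) U)"
    then show "h V (res (section_sheaf X E \<Gamma>) U V s) = res M U V (h U s)"
      using spec[of U s] by (intro uniq) (auto simp: res_closed germ_res)
  qed
qed

text \<open>Injectivity is checked point by point. For surjectivity the germs of \<open>r\<close>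
  are pulled back through the bijections \<open>l z\<close>; \<open>loc'\<close> guarantees that the
  resulting family is locally distinguished and thus a section.\<close>

lemma sheaf_iso_of_stalk_maps:
  fixes E :: "'p \<Rightarrow> (('p set \<times> ('p \<Rightarrow> complex)) set, 'e) module"
  assumes l: "\<And>z. z \<in> pts X \<Longrightarrow> l z \<in> mod_hom (local_ring X z) (E z) (stalk_mod X M z)"
    and bij: "\<And>z. z \<in> pts X \<Longrightarrow> bij_betw (l z) (carrier (E z)) (carrier (stalk (tsp X) M z))"
    and loc: "\<And>W t y. \<lbrakk>openin (tsp X) W; t \<in> \<Gamma> W; y \<in> W\<rbrakk> \<Longrightarrow>
      \<exists>W' r. openin (tsp X) W' \<and> y \<in> W' \<and> W' \<subseteq> W \<and> r \<in> carrier (sect M W') \<and>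
        (\<forall>z \<in> W'. germ (tsp X) M z W' r = l z (t z))"
    and loc': "\<And>V r y. \<lbrakk>openin (tsp X) V; r \<in> carrier (sect M V); y \<in> V\<rbrakk> \<Longrightarrow>
      \<exists>W t. openin (tsp X) W \<and> y \<in> W \<and> W \<subseteq> V \<and> t \<in> \<Gamma> W \<and>
        (\<forall>z \<in> W. t z \<in> carrier (E z) \<and> germ (tsp X) M z V r = l z (t z))"
  defines "h \<equiv> \<lambda>V s. THE t. t \<in> carrier (sect M V) \<and> (\<forall>y \<in> V. germ (tsp X) M y V t = l y (s y))"
  shows "sheaf_iso X (section_sheaf X E \<Gamma>) M h"
proof -
  have hom1: "sheaf_hom X (section_sheaf X E \<Gamma>) M h"
    unfolding h_def by (rule sheaf_hom_of_stalk_maps(1)) (fact l loc)+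
  have hom2: "h V s \<in> carrier (sect M V) \<and> (\<forall>y \<in> V. germ (tsp X) M y V (h V s) = l y (s y))"
    if "openin (tsp X) V" "s \<in> carrier (sect (section_sheaf X E \<Gamma>) V)" for V s
    unfolding h_def by (rule sheaf_hom_of_stalk_maps(2)) (fact l loc that)+
  have hom3: "h V s = t" if "openin (tsp X) V" "t \<in> carrier (sect M V)"
    "\<And>y. y \<in> V \<Longrightarrow> germ (tsp X) M y V t = l y (s y)" for V s t
    unfolding h_def by (rule sheaf_hom_of_stalk_maps(3)) (fact l loc that)+
  have "bij_betw (h V) (carrier (sect (section_sheaf X E \<Gamma>) V)) (carrier (sect M V))"
    if V: "openin (tsp X) V" for V
  proof (rule bij_betw_imageI)
    have pts: "y \<in> pts X" if "y \<in> V" for y using V that openin_subset by blast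
    show "inj_on (h V) (carrier (sect (section_sheaf X E \<Gamma>) V))"
    proof (rule inj_onI)
      fix s t assume s: "s \<in> carrier (sect (section_sheaf X E \<Gamma>) V)"
        and t: "t \<in> carrier (sect (section_sheaf X E \<Gamma>) V)" and eq: "h V s = h V t"
      show "s = t"
      proof (rule extensionalityI[of _ V])
        fix y assume y: "y \<in> V"
        have "l y (s y) = l y (t y)"
          using hom2[OF V s] hom2[OF V t] eq y by metis
        then show "s y = t y"
          using bij[OF pts[OF y]] s t y unfolding section_sheaf_carrier
          by (auto simp: bij_betw_def inj_on_def)
      qed (use s t in \<open>auto simp: section_sheaf_carrier\<close>)
    qed
    show "h V ` carrier (sect (section_sheaf X E \<Gamma>) V) = carrier (sect M V)"
    proof (intro equalityI subsetI)
      fix r assume r: "r \<in> carrier (sect M V)"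
      define s where "s = (\<lambda>z\<in>V. inv_into (carrier (E z)) (l z) (germ (tsp X) M z V r))"
      have sz: "s z \<in> carrier (E z)" "l z (s z) = germ (tsp X) M z V r" if z: "z \<in> V" for z
      proof -
        have "germ (tsp X) M z V r \<in> l z ` carrier (E z)"
          using bij[OF pts[OF z]] germ_closed[OF V z r] by (auto simp: bij_betw_def)
        then show "s z \<in> carrier (E z)" "l z (s z) = germ (tsp X) M z V r"
          using z unfolding s_def by (auto intro: inv_into_into simp: f_inv_into_f)
      qed
      have "\<exists>W t. openin (tsp X) W \<and> y \<in> W \<and> W \<subseteq> V \<and> t \<in> \<Gamma> W \<and> (\<forall>z \<in> W. s z = t z)"
        if y: "y \<in> V" for y
      proof -
        obtain W t where W: "openin (tsp X) W" "y \<in> W" "W \<subseteq> V" "t \<in> \<Gamma> W"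
          "\<forall>z \<in> W. t z \<in> carrier (E z) \<and> germ (tsp X) M z V r = l z (t z)"
          using loc'[OF V r y] by blast
        \<comment> \<open>Both values are mapped to the germ of \<open>r\<close> by the injective
          \<open>l z\<close>, so the pointwise inverse coincides with the distinguished map on
          \<open>W\<close>.\<close>
        have "s z = t z" if z: "z \<in> W" for z
          using bij[OF pts, of z] sz[of z] W z unfolding bij_betw_def inj_on_def by auto
        with W show ?thesis by blast
      qed
      then have "s \<in> carrier (sect (section_sheaf X E \<Gamma>) V)"
        unfolding section_sheaf_carrier using sz by (auto simp: s_def)
      moreover have "h V s = r"
        using V r sz(2) by (intro hom3) auto
      ultimately show "r \<in> h V ` carrier (sect (section_sheaf X E \<Gamma>) V)" by blast
    qed (use hom2[OF V] in auto)
  qed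
  with hom1 show ?thesis
    unfolding sheaf_iso_def by blast
qed

end

text \<open>Closure properties of the distinguished maps pass to the maps that locally coincide with
  them. The module laws themselves hold at each point, in \<open>E y\<close>.\<close>

lemma module_presheaf_section_sheaf:
  fixes E :: "'q \<Rightarrow> (('q set \<times> ('q \<Rightarrow> complex)) set, 'e) module"
  assumes O: "ring_presheaf (tsp Y) (structure_sheaf Y)"
    and E: "\<And>y. y \<in> pts Y \<Longrightarrow> Module.module (local_ring Y y) (E y)"
    and restr: "\<And>W W' t. \<lbrakk>openin (tsp Y) W; openin (tsp Y) W'; W' \<subseteq> W; t \<in> \<Gamma> W\<rbrakk> \<Longrightarrow>
      \<exists>t' \<in> \<Gamma> W'. \<forall>z \<in> W'. t' z = t z"
    and zero: "\<And>W. openin (tsp Y) W \<Longrightarrow> \<exists>t \<in> \<Gamma> W. \<forall>z \<in> W. t z = \<zero>\<^bsub>E z\<^esub>"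
    and add: "\<And>W s t. \<lbrakk>openin (tsp Y) W; s \<in> \<Gamma> W; t \<in> \<Gamma> W\<rbrakk> \<Longrightarrow>
      \<exists>r \<in> \<Gamma> W. \<forall>z \<in> W. r z = s z \<oplus>\<^bsub>E z\<^esub> t z"
    and smult: "\<And>W f t. \<lbrakk>openin (tsp Y) W; f \<in> hol Y W; t \<in> \<Gamma> W\<rbrakk> \<Longrightarrow>
      \<exists>r \<in> \<Gamma> W. \<forall>z \<in> W. r z = germ_fun Y z W f \<odot>\<^bsub>E z\<^esub> t z"
  shows "module_presheaf Y (section_sheaf Y E \<Gamma>)"
proof -
  interpret O: ring_presheaf "tsp Y" "structure_sheaf Y" by (fact O)
  let ?S = "section_sheaf Y E \<Gamma>"
  interpret S: presheaf_on "tsp Y" ?S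
    by (rule presheaf_on_section_sheaf) (rule restr)
  have pts: "y \<in> pts Y" if "openin (tsp Y) V" "y \<in> V" for V y
    using that openin_subset by blast
  have val: "s y \<in> carrier (E y)" if "s \<in> carrier (sect ?S V)" "y \<in> V" for s y V
    using that unfolding section_sheaf_carrier by auto
  have ext: "s = t" if "s \<in> carrier (sect ?S V)" "t \<in> carrier (sect ?S V)" "\<And>y. y \<in> V \<Longrightarrow> s y = t y"
    for s t V
    using that extensionalityI[of s V t] unfolding section_sheaf_carrier by auto
  have local: "\<exists>W s'. openin (tsp Y) W \<and> y \<in> W \<and> W \<subseteq> V \<and> s' \<in> \<Gamma> W \<and> (\<forall>z \<in> W. s z = s' z)"
    if "s \<in> carrier (sect ?S V)" "y \<in> V" for s y V
    using that unfolding section_sheaf_carrier by metis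
  have addc: "s \<oplus>\<^bsub>sect ?S V\<^esub> t \<in> carrier (sect ?S V)" if V: "openin (tsp Y) V"
    and s: "s \<in> carrier (sect ?S V)" and t: "t \<in> carrier (sect ?S V)" for V s t
  proof -
    have "\<exists>W r. openin (tsp Y) W \<and> y \<in> W \<and> W \<subseteq> V \<and> r \<in> \<Gamma> W \<and>
        (\<forall>z \<in> W. (s \<oplus>\<^bsub>sect ?S V\<^esub> t) z = r z)" if y: "y \<in> V" for y
    proof -
      obtain W1 s1 where 1: "openin (tsp Y) W1" "y \<in> W1" "W1 \<subseteq> V" "s1 \<in> \<Gamma> W1" "\<forall>z \<in> W1. s z = s1 z"
        using local[OF s y] by blast
      obtain W2 s2 where 2: "openin (tsp Y) W2" "y \<in> W2" "W2 \<subseteq> V" "s2 \<in> \<Gamma> W2" "\<forall>z \<in> W2. t z = s2 z"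
        using local[OF t y] by blast
      \<comment> \<open>Closure under addition is available over one open set, so both local
        representatives are first moved to \<open>W1 \<inter> W2\<close>.\<close>
      let ?W = "W1 \<inter> W2"
      have W: "openin (tsp Y) ?W" using 1 2 by auto
      obtain s' where s': "s' \<in> \<Gamma> ?W" "\<forall>z \<in> ?W. s' z = s1 z"
        using restr[OF 1(1) W _ 1(4)] by auto
      obtain t' where t': "t' \<in> \<Gamma> ?W" "\<forall>z \<in> ?W. t' z = s2 z"
        using restr[OF 2(1) W _ 2(4)] by auto
      obtain r where "r \<in> \<Gamma> ?W" "\<forall>z \<in> ?W. r z = s' z \<oplus>\<^bsub>E z\<^esub> t' z"
        using add[OF W s'(1) t'(1)] by blast
      then show ?thesis
        using W 1 2 s' t' by (intro exI[of _ ?W] exI[of _ r]) auto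
    qed
    then show ?thesis
      unfolding section_sheaf_carrier
      using val[OF s] val[OF t] E[OF pts[OF V], THEN module.axioms(2)]
      by (auto simp: abelian_monoid.a_closed abelian_group.axioms)
  qed
  have smultc: "f \<odot>\<^bsub>sect ?S V\<^esub> s \<in> carrier (sect ?S V)" if V: "openin (tsp Y) V"
    and f: "f \<in> hol Y V" and s: "s \<in> carrier (sect ?S V)" for V f s
  proof -
    have "\<exists>W r. openin (tsp Y) W \<and> y \<in> W \<and> W \<subseteq> V \<and> r \<in> \<Gamma> W \<and>
        (\<forall>z \<in> W. (f \<odot>\<^bsub>sect ?S V\<^esub> s) z = r z)" if y: "y \<in> V" for y
    proof -
      obtain W s1 where 1: "openin (tsp Y) W" "y \<in> W" "W \<subseteq> V" "s1 \<in> \<Gamma> W" "\<forall>z \<in> W. s z = s1 z"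
        using local[OF s y] by blast
      have f': "restrict f W \<in> hol Y W" using O.res_closed[OF V 1(1,3)] f by simp
      obtain r where r: "r \<in> \<Gamma> W" "\<forall>z \<in> W. r z = germ_fun Y z W (restrict f W) \<odot>\<^bsub>E z\<^esub> s1 z"
        using smult[OF 1(1) f' 1(4)] by blast
      have "germ_fun Y z W (restrict f W) = germ_fun Y z V f" if "z \<in> W" for z
        using O.germ_res[OF V 1(1,3) that] f by simp
      then show ?thesis
        using 1 r by (intro exI[of _ W] exI[of _ r]) auto
    qed
    then show ?thesis
      unfolding section_sheaf_carrier
      using val[OF s] E[OF pts[OF V], THEN module.smult_closed] O.germ_closed[OF V] f
      by auto
  qed
  have zeroc: "\<zero>\<^bsub>sect ?S V\<^esub> \<in> carrier (sect ?S V)" if V: "openin (tsp Y) V" for V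
  proof -
    obtain t where "t \<in> \<Gamma> V" "\<forall>z \<in> V. t z = \<zero>\<^bsub>E z\<^esub>" using zero[OF V] by blast
    then have "\<exists>W t. openin (tsp Y) W \<and> y \<in> W \<and> W \<subseteq> V \<and> t \<in> \<Gamma> W \<and>
        (\<forall>z \<in> W. \<zero>\<^bsub>sect ?S V\<^esub> z = t z)" if "y \<in> V" for y
      using V that by (intro exI[of _ V] exI[of _ t]) auto
    then show ?thesis
      unfolding section_sheaf_carrier using E[OF pts[OF V], THEN module.axioms(2)]
      by (auto simp: abelian_monoid.zero_closed abelian_group.axioms)
  qed
  have mod: "Module.module (sect (structure_sheaf Y) V) (sect ?S V)" if V: "openin (tsp Y) V" for V
  proof (rule moduleI)
    note M = E[OF pts[OF V]]
    note A = M[THEN module.axioms(2)]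
    note m = A[THEN abelian_group.axioms(1)]
    interpret OV: cring "sect (structure_sheaf Y) V" using V by (rule O.cring_sect)
    show "cring (sect (structure_sheaf Y) V)" by (rule OV.is_cring)
    have g: "germ_fun Y y V f \<in> carrier (local_ring Y y)" if "y \<in> V" "f \<in> hol Y V" for y f
      using O.germ_closed[OF V] that by simp
    have gadd: "germ_fun Y y V (f \<oplus>\<^bsub>sect (structure_sheaf Y) V\<^esub> f') =
        germ_fun Y y V f \<oplus>\<^bsub>local_ring Y y\<^esub> germ_fun Y y V f'"
      and gmult: "germ_fun Y y V (f \<otimes>\<^bsub>sect (structure_sheaf Y) V\<^esub> f') =
        germ_fun Y y V f \<otimes>\<^bsub>local_ring Y y\<^esub> germ_fun Y y V f'"
      if "y \<in> V" "f \<in> hol Y V" "f' \<in> hol Y V" for y f f'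
      using O.germ_add[OF V] O.germ_mult[OF V] that by simp_all
    show "abelian_group (sect ?S V)"
    proof (rule abelian_groupI)
      fix s t u assume s: "s \<in> carrier (sect ?S V)" and t: "t \<in> carrier (sect ?S V)"
        and u: "u \<in> carrier (sect ?S V)"
      show "s \<oplus>\<^bsub>sect ?S V\<^esub> t \<in> carrier (sect ?S V)" using V s t by (rule addc)
      show "s \<oplus>\<^bsub>sect ?S V\<^esub> t \<oplus>\<^bsub>sect ?S V\<^esub> u = s \<oplus>\<^bsub>sect ?S V\<^esub> (t \<oplus>\<^bsub>sect ?S V\<^esub> u)"
        by (auto intro!: restrict_ext abelian_monoid.a_assoc[OF m] val[OF s] val[OF t] val[OF u])
      show "s \<oplus>\<^bsub>sect ?S V\<^esub> t = t \<oplus>\<^bsub>sect ?S V\<^esub> s"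
        by (auto intro!: restrict_ext abelian_monoid.a_comm[OF m] val[OF s] val[OF t])
      show "\<zero>\<^bsub>sect ?S V\<^esub> \<oplus>\<^bsub>sect ?S V\<^esub> s = s"
        by (rule ext[OF addc[OF V zeroc[OF V] s] s])
          (simp add: abelian_monoid.l_zero[OF m] val[OF s])
      \<comment> \<open>Distinguished maps are not assumed closed under negation; the additive
        inverse of \<open>s\<close> is obtained as its multiple by the constant function -1.\<close>
      define f where "f = \<ominus>\<^bsub>sect (structure_sheaf Y) V\<^esub> \<one>\<^bsub>sect (structure_sheaf Y) V\<^esub>"
      have f: "f \<in> hol Y V" using OV.a_inv_closed[OF OV.one_closed] by (simp add: f_def)
      have 1: "(\<lambda>x\<in>V. 1) \<in> hol Y V" using OV.one_closed by simp
      have "germ_fun Y y V f \<odot>\<^bsub>E y\<^esub> s y \<oplus>\<^bsub>E y\<^esub> s y = \<zero>\<^bsub>E y\<^esub>" if y: "y \<in> V" for y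
      proof -
        have "germ_fun Y y V f \<odot>\<^bsub>E y\<^esub> s y \<oplus>\<^bsub>E y\<^esub> s y =
            (germ_fun Y y V f \<oplus>\<^bsub>local_ring Y y\<^esub> \<one>\<^bsub>local_ring Y y\<^esub>) \<odot>\<^bsub>E y\<^esub> s y"
          using module.smult_l_distr[OF M, of y "germ_fun Y y V f" "\<one>\<^bsub>local_ring Y y\<^esub>" "s y"]
            g[OF y 1] y f g[OF y f] val[OF s y] O.germ_one[OF V y] module.smult_one[OF M, of y "s y"]
          by simp
        also have "germ_fun Y y V f \<oplus>\<^bsub>local_ring Y y\<^esub> \<one>\<^bsub>local_ring Y y\<^esub> = \<zero>\<^bsub>local_ring Y y\<^esub>"
          using gadd[OF y f 1] OV.l_neg[OF OV.one_closed] O.germ_one[OF V y] O.germ_zero[OF V y]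
          by (simp add: f_def)
        finally show ?thesis
          using module.smult_l_null[OF M] y val[OF s y] by simp
      qed
      then have "f \<odot>\<^bsub>sect ?S V\<^esub> s \<oplus>\<^bsub>sect ?S V\<^esub> s = \<zero>\<^bsub>sect ?S V\<^esub>"
        by auto
      then show "\<exists>t \<in> carrier (sect ?S V). t \<oplus>\<^bsub>sect ?S V\<^esub> s = \<zero>\<^bsub>sect ?S V\<^esub>"
        using smultc[OF V f s] by blast
    next
      show "\<zero>\<^bsub>sect ?S V\<^esub> \<in> carrier (sect ?S V)" using V by (rule zeroc)
    qed
    fix f f' s t assume f: "f \<in> carrier (sect (structure_sheaf Y) V)" and s: "s \<in> carrier (sect ?S V)"
    then show "f \<odot>\<^bsub>sect ?S V\<^esub> s \<in> carrier (sect ?S V)"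
      using smultc[OF V] by simp
    show "f \<odot>\<^bsub>sect ?S V\<^esub> (s \<oplus>\<^bsub>sect ?S V\<^esub> t) = f \<odot>\<^bsub>sect ?S V\<^esub> s \<oplus>\<^bsub>sect ?S V\<^esub> f \<odot>\<^bsub>sect ?S V\<^esub> t"
      if t: "t \<in> carrier (sect ?S V)"
      using f by (auto intro!: restrict_ext module.smult_r_distr[OF M] val[OF s] val[OF t] g)
    assume f': "f' \<in> carrier (sect (structure_sheaf Y) V)"
    show "(f \<oplus>\<^bsub>sect (structure_sheaf Y) V\<^esub> f') \<odot>\<^bsub>sect ?S V\<^esub> s =
        f \<odot>\<^bsub>sect ?S V\<^esub> s \<oplus>\<^bsub>sect ?S V\<^esub> f' \<odot>\<^bsub>sect ?S V\<^esub> s"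
      using f f' gadd g by (auto intro!: restrict_ext simp: module.smult_l_distr[OF M] val[OF s])
    show "(f \<otimes>\<^bsub>sect (structure_sheaf Y) V\<^esub> f') \<odot>\<^bsub>sect ?S V\<^esub> s =
        f \<odot>\<^bsub>sect ?S V\<^esub> (f' \<odot>\<^bsub>sect ?S V\<^esub> s)"
      using f f' gmult g by (auto intro!: restrict_ext simp: module.smult_assoc1[OF M] val[OF s])
  next
    fix s assume s: "s \<in> carrier (sect ?S V)"
    have 1: "(\<lambda>x\<in>V. 1) \<in> hol Y V" using cring.cring_simprules(6)[OF O.cring_sect[OF V]] by simp
    show "\<one>\<^bsub>sect (structure_sheaf Y) V\<^esub> \<odot>\<^bsub>sect ?S V\<^esub> s = s"
      by (rule ext[OF smultc[OF V _ s] s])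
        (use 1 O.germ_one[OF V] val[OF s] module.smult_one[OF E[OF pts[OF V]]] in auto)
  qed
  show ?thesis
  proof (intro module_presheaf.intro module_presheaf_axioms.intro additive_presheaf.intro
      additive_presheaf_axioms.intro S.presheaf_on_axioms O mod)
    show "abelian_group (sect ?S V)" if "openin (tsp Y) V" for V
      using mod[OF that] by (rule module.axioms(2))
  next
    fix U V s t f assume *: "openin (tsp Y) U" "openin (tsp Y) V" "V \<subseteq> U" "s \<in> carrier (sect ?S U)"
    show "res ?S U V (s \<oplus>\<^bsub>sect ?S U\<^esub> t) = res ?S U V s \<oplus>\<^bsub>sect ?S V\<^esub> res ?S U V t"
      using *(3) by (auto simp: fun_eq_iff restrict_def)
    show "res ?S U V (f \<odot>\<^bsub>sect ?S U\<^esub> s) = restrict f V \<odot>\<^bsub>sect ?S V\<^esub> res ?S U V s"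
      if "f \<in> hol Y U"
    proof
      show "res ?S U V (f \<odot>\<^bsub>sect ?S U\<^esub> s) z = (restrict f V \<odot>\<^bsub>sect ?S V\<^esub> res ?S U V s) z" for z
        using *(3) O.germ_res[OF *(1-3), of z f] that by (auto simp: restrict_def)
    qed
  qed
qed

section \<open>Quotients\<close>

context
  fixes R :: "('r, 'm) ring_scheme" and M :: "('r, 'a) module" and N :: "('r, 'b) module" and h K
  assumes M: "Module.module R M" and N: "abelian_group N" and h: "h \<in> mod_hom R M N"
  defines "K \<equiv> {x \<in> carrier M. h x = \<zero>\<^bsub>N\<^esub>}"
begin

interpretation M: module R M by (fact M)
interpretation N: abelian_group N by (fact N)

lemma mod_hom_props:
  "x \<in> carrier M \<Longrightarrow> h x \<in> carrier N"
  "\<lbrakk>x \<in> carrier M; y \<in> carrier M\<rbrakk> \<Longrightarrow> h (x \<oplus>\<^bsub>M\<^esub> y) = h x \<oplus>\<^bsub>N\<^esub> h y"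
  "\<lbrakk>a \<in> carrier R; x \<in> carrier M\<rbrakk> \<Longrightarrow> h (a \<odot>\<^bsub>M\<^esub> x) = a \<odot>\<^bsub>N\<^esub> h x"
  using h unfolding mod_hom_def by auto

text \<open>The difference of two points with the same image lies in the kernel. Describing cosets
  as fibres of \<open>h\<close> makes every operation on the quotient visibly independent of
  representatives.\<close>

lemma kernel_coset:
  assumes x: "x \<in> carrier M"
  shows "K +>\<^bsub>M\<^esub> x = {y \<in> carrier M. h y = h x}"
proof (intro equalityI subsetI)
  fix y assume "y \<in> K +>\<^bsub>M\<^esub> x"
  then show "y \<in> {y \<in> carrier M. h y = h x}"
    using x unfolding a_r_coset_def' K_def by (auto simp: mod_hom_props)
next
  fix y assume y: "y \<in> {y \<in> carrier M. h y = h x}"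
  let ?k = "y \<oplus>\<^bsub>M\<^esub> \<ominus>\<^bsub>M\<^esub> x"
  have yk: "y = ?k \<oplus>\<^bsub>M\<^esub> x" using x y by (simp add: M.a_assoc M.l_neg)
  have "h y = h ?k \<oplus>\<^bsub>N\<^esub> h x"
    using x y by (subst yk) (simp add: mod_hom_props)
  then have "h ?k = \<zero>\<^bsub>N\<^esub>"
    using x y mod_hom_props(1)[of x] mod_hom_props(1)[of ?k] by (simp add: N.add.r_cancel_one)
  then have "?k \<in> K" using x y unfolding K_def by auto
  then show "y \<in> K +>\<^bsub>M\<^esub> x" unfolding a_r_coset_def' using yk by blast
qed

lemma quot_mod_carrier: "A \<in> carrier (quot_mod M K) \<longleftrightarrow> (\<exists>x \<in> carrier M. A = K +>\<^bsub>M\<^esub> x)"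
  by (auto simp: quot_mod_def A_RCOSETS_def')

lemma induced_map_coset:
  assumes "x \<in> carrier M"
  shows "the_elem (h ` (K +>\<^bsub>M\<^esub> x)) = h x"
proof -
  have "h ` (K +>\<^bsub>M\<^esub> x) = {h x}" using assms by (auto simp: kernel_coset)
  then show ?thesis by simp
qed

lemma quot_mod_add:
  assumes "x \<in> carrier M" "y \<in> carrier M"
  shows "(K +>\<^bsub>M\<^esub> x) \<oplus>\<^bsub>quot_mod M K\<^esub> (K +>\<^bsub>M\<^esub> y) = K +>\<^bsub>M\<^esub> (x \<oplus>\<^bsub>M\<^esub> y)"
proof (intro equalityI subsetI)
  fix z assume "z \<in> (K +>\<^bsub>M\<^esub> x) \<oplus>\<^bsub>quot_mod M K\<^esub> (K +>\<^bsub>M\<^esub> y)"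
  then show "z \<in> K +>\<^bsub>M\<^esub> (x \<oplus>\<^bsub>M\<^esub> y)"
    using assms by (auto simp: quot_mod_def set_add_def' kernel_coset mod_hom_props)
next
  fix z assume "z \<in> K +>\<^bsub>M\<^esub> (x \<oplus>\<^bsub>M\<^esub> y)"
  then obtain k where k: "k \<in> K" "z = k \<oplus>\<^bsub>M\<^esub> (x \<oplus>\<^bsub>M\<^esub> y)"
    unfolding a_r_coset_def' by blast
  have "y = \<zero>\<^bsub>M\<^esub> \<oplus>\<^bsub>M\<^esub> y" "\<zero>\<^bsub>M\<^esub> \<in> K"
    using assms mod_hom_props(2)[of "\<zero>\<^bsub>M\<^esub>" "\<zero>\<^bsub>M\<^esub>"] mod_hom_props(1)[of "\<zero>\<^bsub>M\<^esub>"]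
    by (simp_all add: K_def N.add.r_cancel_one)
  then have "y \<in> K +>\<^bsub>M\<^esub> y" "k \<oplus>\<^bsub>M\<^esub> x \<in> K +>\<^bsub>M\<^esub> x"
    using k unfolding a_r_coset_def' by blast+
  moreover have "z = (k \<oplus>\<^bsub>M\<^esub> x) \<oplus>\<^bsub>M\<^esub> y"
    using k assms by (simp add: K_def M.a_assoc)
  ultimately show "z \<in> (K +>\<^bsub>M\<^esub> x) \<oplus>\<^bsub>quot_mod M K\<^esub> (K +>\<^bsub>M\<^esub> y)"
    unfolding quot_mod_def set_add_def' by auto
qed

lemma quot_mod_smult:
  assumes "r \<in> carrier R" "x \<in> carrier M"
  shows "r \<odot>\<^bsub>quot_mod M K\<^esub> (K +>\<^bsub>M\<^esub> x) = K +>\<^bsub>M\<^esub> (r \<odot>\<^bsub>M\<^esub> x)"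
proof -
  have "K +>\<^bsub>M\<^esub> (r \<odot>\<^bsub>M\<^esub> y) = K +>\<^bsub>M\<^esub> (r \<odot>\<^bsub>M\<^esub> x)" if "y \<in> K +>\<^bsub>M\<^esub> x" for y
    using that assms by (simp add: kernel_coset mod_hom_props)
  moreover have "x \<in> K +>\<^bsub>M\<^esub> x" using assms by (simp add: kernel_coset)
  ultimately have "(\<lambda>y. K +>\<^bsub>M\<^esub> (r \<odot>\<^bsub>M\<^esub> y)) ` (K +>\<^bsub>M\<^esub> x) = {K +>\<^bsub>M\<^esub> (r \<odot>\<^bsub>M\<^esub> x)}"
    by blast
  then show ?thesis by (simp add: quot_mod_def)
qed

lemma induced_map_hom: "(\<lambda>A. the_elem (h ` A)) \<in> mod_hom R (quot_mod M K) N"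
  unfolding mod_hom_def
  by (auto simp: quot_mod_carrier quot_mod_add quot_mod_smult induced_map_coset mod_hom_props)

lemma induced_map_bij:
  assumes "h ` carrier M = carrier N"
  shows "bij_betw (\<lambda>A. the_elem (h ` A)) (carrier (quot_mod M K)) (carrier N)"
proof (rule bij_betw_imageI)
  show "inj_on (\<lambda>A. the_elem (h ` A)) (carrier (quot_mod M K))"
    by (rule inj_onI) (auto simp: quot_mod_carrier induced_map_coset, auto simp: kernel_coset)
  show "(\<lambda>A. the_elem (h ` A)) ` carrier (quot_mod M K) = carrier N"
  proof (intro equalityI subsetI)
    fix n assume "n \<in> carrier N"
    then obtain x where "x \<in> carrier M" "n = h x" using assms by blast
    then show "n \<in> (\<lambda>A. the_elem (h ` A)) ` carrier (quot_mod M K)"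
      by (intro image_eqI[of _ _ "K +>\<^bsub>M\<^esub> x"]) (auto simp: quot_mod_carrier induced_map_coset)
  qed (auto simp: quot_mod_carrier induced_map_coset mod_hom_props)
qed

end

text \<open>The homomorphism theorem for sheaves, with local surjectivity in the role of
  surjectivity. On stalks \<open>c\<close> induces maps \<open>cs z\<close>, which are onto by
  \<open>surj\<close>. Their kernel is \<open>sub_stalk\<close>: if the germ of \<open>c U s\<close>
  vanishes, then \<open>c\<close> kills the restriction of \<open>s\<close> to a neighbourhood, and
  this restriction lies in \<open>N\<close>. The module version then gives bijections
  \<open>l z\<close>, which are assembled by \<open>sheaf_iso_of_stalk_maps\<close>.\<close>

theorem (in module_sheaf) quot_sheaf_iso:
  fixes I :: "('p, 't) apresheaf"
  assumes I: "module_presheaf X I" and c: "sheaf_hom X I M c"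
    and ker: "\<And>U. openin (tsp X) U \<Longrightarrow> N U = {s \<in> carrier (sect I U). c U s = \<zero>\<^bsub>sect M U\<^esub>}"
    and surj: "\<And>V r y. \<lbrakk>openin (tsp X) V; r \<in> carrier (sect M V); y \<in> V\<rbrakk> \<Longrightarrow>
      \<exists>W s. openin (tsp X) W \<and> y \<in> W \<and> W \<subseteq> V \<and> s \<in> carrier (sect I W) \<and> c W s = res M V W r"
  shows "\<exists>h. sheaf_iso X (quot_sheaf X I N) M h \<and>
    (\<forall>V s. openin (tsp X) V \<and> s \<in> carrier (sect I V) \<longrightarrow> h V (quot_proj X I N V s) = c V s)"
proof -
  interpret I: module_presheaf X I by (fact I)
  have cU: "c U \<in> mod_hom (sect (structure_sheaf X) U) (sect I U) (sect M U)" if "openin (tsp X) U" for U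
    using c that unfolding sheaf_hom_def by blast
  have c_closed: "c U s \<in> carrier (sect M U)" if "openin (tsp X) U" "s \<in> carrier (sect I U)" for U s
    using cU[OF that(1)] that(2) unfolding mod_hom_def by auto
  have c_add: "c U (s \<oplus>\<^bsub>sect I U\<^esub> t) = c U s \<oplus>\<^bsub>sect M U\<^esub> c U t"
    if "openin (tsp X) U" "s \<in> carrier (sect I U)" "t \<in> carrier (sect I U)" for U s t
    using cU[OF that(1)] that(2,3) unfolding mod_hom_def by auto
  have c_smult: "c U (f \<odot>\<^bsub>sect I U\<^esub> s) = f \<odot>\<^bsub>sect M U\<^esub> c U s"
    if "openin (tsp X) U" "f \<in> hol X U" "s \<in> carrier (sect I U)" for U f s
    using cU[OF that(1)] that(2,3) unfolding mod_hom_def by auto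
  have c_res: "c V (res I U V s) = res M U V (c U s)"
    if "openin (tsp X) U" "openin (tsp X) V" "V \<subseteq> U" "s \<in> carrier (sect I U)" for U V s
    using c that unfolding sheaf_hom_def by blast
  define cs where "cs z A = (\<Union>(U, s) \<in> A. germ (tsp X) M z U (c U s))" for z A
  have cs: "cs z (germ (tsp X) I z U s) = germ (tsp X) M z U (c U s)"
    if "openin (tsp X) U" "z \<in> U" "s \<in> carrier (sect I U)" for z U s
    unfolding cs_def using that c_closed c_res I.presheaf_on_axioms presheaf_on_axioms
    by (intro germ_map[where p = "\<lambda>U. U"]) auto
  have cs_hom: "cs z \<in> mod_hom (local_ring X z) (stalk_mod X I z) (stalk_mod X M z)"
    if "z \<in> pts X" for z
    unfolding mod_hom_def stalk_mod_simps
  proof (intro CollectI conjI ballI)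
    show "cs z \<in> carrier (stalk (tsp X) I z) \<rightarrow> carrier (stalk (tsp X) M z)"
    proof
      fix A assume "A \<in> carrier (stalk (tsp X) I z)"
      then show "cs z A \<in> carrier (stalk (tsp X) M z)"
        by (elim I.stalk_cases) (simp add: cs c_closed germ_closed)
    qed
  next
    fix A B assume "A \<in> carrier (stalk (tsp X) I z)" "B \<in> carrier (stalk (tsp X) I z)"
    then obtain U s t where U: "openin (tsp X) U" "z \<in> U" "s \<in> carrier (sect I U)"
      "t \<in> carrier (sect I U)" "A = germ (tsp X) I z U s" "B = germ (tsp X) I z U t"
      by (rule I.stalk_cases2)
    show "cs z (A \<oplus>\<^bsub>stalk (tsp X) I z\<^esub> B) = cs z A \<oplus>\<^bsub>stalk (tsp X) M z\<^esub> cs z B"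
      unfolding U(5,6) using U(1-4)
      by (simp add: cs c_closed c_add germ_add I.germ_add I.add_sect_closed)
  next
    fix f A assume "f \<in> carrier (local_ring X z)" "A \<in> carrier (stalk (tsp X) I z)"
    then obtain U g s where U: "openin (tsp X) U" "z \<in> U" "g \<in> hol X U" "s \<in> carrier (sect I U)"
      "f = germ_fun X z U g" "A = germ (tsp X) I z U s"
      by (rule I.ring_module_stalk_cases)
    show "cs z (f \<odot>\<^bsub>stalk_mod X I z\<^esub> A) = f \<odot>\<^bsub>stalk_mod X M z\<^esub> cs z A"
      unfolding U(5,6) using U(1-4)
      by (simp add: cs c_closed c_smult germ_smult I.germ_smult I.smult_sect_closed)
  qed
  have sub: "sub_stalk X I N z = {A \<in> carrier (stalk_mod X I z). cs z A = \<zero>\<^bsub>stalk_mod X M z\<^esub>}"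
    if z: "z \<in> pts X" for z
  proof (intro equalityI subsetI)
    fix A assume "A \<in> sub_stalk X I N z"
    then obtain U s where "openin (tsp X) U" "z \<in> U" "s \<in> N U" "A = germ (tsp X) I z U s"
      unfolding sub_stalk_def by blast
    then show "A \<in> {A \<in> carrier (stalk_mod X I z). cs z A = \<zero>\<^bsub>stalk_mod X M z\<^esub>}"
      by (simp add: ker cs germ_zero I.germ_closed)
  next
    fix A assume A: "A \<in> {A \<in> carrier (stalk_mod X I z). cs z A = \<zero>\<^bsub>stalk_mod X M z\<^esub>}"
    then obtain U s where U: "openin (tsp X) U" "z \<in> U" "s \<in> carrier (sect I U)"
      "A = germ (tsp X) I z U s"
      using I.stalk_cases[of A z] by (metis (lifting) mem_Collect_eq stalk_mod_simps(1))
    have "germ (tsp X) M z U (c U s) = \<zero>\<^bsub>stalk (tsp X) M z\<^esub>"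
      using A U by (simp add: cs)
    then obtain W where W: "openin (tsp X) W" "z \<in> W" "W \<subseteq> U" "res M U W (c U s) = \<zero>\<^bsub>sect M W\<^esub>"
      by (rule germ_eq_zeroD) (use U c_closed in auto)
    then have "res I U W s \<in> N W" "A = germ (tsp X) I z W (res I U W s)"
      using U by (simp_all add: ker c_res I.res_closed I.germ_res)
    then show "A \<in> sub_stalk X I N z"
      unfolding sub_stalk_def using W by blast
  qed
  define l where "l z A = the_elem (cs z ` A)" for z A
  have qhom: "l z \<in> mod_hom (local_ring X z) (quot_mod (stalk_mod X I z) (sub_stalk X I N z)) (stalk_mod X M z)"
    if z: "z \<in> pts X" for z
    unfolding l_def[abs_def] sub[OF z]
    using I.stalk_module[OF z] stalk_module[OF z, THEN module.axioms(2)] cs_hom[OF z]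
    by (rule induced_map_hom)
  have ql: "l z (quot_proj X I N U s z) = germ (tsp X) M z U (c U s)"
    "quot_proj X I N U s z \<in> carrier (quot_mod (stalk_mod X I z) (sub_stalk X I N z))"
    if U: "openin (tsp X) U" "z \<in> U" "s \<in> carrier (sect I U)" for z U s
  proof -
    have z: "z \<in> pts X" using U openin_subset by blast
    have g: "germ (tsp X) I z U s \<in> carrier (stalk_mod X I z)"
      using U by (simp add: I.germ_closed)
    show "l z (quot_proj X I N U s z) = germ (tsp X) M z U (c U s)"
      unfolding l_def quot_proj_def restrict_apply'[OF U(2)] sub[OF z]
      using induced_map_coset[OF I.stalk_module[OF z] stalk_module[OF z, THEN module.axioms(2)] cs_hom[OF z] g]
        cs[OF U] by simp
    show "quot_proj X I N U s z \<in> carrier (quot_mod (stalk_mod X I z) (sub_stalk X I N z))"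
      unfolding quot_proj_def restrict_apply'[OF U(2)] quot_mod_def A_RCOSETS_def'
      using g by auto
  qed
  have cs_surj: "cs z ` carrier (stalk_mod X I z) = carrier (stalk_mod X M z)" if z: "z \<in> pts X" for z
  proof (intro equalityI subsetI)
    fix m assume "m \<in> carrier (stalk_mod X M z)"
    then obtain V r where V: "openin (tsp X) V" "z \<in> V" "r \<in> carrier (sect M V)" "m = germ (tsp X) M z V r"
      using stalk_cases[of m z] by (metis stalk_mod_simps(1))
    obtain W s where W: "openin (tsp X) W" "z \<in> W" "W \<subseteq> V" "s \<in> carrier (sect I W)" "c W s = res M V W r"
      using surj[OF V(1,3,2)] by blast
    have "m = cs z (germ (tsp X) I z W s)"
      using V W by (simp add: cs germ_res)
    then show "m \<in> cs z ` carrier (stalk_mod X I z)"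
      using W by (simp add: I.germ_closed)
  qed (use cs_hom[OF z] in \<open>auto simp: mod_hom_def\<close>)
  have bij: "bij_betw (l z) (carrier (quot_mod (stalk_mod X I z) (sub_stalk X I N z)))
      (carrier (stalk (tsp X) M z))" if z: "z \<in> pts X" for z
    unfolding l_def[abs_def] sub[OF z]
    using induced_map_bij[OF I.stalk_module[OF z] stalk_module[OF z, THEN module.axioms(2)] cs_hom[OF z]
        cs_surj[OF z]] by simp
  define h where "h V s = (THE t. t \<in> carrier (sect M V) \<and> (\<forall>y \<in> V. germ (tsp X) M y V t = l y (s y)))"
    for V s
  have loc: "\<exists>W' r. openin (tsp X) W' \<and> y \<in> W' \<and> W' \<subseteq> W \<and> r \<in> carrier (sect M W') \<and>
      (\<forall>z \<in> W'. germ (tsp X) M z W' r = l z (t z))"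
    if W: "openin (tsp X) W" "t \<in> quot_proj X I N W ` carrier (sect I W)" "y \<in> W" for W t y
  proof -
    obtain s where s: "s \<in> carrier (sect I W)" "t = quot_proj X I N W s" using W(2) by blast
    then show ?thesis
      using W c_closed ql(1) by (intro exI[of _ W] exI[of _ "c W s"]) auto
  qed
  have loc': "\<exists>W t. openin (tsp X) W \<and> y \<in> W \<and> W \<subseteq> V \<and> t \<in> quot_proj X I N W ` carrier (sect I W) \<and>
      (\<forall>z \<in> W. t z \<in> carrier (quot_mod (stalk_mod X I z) (sub_stalk X I N z)) \<and>
        germ (tsp X) M z V r = l z (t z))"
    if V: "openin (tsp X) V" "r \<in> carrier (sect M V)" "y \<in> V" for V r y
  proof -
    obtain W s where W: "openin (tsp X) W" "y \<in> W" "W \<subseteq> V" "s \<in> carrier (sect I W)" "c W s = res M V W r"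
      using surj[OF V] by blast
    have "germ (tsp X) M z V r = l z (quot_proj X I N W s z)" if "z \<in> W" for z
      using germ_res[OF V(1) W(1,3) that V(2)] ql(1)[OF W(1) that W(4)] W(5) by simp
    then show ?thesis
      using W ql(2)[OF W(1) _ W(4)] by (intro exI[of _ W] exI[of _ "quot_proj X I N W s"]) blast
  qed
  have "sheaf_iso X (quot_sheaf X I N) M h"
    unfolding quot_sheaf_def h_def by (rule sheaf_iso_of_stalk_maps) (fact qhom bij loc loc')+
  \<comment> \<open>\<open>c V s\<close> has the germs that characterize the value of
    \<open>h V\<close>, and a section is determined by its germs; \<open>quot_proj\<close> does not
    have to be recognized as a section of the quotient sheaf first.\<close>
  moreover have "h V (quot_proj X I N V s) = c V s"
    if "openin (tsp X) V" "s \<in> carrier (sect I V)" for V s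
    unfolding h_def
    by (rule sheaf_hom_of_stalk_maps(3)[where \<Gamma> = "\<lambda>W. quot_proj X I N W ` carrier (sect I W)"])
      (fact qhom loc that c_closed[OF that] | simp add: ql(1)[OF that(1) _ that(2)])+
  ultimately show ?thesis
    by blast
qed

section \<open>Extension of scalars\<close>

lemma Union_const: "\<lbrakk>a \<in> A; \<And>x. x \<in> A \<Longrightarrow> f x = c\<rbrakk> \<Longrightarrow> (\<Union>x \<in> A. f x) = c"
  by auto

text \<open>Closure of \<open>M\<close> and \<phi> is all that is required of the source, since the
  module laws of the tensor product come from \<open>S\<close> and from the relations. In this form
  the locale applies to stalks of a direct image over \<open>X\<close>.\<close>

locale scalar_extension = S: cring S
  for R :: "('r, 'm) ring_scheme" and S :: "('s, 'n) ring_scheme" and \<phi> :: "'r \<Rightarrow> 's"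
    and M :: "('r, 'a) module" +
  assumes add_closed: "\<lbrakk>x \<in> carrier M; y \<in> carrier M\<rbrakk> \<Longrightarrow> x \<oplus>\<^bsub>M\<^esub> y \<in> carrier M"
    and smult_closed: "\<lbrakk>r \<in> carrier R; x \<in> carrier M\<rbrakk> \<Longrightarrow> r \<odot>\<^bsub>M\<^esub> x \<in> carrier M"
    and phi_closed: "r \<in> carrier R \<Longrightarrow> \<phi> r \<in> carrier S"
begin

definition tensors :: "('a \<times> 's \<Rightarrow>\<^sub>0 int) set" where
  "tensors = {f. Poly_Mapping.keys f \<subseteq> carrier M \<times> carrier S}"

abbreviation cls :: "('a \<times> 's \<Rightarrow>\<^sub>0 int) \<Rightarrow> ('a \<times> 's \<Rightarrow>\<^sub>0 int) set" where
  "cls \<equiv> tensor_class R S \<phi> M"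

abbreviation tmult :: "'s \<Rightarrow> ('a \<times> 's \<Rightarrow>\<^sub>0 int) \<Rightarrow> ('a \<times> 's \<Rightarrow>\<^sub>0 int)" where
  "tmult t \<equiv> frag_extend (\<lambda>(x, s). frag_of (x, t \<otimes>\<^bsub>S\<^esub> s))"

lemma tensors_closed:
  "0 \<in> tensors"
  "\<lbrakk>f \<in> tensors; g \<in> tensors\<rbrakk> \<Longrightarrow> f - g \<in> tensors"
  "\<lbrakk>f \<in> tensors; g \<in> tensors\<rbrakk> \<Longrightarrow> f + g \<in> tensors"
  "f \<in> tensors \<Longrightarrow> - f \<in> tensors"
  "\<lbrakk>x \<in> carrier M; s \<in> carrier S\<rbrakk> \<Longrightarrow> frag_of (x, s) \<in> tensors"
  using keys_diff[of f g] keys_add[of f g] unfolding tensors_def by auto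

lemma tensors_induct [consumes 1, case_names zero one diff]:
  assumes "f \<in> tensors" "P 0"
    and "\<And>x s. \<lbrakk>x \<in> carrier M; s \<in> carrier S\<rbrakk> \<Longrightarrow> P (frag_of (x, s))"
    and "\<And>f g. \<lbrakk>P f; P g\<rbrakk> \<Longrightarrow> P (f - g)"
  shows "P f"
  using assms(1)[unfolded tensors_def mem_Collect_eq]
  by (induction rule: frag_induction) (use assms in auto)

lemma rel_tensors: "f \<in> tensor_rel R S \<phi> M \<Longrightarrow> f \<in> tensors"
proof (induction rule: tensor_rel.induct)
  case (diff f g) show ?case using diff(3,4) by (rule tensors_closed(2))
next
  case (add_left x y s) then show ?case by (intro tensors_closed(2,5) add_closed)
next
  case (add_right x s t) then show ?case by (intro tensors_closed(2,5)) simp_all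
next
  case (balanced r x s)
  then show ?case by (intro tensors_closed(2,5)) (simp_all add: smult_closed phi_closed)
qed (rule tensors_closed(1))

lemma rel_uminus: "f \<in> tensor_rel R S \<phi> M \<Longrightarrow> - f \<in> tensor_rel R S \<phi> M"
  using tensor_rel.diff[OF tensor_rel.zero] by fastforce

lemma rel_add: "\<lbrakk>f \<in> tensor_rel R S \<phi> M; g \<in> tensor_rel R S \<phi> M\<rbrakk> \<Longrightarrow> f + g \<in> tensor_rel R S \<phi> M"
  using tensor_rel.diff[OF _ rel_uminus] by fastforce

lemma cls_mem: "f \<in> tensors \<Longrightarrow> f \<in> cls f"
  unfolding tensor_class_def tensors_def using tensor_rel.zero by auto

lemma cls_eq_iff:
  assumes "f \<in> tensors"
  shows "cls f = cls g \<longleftrightarrow> f - g \<in> tensor_rel R S \<phi> M"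
proof
  assume "cls f = cls g"
  then show "f - g \<in> tensor_rel R S \<phi> M"
    using cls_mem[OF assms] unfolding tensor_class_def by auto
next
  assume fg: "f - g \<in> tensor_rel R S \<phi> M"
  have "h - f \<in> tensor_rel R S \<phi> M \<longleftrightarrow> h - g \<in> tensor_rel R S \<phi> M" for h
    using rel_add[of "h - f" "f - g"] tensor_rel.diff[of "h - g" _ _ _ _ "f - g"] fg by auto
  then show "cls f = cls g" unfolding tensor_class_def by blast
qed

lemma cls_eq_mem: "\<lbrakk>f \<in> tensors; g \<in> cls f\<rbrakk> \<Longrightarrow> g \<in> tensors \<and> g - f \<in> tensor_rel R S \<phi> M"
  unfolding tensor_class_def tensors_def by auto

lemma tmult_tensors: "\<lbrakk>t \<in> carrier S; f \<in> tensors\<rbrakk> \<Longrightarrow> tmult t f \<in> tensors"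
  by (erule tensors_induct)
    (simp_all add: frag_extend_diff tensors_closed)

text \<open>Stability of the relations makes the action of \<open>S\<close> on classes well defined.
  In the balanced case commutativity of \<open>S\<close> moves \<open>t\<close> past
  \<open>\<phi> r\<close>.\<close>

lemma tmult_rel:
  assumes t: "t \<in> carrier S" and f: "f \<in> tensor_rel R S \<phi> M"
  shows "tmult t f \<in> tensor_rel R S \<phi> M"
  using f
proof (induction rule: tensor_rel.induct)
  case (diff f g) then show ?case by (simp add: frag_extend_diff tensor_rel.diff)
next
  case (add_left x y s) then show ?case by (simp add: frag_extend_diff tensor_rel.add_left t)
next
  case (add_right x s u)
  then show ?case by (simp add: frag_extend_diff tensor_rel.add_right t S.r_distr)
next
  case (balanced r x s)
  then show ?case
    using tensor_rel.balanced[of r R x M "t \<otimes>\<^bsub>S\<^esub> s" S \<phi>]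
    by (simp add: frag_extend_diff t S.m_lcomm phi_closed)
qed (simp add: tensor_rel.zero)

lemma base_change_carrier: "A \<in> carrier (base_change R S \<phi> M) \<longleftrightarrow> (\<exists>f \<in> tensors. A = cls f)"
  unfolding base_change_def tensors_def by auto

lemma base_change_zero: "\<zero>\<^bsub>base_change R S \<phi> M\<^esub> = cls 0"
  unfolding base_change_def by simp

lemma base_change_add:
  assumes "f \<in> tensors" "g \<in> tensors"
  shows "cls f \<oplus>\<^bsub>base_change R S \<phi> M\<^esub> cls g = cls (f + g)"
proof -
  have "cls (f' + g') = cls (f + g)" if "f' \<in> cls f" "g' \<in> cls g" for f' g'
  proof -
    have "f' \<in> tensors" "g' \<in> tensors" "(f' - f) + (g' - g) \<in> tensor_rel R S \<phi> M"
      using that assms cls_eq_mem by (auto intro: rel_add)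
    moreover have "(f' - f) + (g' - g) = (f' + g') - (f + g)" by simp
    ultimately show ?thesis
      by (subst cls_eq_iff) (auto intro: tensors_closed(3))
  qed
  then have "(\<Union>f' \<in> cls f. \<Union>g' \<in> cls g. cls (f' + g')) = cls (f + g)"
    by (intro Union_const[OF cls_mem[OF assms(1)]] Union_const[OF cls_mem[OF assms(2)]])
  then show ?thesis unfolding base_change_def by simp
qed

lemma base_change_smult:
  assumes "t \<in> carrier S" "f \<in> tensors"
  shows "t \<odot>\<^bsub>base_change R S \<phi> M\<^esub> cls f = cls (tmult t f)"
proof -
  have "cls (tmult t f') = cls (tmult t f)" if "f' \<in> cls f" for f'
  proof -
    have f': "f' \<in> tensors" "tmult t (f' - f) \<in> tensor_rel R S \<phi> M"
      using that assms cls_eq_mem by (auto intro: tmult_rel)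
    then show ?thesis
      using tmult_tensors[OF assms(1) f'(1)] by (simp add: cls_eq_iff frag_extend_diff)
  qed
  then have "(\<Union>f' \<in> cls f. cls (tmult t f')) = cls (tmult t f)"
    by (intro Union_const[OF cls_mem[OF assms(2)]])
  then show ?thesis unfolding base_change_def by simp
qed

text \<open>The associative and unit laws of the action hold already in the free group.
  Distributivity over the sum of scalars holds only modulo the \<open>add_right\<close>
  relations.\<close>

lemma tmult_add_rel:
  assumes "a \<in> carrier S" "b \<in> carrier S" "f \<in> tensors"
  shows "tmult (a \<oplus>\<^bsub>S\<^esub> b) f - (tmult a f + tmult b f) \<in> tensor_rel R S \<phi> M"
  using assms(3)
proof (induction rule: tensors_induct)
  case (one x s)
  then show ?case
    using tensor_rel.add_right[of x M "a \<otimes>\<^bsub>S\<^esub> s" S "b \<otimes>\<^bsub>S\<^esub> s"] assms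
    by (simp add: S.l_distr diff_diff_eq)
next
  case (diff f g)
  then show ?case
    using tensor_rel.diff[OF diff] by (simp add: frag_extend_diff algebra_simps)
qed (simp add: tensor_rel.zero)

lemma cls_tmult_add:
  assumes "a \<in> carrier S" "b \<in> carrier S" "f \<in> tensors"
  shows "cls (tmult (a \<oplus>\<^bsub>S\<^esub> b) f) = cls (tmult a f + tmult b f)"
  by (subst cls_eq_iff) (simp_all add: tmult_tensors tmult_add_rel assms)

lemma tmult_mult:
  assumes "a \<in> carrier S" "b \<in> carrier S" "f \<in> tensors"
  shows "tmult (a \<otimes>\<^bsub>S\<^esub> b) f = tmult a (tmult b f)"
  using assms(3)
  by (induction rule: tensors_induct) (simp_all add: frag_extend_diff S.m_assoc assms)

lemma tmult_one: "f \<in> tensors \<Longrightarrow> tmult \<one>\<^bsub>S\<^esub> f = f"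
  by (induction rule: tensors_induct) (simp_all add: frag_extend_diff)

lemma base_change_module: "Module.module S (base_change R S \<phi> M)"
proof (rule moduleI)
  show "cring S" by (rule S.is_cring)
  show "abelian_group (base_change R S \<phi> M)"
  proof (rule abelian_groupI)
    fix A assume "A \<in> carrier (base_change R S \<phi> M)"
    then obtain f where f: "f \<in> tensors" "A = cls f" unfolding base_change_carrier by blast
    show "\<exists>B \<in> carrier (base_change R S \<phi> M). B \<oplus>\<^bsub>base_change R S \<phi> M\<^esub> A = \<zero>\<^bsub>base_change R S \<phi> M\<^esub>"
      using tensors_closed(4)[OF f(1)] f
      by (intro bexI[of _ "cls (- f)"])
        (auto simp: base_change_add base_change_zero base_change_carrier)
  next
    show "\<zero>\<^bsub>base_change R S \<phi> M\<^esub> \<in> carrier (base_change R S \<phi> M)"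
      unfolding base_change_carrier base_change_zero using tensors_closed(1) by blast
  qed (use tensors_closed(1,3) in \<open>auto simp: base_change_carrier base_change_add base_change_zero
      ac_simps\<close>)
qed (use tensors_closed(3) tmult_tensors in \<open>auto simp: base_change_carrier
    base_change_add base_change_smult frag_extend_add tmult_mult tmult_one cls_tmult_add\<close>)

end

section \<open>Extending a semilinear map to the tensor product\<close>

locale scalar_extension_lift = scalar_extension R S \<phi> M + N: module S N
  for R :: "('r, 'm) ring_scheme" and S :: "('s, 'n) ring_scheme" and \<phi> :: "'r \<Rightarrow> 's"
    and M :: "('r, 'a) module" and N :: "('s, 'b) module" +
  fixes D :: "'a \<Rightarrow> 'b"
  assumes D_closed: "x \<in> carrier M \<Longrightarrow> D x \<in> carrier N"
    and D_add: "\<lbrakk>x \<in> carrier M; y \<in> carrier M\<rbrakk> \<Longrightarrow> D (x \<oplus>\<^bsub>M\<^esub> y) = D x \<oplus>\<^bsub>N\<^esub> D y"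
    and D_smult: "\<lbrakk>r \<in> carrier R; x \<in> carrier M\<rbrakk> \<Longrightarrow> D (r \<odot>\<^bsub>M\<^esub> x) = \<phi> r \<odot>\<^bsub>N\<^esub> D x"
begin

text \<open>The formula is the one inside \<open>canonical_stalk\<close>; the canonical map on
  stalks thus equals \<open>lift\<close> by unfolding, and inherits its well-definedness and
  linearity.\<close>

definition lift_free :: "('a \<times> 's \<Rightarrow>\<^sub>0 int) \<Rightarrow> 'b" where
  "lift_free f = (\<Oplus>\<^bsub>N\<^esub>p \<in> Poly_Mapping.keys f.
      add_pow N (Poly_Mapping.lookup f p) (snd p \<odot>\<^bsub>N\<^esub> D (fst p)))"

lemma add_pow_int_0: "add_pow N (0 :: int) x = \<zero>\<^bsub>N\<^esub>"
  by (simp add: add_pow_def int_pow_def)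

lemma add_pow_int_1: "x \<in> carrier N \<Longrightarrow> add_pow N (1 :: int) x = x"
  by (simp add: add_pow_def int_pow_def)

text \<open>Cancellation can make the support of a sum smaller than the union of the supports. Sums
  over different supports are compared by extending them to a common finite index set, where the new
  terms are zero.\<close>

lemma lift_free_eq:
  assumes "finite A" "Poly_Mapping.keys f \<subseteq> A" "A \<subseteq> carrier M \<times> carrier S"
  shows "lift_free f = (\<Oplus>\<^bsub>N\<^esub>p \<in> A. add_pow N (Poly_Mapping.lookup f p) (snd p \<odot>\<^bsub>N\<^esub> D (fst p)))"
  unfolding lift_free_def
  using assms D_closed
  by (intro N.M.add.finprod_mono_neutral_cong_left) (auto simp: in_keys_iff add_pow_int_0)

lemma lift_free_closed: "f \<in> tensors \<Longrightarrow> lift_free f \<in> carrier N"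
  unfolding lift_free_def tensors_def using D_closed by (intro N.M.finsum_closed) auto

lemma lift_free_add:
  assumes "f \<in> tensors" "g \<in> tensors"
  shows "lift_free (f + g) = lift_free f \<oplus>\<^bsub>N\<^esub> lift_free g"
proof -
  let ?A = "Poly_Mapping.keys f \<union> Poly_Mapping.keys g"
  have A: "finite ?A" "?A \<subseteq> carrier M \<times> carrier S" using assms unfolding tensors_def by auto
  have e: "snd p \<odot>\<^bsub>N\<^esub> D (fst p) \<in> carrier N" if "p \<in> ?A" for p
    using that A(2) D_closed by auto
  have "lift_free (f + g) = (\<Oplus>\<^bsub>N\<^esub>p \<in> ?A. add_pow N (Poly_Mapping.lookup f p) (snd p \<odot>\<^bsub>N\<^esub> D (fst p)) \<oplus>\<^bsub>N\<^esub>
      add_pow N (Poly_Mapping.lookup g p) (snd p \<odot>\<^bsub>N\<^esub> D (fst p)))"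
    unfolding lift_free_eq[OF A(1) keys_add A(2)] using e
    by (intro N.M.finsum_cong') (auto simp: lookup_add N.M.add.int_pow_mult)
  also have "\<dots> = lift_free f \<oplus>\<^bsub>N\<^esub> lift_free g"
    using e A by (subst N.M.finsum_addf) (auto simp: lift_free_eq[of ?A])
  finally show ?thesis .
qed

lemma lift_free_diff:
  assumes "f \<in> tensors" "g \<in> tensors"
  shows "lift_free (f - g) = lift_free f \<ominus>\<^bsub>N\<^esub> lift_free g"
proof -
  have "lift_free f = lift_free (f - g) \<oplus>\<^bsub>N\<^esub> lift_free g"
    using lift_free_add[OF tensors_closed(2)[OF assms] assms(2)] by simp
  then show ?thesis
    using lift_free_closed[OF tensors_closed(2)[OF assms]] lift_free_closed[OF assms(2)]
    by (simp add: N.M.minus_eq N.M.a_assoc N.M.r_neg)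
qed

lemma lift_free_zero: "lift_free 0 = \<zero>\<^bsub>N\<^esub>"
  by (simp add: lift_free_def)

lemma lift_free_of:
  assumes "x \<in> carrier M" "s \<in> carrier S"
  shows "lift_free (frag_of (x, s)) = s \<odot>\<^bsub>N\<^esub> D x"
  using assms D_closed by (simp add: lift_free_def add_pow_int_1)

lemma add_diff_diff_zero:
  assumes "a \<in> carrier N" "b \<in> carrier N"
  shows "a \<oplus>\<^bsub>N\<^esub> b \<ominus>\<^bsub>N\<^esub> a \<ominus>\<^bsub>N\<^esub> b = \<zero>\<^bsub>N\<^esub>"
  using assms N.M.r_neg[of "a \<oplus>\<^bsub>N\<^esub> b"] by (simp add: N.M.minus_eq N.M.minus_add N.M.a_assoc)

text \<open>The generating relations express that \<open>s \<odot> D x\<close> is additive in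
  \<open>x\<close> and in \<open>s\<close> and that \<open>D\<close> is semilinear along \<phi>.
  This is what makes \<open>lift\<close> independent of the representative.\<close>

lemma lift_free_rel: "f \<in> tensor_rel R S \<phi> M \<Longrightarrow> lift_free f = \<zero>\<^bsub>N\<^esub>"
proof (induction rule: tensor_rel.induct)
  case (diff f g)
  then show ?case using rel_tensors by (simp add: lift_free_diff N.M.minus_eq)
next
  case (add_left x y s)
  then show ?case
    using D_closed add_closed tensors_closed(2,5)
    by (simp add: lift_free_diff lift_free_of D_add N.smult_r_distr add_diff_diff_zero)
next
  case (add_right x s t)
  then show ?case
    using D_closed tensors_closed(2,5)
    by (simp add: lift_free_diff lift_free_of N.smult_l_distr add_diff_diff_zero)
next
  case (balanced r x s)
  then have "s \<odot>\<^bsub>N\<^esub> (\<phi> r \<odot>\<^bsub>N\<^esub> D x) = (\<phi> r \<otimes>\<^bsub>S\<^esub> s) \<odot>\<^bsub>N\<^esub> D x"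
    using D_closed phi_closed by (simp add: N.smult_assoc1[symmetric] S.m_comm)
  with balanced show ?case
    using D_closed smult_closed phi_closed tensors_closed(5)
    by (simp add: lift_free_diff lift_free_of D_smult N.M.minus_eq N.M.r_neg)
qed (rule lift_free_zero)

lemma lift_free_tmult:
  assumes "t \<in> carrier S" "f \<in> tensors"
  shows "lift_free (tmult t f) = t \<odot>\<^bsub>N\<^esub> lift_free f"
proof -
  \<comment> \<open>Membership is carried through the induction because the rule
    \<open>tensors_induct\<close> does not provide it for the two parts of a difference.\<close>
  have "f \<in> tensors \<and> lift_free (tmult t f) = t \<odot>\<^bsub>N\<^esub> lift_free f"
    using assms(2)
  proof (induction rule: tensors_induct)
    case zero
    then show ?case using assms tensors_closed(1) by (simp add: lift_free_zero)
  next
    case (one x s)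
    then show ?case
      using assms D_closed tensors_closed(5) by (simp add: lift_free_of N.smult_assoc1)
  next
    case (diff f g)
    then have c: "f \<in> tensors" "g \<in> tensors" "tmult t f \<in> tensors" "tmult t g \<in> tensors"
      "lift_free f \<in> carrier N" "lift_free g \<in> carrier N"
      using tmult_tensors[OF assms(1)] lift_free_closed by blast+
    have "lift_free (tmult t (f - g)) = t \<odot>\<^bsub>N\<^esub> lift_free f \<ominus>\<^bsub>N\<^esub> t \<odot>\<^bsub>N\<^esub> lift_free g"
      using c diff by (simp add: frag_extend_diff lift_free_diff)
    also have "\<dots> = t \<odot>\<^bsub>N\<^esub> lift_free (f - g)"
      using c assms by (simp add: lift_free_diff N.M.minus_eq N.smult_r_distr N.smult_r_minus)
    finally show ?case using tensors_closed(2)[OF c(1,2)] by blast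
  qed
  then show ?thesis by blast
qed

definition lift :: "('a \<times> 's \<Rightarrow>\<^sub>0 int) set \<Rightarrow> 'b" where
  "lift C = the_elem (lift_free ` C)"

lemma lift_cls:
  assumes "f \<in> tensors"
  shows "lift (cls f) = lift_free f"
proof -
  have "lift_free g = lift_free f" if g: "g \<in> cls f" for g
  proof -
    have "g \<in> tensors" "g - f \<in> tensor_rel R S \<phi> M" using cls_eq_mem[OF assms g] by auto
    then have "lift_free g = lift_free (g - f) \<oplus>\<^bsub>N\<^esub> lift_free f"
      using lift_free_add[OF tensors_closed(2)[OF _ assms] assms, of g] by simp
    then show ?thesis
      using lift_free_rel[OF \<open>g - f \<in> _\<close>] lift_free_closed[OF assms] by simp
  qed
  then have "lift_free ` cls f = {lift_free f}" using cls_mem[OF assms] by blast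
  then show ?thesis unfolding lift_def by simp
qed

lemma lift_hom: "lift \<in> mod_hom S (base_change R S \<phi> M) N"
  unfolding mod_hom_def
  using tensors_closed(3) tmult_tensors lift_free_closed
  by (auto simp: base_change_carrier lift_cls base_change_add base_change_smult lift_free_add
      lift_free_tmult)

end

section \<open>Integral extensions inside the field of fractions\<close>

context domain
begin

lemma nonzerodivisors_eq: "nonzerodivisors R = carrier R - {\<zero>}"
  unfolding nonzerodivisors_def using integral one_closed by fastforce

text \<open>Cross multiplication is transitive because denominators can be cancelled: a relation
  with a third pair is multiplied by \<open>d\<close>, rewritten by \<open>a d = c b\<close>, and
  then divided by \<open>b\<close>.\<close>

lemma fraction_eq_iff:
  assumes "a \<in> carrier R" "b \<in> carrier R - {\<zero>}" "c \<in> carrier R" "d \<in> carrier R - {\<zero>}"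
  shows "fraction R a b = fraction R c d \<longleftrightarrow> a \<otimes> d = c \<otimes> b"
proof
  assume "fraction R a b = fraction R c d"
  moreover have "(c, d) \<in> fraction R c d"
    using assms by (simp add: fraction_def nonzerodivisors_eq)
  ultimately show "a \<otimes> d = c \<otimes> b"
    unfolding fraction_def by blast
next
  assume eq: "a \<otimes> d = c \<otimes> b"
  have "a \<otimes> f = e \<otimes> b \<longleftrightarrow> c \<otimes> f = e \<otimes> d" if "e \<in> carrier R" "f \<in> carrier R" for e f
  proof -
    have "a \<otimes> f = e \<otimes> b \<longleftrightarrow> (a \<otimes> f) \<otimes> d = (e \<otimes> b) \<otimes> d"
      using assms that m_rcancel[of d "a \<otimes> f" "e \<otimes> b"] by auto
    also have "(a \<otimes> f) \<otimes> d = (c \<otimes> f) \<otimes> b"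
      using assms that eq by (metis DiffE m_assoc m_comm)
    also have "(e \<otimes> b) \<otimes> d = (e \<otimes> d) \<otimes> b"
      using assms that by (simp add: m_ac)
    also have "(c \<otimes> f) \<otimes> b = (e \<otimes> d) \<otimes> b \<longleftrightarrow> c \<otimes> f = e \<otimes> d"
      using assms that m_rcancel[of b "c \<otimes> f" "e \<otimes> d"] by auto
    finally show ?thesis .
  qed
  then show "fraction R a b = fraction R c d"
    unfolding fraction_def nonzerodivisors_eq by auto
qed

lemma fraction_memD:
  assumes "(c, d) \<in> fraction R a b"
  shows "c \<in> carrier R" "d \<in> carrier R" "d \<noteq> \<zero>" "a \<otimes> d = c \<otimes> b"
  using assms unfolding fraction_def nonzerodivisors_eq by auto

lemma fraction_self: "\<lbrakk>a \<in> carrier R; b \<in> carrier R - {\<zero>}\<rbrakk> \<Longrightarrow> (a, b) \<in> fraction R a b"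
  by (simp add: fraction_def nonzerodivisors_eq)

lemma nonzero_mult: "\<lbrakk>a \<in> carrier R - {\<zero>}; b \<in> carrier R - {\<zero>}\<rbrakk> \<Longrightarrow> a \<otimes> b \<in> carrier R - {\<zero>}"
  using integral by blast

lemma fraction_mult:
  assumes "a \<in> carrier R" "b \<in> carrier R - {\<zero>}" "c \<in> carrier R" "d \<in> carrier R - {\<zero>}"
  shows "fraction R a b \<otimes>\<^bsub>total_fractions R\<^esub> fraction R c d = fraction R (a \<otimes> c) (b \<otimes> d)"
proof -
  have "fraction R (a' \<otimes> c') (b' \<otimes> d') = fraction R (a \<otimes> c) (b \<otimes> d)"
    if ab: "(a', b') \<in> fraction R a b" and cd: "(c', d') \<in> fraction R c d" for a' b' c' d'
  proof -
    note 1 = fraction_memD[OF ab] and 2 = fraction_memD[OF cd]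
    have nz: "b' \<otimes> d' \<in> carrier R - {\<zero>}" "b \<otimes> d \<in> carrier R - {\<zero>}"
      using 1 2 assms nonzero_mult[of b' d'] nonzero_mult[of b d] by simp_all
    have "(a' \<otimes> c') \<otimes> (b \<otimes> d) = (a' \<otimes> b) \<otimes> (c' \<otimes> d)"
      using 1(1,2) 2(1,2) assms by (simp add: m_ac)
    also have "\<dots> = (a \<otimes> b') \<otimes> (c \<otimes> d')"
      by (simp only: 1(4) 2(4))
    also have "\<dots> = (a \<otimes> c) \<otimes> (b' \<otimes> d')"
      using 1(1,2) 2(1,2) assms by (simp add: m_ac)
    finally show ?thesis
      using 1 2 assms nz by (subst fraction_eq_iff) auto
  qed
  then have "(\<Union>(a', b') \<in> fraction R a b. \<Union>(c', d') \<in> fraction R c d. fraction R (a' \<otimes> c') (b' \<otimes> d')) =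
      fraction R (a \<otimes> c) (b \<otimes> d)"
    by (intro Union_pair_const[OF fraction_self[OF assms(1,2)]]
        Union_pair_const[OF fraction_self[OF assms(3,4)]])
  then show ?thesis by (simp add: total_fractions_def)
qed

text \<open>Serves to recognize the image of zero under an additive map. The sum of fractions is a
  union over representatives; evaluating it at a single pair gives a subset of it, and that suffices
  to obtain \<open>x + x = x\<close> for \<open>x = a b b\<close>.\<close>

lemma fraction_double:
  assumes "a \<in> carrier R" "b \<in> carrier R - {\<zero>}"
    and eq: "fraction R a b \<oplus>\<^bsub>total_fractions R\<^esub> fraction R a b = fraction R a b"
  shows "a = \<zero>"
proof -
  have bb: "b \<otimes> b \<in> carrier R - {\<zero>}" using nonzero_mult[OF assms(2,2)] .
  have "fraction R ((a \<otimes> b) \<oplus> (a \<otimes> b)) (b \<otimes> b) \<subseteq>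
      fraction R a b \<oplus>\<^bsub>total_fractions R\<^esub> fraction R a b"
    unfolding total_fractions_def using fraction_self[OF assms(1,2)] by auto
  then have "((a \<otimes> b) \<oplus> (a \<otimes> b), b \<otimes> b) \<in> fraction R a b"
    using fraction_self[OF _ bb, of "(a \<otimes> b) \<oplus> (a \<otimes> b)"] assms eq by auto
  then have "a \<otimes> (b \<otimes> b) = ((a \<otimes> b) \<oplus> (a \<otimes> b)) \<otimes> b"
    by (rule fraction_memD(4))
  then have "a \<otimes> (b \<otimes> b) \<oplus> a \<otimes> (b \<otimes> b) = a \<otimes> (b \<otimes> b)"
    using assms by (simp add: l_distr m_assoc)
  then have "a \<otimes> (b \<otimes> b) = \<zero>"
    using assms by simp
  then show ?thesis
    using integral_iff[of a "b \<otimes> b"] bb assms by auto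
qed

end

section \<open>Rings isomorphic to the integral closure of a domain\<close>

context
  fixes R :: "('r, 'm) ring_scheme" and D :: "('d, 'n) ring_scheme" and \<theta> \<delta>
  assumes R: "domain R" and D: "ring D"
    and \<theta>: "\<theta> \<in> ring_iso D ((total_fractions R)\<lparr>carrier := integral_closure R\<rparr>)"
    and \<delta>: "\<And>a. a \<in> carrier R \<Longrightarrow> \<delta> a \<in> carrier D"
    and \<theta>\<delta>: "\<And>a. a \<in> carrier R \<Longrightarrow> \<theta> (\<delta> a) = to_fraction R a"
begin

interpretation R: domain R by (fact R)
interpretation D: ring D by (fact D)

lemma theta_mult: "\<lbrakk>x \<in> carrier D; y \<in> carrier D\<rbrakk> \<Longrightarrow>
    \<theta> (x \<otimes>\<^bsub>D\<^esub> y) = \<theta> x \<otimes>\<^bsub>total_fractions R\<^esub> \<theta> y"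
  using ring_iso_memE(2)[OF \<theta>] by simp

lemma theta_fraction:
  assumes "x \<in> carrier D"
  obtains a b where "a \<in> carrier R" "b \<in> carrier R - {\<zero>\<^bsub>R\<^esub>}" "\<theta> x = fraction R a b"
proof -
  have "\<theta> x \<in> carrier (total_fractions R)"
    using ring_iso_memE(1)[OF \<theta> assms] by (simp add: integral_closure_def Let_def)
  then show ?thesis
    using that by (auto simp: total_fractions_def R.nonzerodivisors_eq)
qed

lemma theta_inj: "\<lbrakk>x \<in> carrier D; y \<in> carrier D; \<theta> x = \<theta> y\<rbrakk> \<Longrightarrow> x = y"
  using ring_iso_memE(5)[OF \<theta>] unfolding bij_betw_def inj_on_def by blast

text \<open>The target of \<theta> has not been shown to be a ring, so the value at zero has to be
  found: it is unchanged by doubling, hence has numerator zero by \<open>fraction_double\<close>.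
  Injectivity of \<theta> does the rest.\<close>

lemma theta_eq_zero_iff:
  assumes "x \<in> carrier D" "a \<in> carrier R" "b \<in> carrier R - {\<zero>\<^bsub>R\<^esub>}" "\<theta> x = fraction R a b"
  shows "x = \<zero>\<^bsub>D\<^esub> \<longleftrightarrow> a = \<zero>\<^bsub>R\<^esub>"
proof -
  obtain p q where pq: "p \<in> carrier R" "q \<in> carrier R - {\<zero>\<^bsub>R\<^esub>}" "\<theta> \<zero>\<^bsub>D\<^esub> = fraction R p q"
    by (rule theta_fraction[OF D.zero_closed])
  have "\<theta> \<zero>\<^bsub>D\<^esub> \<oplus>\<^bsub>total_fractions R\<^esub> \<theta> \<zero>\<^bsub>D\<^esub> = \<theta> \<zero>\<^bsub>D\<^esub>"
    using ring_iso_memE(3)[OF \<theta> D.zero_closed D.zero_closed] by simp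
  then have "p = \<zero>\<^bsub>R\<^esub>"
    using R.fraction_double[OF pq(1,2)] pq(3) by simp
  then have "\<theta> x = \<theta> \<zero>\<^bsub>D\<^esub> \<longleftrightarrow> a = \<zero>\<^bsub>R\<^esub>"
    unfolding assms(4) pq(3) using assms(2,3) pq(1,2)
    by (subst R.fraction_eq_iff) (auto simp: R.integral_iff)
  then show ?thesis
    using theta_inj[OF assms(1) D.zero_closed] by auto
qed

text \<open>Under \<theta> both elements become fractions, the product has the product of the
  numerators as its numerator, and vanishing can be read off numerators.\<close>

lemma integral_extension_integral:
  assumes "x \<in> carrier D" "y \<in> carrier D" "x \<otimes>\<^bsub>D\<^esub> y = \<zero>\<^bsub>D\<^esub>"
  shows "x = \<zero>\<^bsub>D\<^esub> \<or> y = \<zero>\<^bsub>D\<^esub>"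
proof -
  obtain a b where ab: "a \<in> carrier R" "b \<in> carrier R - {\<zero>\<^bsub>R\<^esub>}" "\<theta> x = fraction R a b"
    by (rule theta_fraction[OF assms(1)])
  obtain c d where cd: "c \<in> carrier R" "d \<in> carrier R - {\<zero>\<^bsub>R\<^esub>}" "\<theta> y = fraction R c d"
    by (rule theta_fraction[OF assms(2)])
  have "\<theta> (x \<otimes>\<^bsub>D\<^esub> y) = fraction R (a \<otimes>\<^bsub>R\<^esub> c) (b \<otimes>\<^bsub>R\<^esub> d)"
    unfolding theta_mult[OF assms(1,2)] ab(3) cd(3) by (rule R.fraction_mult[OF ab(1,2) cd(1,2)])
  then have "a \<otimes>\<^bsub>R\<^esub> c = \<zero>\<^bsub>R\<^esub>"
    using theta_eq_zero_iff[of "x \<otimes>\<^bsub>D\<^esub> y" "a \<otimes>\<^bsub>R\<^esub> c" "b \<otimes>\<^bsub>R\<^esub> d"] ab cd assms R.nonzero_mult[of b d]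
    by auto
  then show ?thesis
    using theta_eq_zero_iff[OF assms(1) ab] theta_eq_zero_iff[OF assms(2) cd] R.integral[of a c] ab cd
    by auto
qed

lemma integral_extension_inj:
  assumes "a \<in> carrier R" "\<delta> a = \<zero>\<^bsub>D\<^esub>"
  shows "a = \<zero>\<^bsub>R\<^esub>"
  using theta_eq_zero_iff[OF \<delta>[OF assms(1)] assms(1), of "\<one>\<^bsub>R\<^esub>"] assms \<theta>\<delta>[OF assms(1)] R.one_not_zero
  by (simp add: to_fraction_def)

text \<open>The witnesses are numerator and denominator of \<open>\<theta> x\<close>. Both sides of
  the claimed equation are mapped to the fraction \<open>a / 1\<close>, and \<theta> is
  injective.\<close>

lemma integral_extension_denominator:
  assumes "x \<in> carrier D"
  shows "\<exists>a \<in> carrier R. \<exists>b \<in> carrier R - {\<zero>\<^bsub>R\<^esub>}. \<delta> b \<otimes>\<^bsub>D\<^esub> x = \<delta> a"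
proof -
  obtain a b where ab: "a \<in> carrier R" "b \<in> carrier R - {\<zero>\<^bsub>R\<^esub>}" "\<theta> x = fraction R a b"
    by (rule theta_fraction[OF assms(1)])
  have 1: "\<one>\<^bsub>R\<^esub> \<in> carrier R - {\<zero>\<^bsub>R\<^esub>}" using R.one_not_zero by simp
  have "\<theta> (\<delta> b \<otimes>\<^bsub>D\<^esub> x) = fraction R (b \<otimes>\<^bsub>R\<^esub> a) (\<one>\<^bsub>R\<^esub> \<otimes>\<^bsub>R\<^esub> b)"
    using ab 1 assms R.fraction_mult[of b "\<one>\<^bsub>R\<^esub>" a b] by (simp add: theta_mult \<delta> \<theta>\<delta> to_fraction_def)
  also have "\<dots> = \<theta> (\<delta> a)"
    using ab 1 by (simp add: \<theta>\<delta> to_fraction_def R.fraction_eq_iff R.m_comm)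
  finally have "\<delta> b \<otimes>\<^bsub>D\<^esub> x = \<delta> a"
    using theta_inj ab assms by (simp add: \<delta>)
  then show ?thesis using ab by blast
qed

end

section \<open>Holomorphic functions on complex spaces\<close>

lemma holomorphic_Cspace_subset:
  assumes "holomorphic_Cspace n W f" "openin (Cspace n) W'" "W' \<subseteq> W"
  shows "holomorphic_Cspace n W' f"
  using assms unfolding holomorphic_Cspace_def
  by (auto intro: continuous_map_from_subtopology_mono)

lemma holomorphic_Cspace_mult:
  assumes "holomorphic_Cspace n W f" "holomorphic_Cspace n W g"
  shows "holomorphic_Cspace n W (\<lambda>w. f w * g w)"
proof -
  have "continuous_map (subtopology (Cspace n) W) euclidean (\<lambda>w. f w * g w)"
    using assms unfolding holomorphic_Cspace_def by (simp add: continuous_map_atin tendsto_mult)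
  then show ?thesis
    using assms unfolding holomorphic_Cspace_def by (auto intro: field_differentiable_mult)
qed

lemma holomorphic_model_mult:
  assumes "holomorphic_model n B f" "holomorphic_model n B g"
  shows "holomorphic_model n B (\<lambda>w. f w * g w)"
  unfolding holomorphic_model_def
proof
  fix b assume b: "b \<in> B"
  obtain N h where N: "b \<in> N" "holomorphic_Cspace n N h" "\<forall>w \<in> N \<inter> B. h w = f w"
    using assms(1) b unfolding holomorphic_model_def by blast
  obtain N' h' where N': "b \<in> N'" "holomorphic_Cspace n N' h'" "\<forall>w \<in> N' \<inter> B. h' w = g w"
    using assms(2) b unfolding holomorphic_model_def by blast
  have "openin (Cspace n) (N \<inter> N')"
    using N N' unfolding holomorphic_Cspace_def by auto
  then have "holomorphic_Cspace n (N \<inter> N') (\<lambda>w. h w * h' w)"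
    using N N' by (intro holomorphic_Cspace_mult) (auto intro: holomorphic_Cspace_subset)
  then show "\<exists>N h. b \<in> N \<and> holomorphic_Cspace n N h \<and> (\<forall>w \<in> N \<inter> B. h w = f w * g w)"
    using N N' by (intro exI[of _ "N \<inter> N'"] exI[of _ "\<lambda>w. h w * h' w"]) auto
qed

lemma holomorphic_model_cong:
  "\<lbrakk>holomorphic_model n B f; \<And>w. w \<in> B \<Longrightarrow> f w = g w\<rbrakk> \<Longrightarrow> holomorphic_model n B g"
  unfolding holomorphic_model_def by fastforce

text \<open>Products do not occur in the axioms of \<open>complex_space\<close>. In a chart,
  holomorphic functions are local restrictions of ambient ones, whose products are again
  holomorphic; the result is glued by \<open>hol_local\<close>.\<close>

lemma hol_mult:
  assumes X: "complex_space X" and U: "openin (tsp X) U" and f: "f \<in> hol X U" and g: "g \<in> hol X U"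
  shows "(\<lambda>x\<in>U. f x * g x) \<in> hol X U"
proof (rule hol_local[OF X U])
  fix x assume x: "x \<in> U"
  then have "x \<in> pts X" using U openin_subset by blast
  note bspec[OF X[unfolded complex_space_def, THEN conjunct2, THEN conjunct2, THEN conjunct2] this]
  then obtain U0 n W A \<phi> \<phi>' where chart: "openin (tsp X) U0 \<and> x \<in> U0 \<and> analytic_set n W A \<and>
      homeomorphic_maps (subtopology (tsp X) U0) (subtopology (Cspace n) A) \<phi> \<phi>' \<and>
      (\<forall>V. openin (tsp X) V \<and> V \<subseteq> U0 \<longrightarrow>
        hol X V = {f \<in> extensional V. holomorphic_model n (\<phi> ` V) (f \<circ> \<phi>')})"
    by (elim exE) (rule that)
  have c: "openin (tsp X) U0" "x \<in> U0"
    "homeomorphic_maps (subtopology (tsp X) U0) (subtopology (Cspace n) A) \<phi> \<phi>'"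
    using chart by simp_all
  have c4: "hol X V = {f \<in> extensional V. holomorphic_model n (\<phi> ` V) (f \<circ> \<phi>')}"
    if "openin (tsp X) V" "V \<subseteq> U0" for V
    using chart that by simp
  define V where "V = U \<inter> U0"
  have V: "openin (tsp X) V" "V \<subseteq> U" "V \<subseteq> U0" "x \<in> V" using U c x unfolding V_def by auto
  \<comment> \<open>This identity shows that, on the image of \<open>V\<close>, the transported
    product is the product of the transported factors.\<close>
  have inv: "\<phi>' (\<phi> v) = v" if "v \<in> V" for v
  proof -
    have "v \<in> topspace (subtopology (tsp X) U0)"
      using that V openin_subset[OF c(1)] by auto
    then show ?thesis using c(3) unfolding homeomorphic_maps_def by blast
  qed
  have "restrict f V \<in> hol X V" "restrict g V \<in> hol X V"
    using hol_restrict[OF X U V(1,2)] f g by auto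
  then have "holomorphic_model n (\<phi> ` V) (restrict f V \<circ> \<phi>')"
    "holomorphic_model n (\<phi> ` V) (restrict g V \<circ> \<phi>')"
    using c4[OF V(1,3)] by auto
  then have "holomorphic_model n (\<phi> ` V) (\<lambda>w. (restrict f V \<circ> \<phi>') w * (restrict g V \<circ> \<phi>') w)"
    by (rule holomorphic_model_mult)
  then have "holomorphic_model n (\<phi> ` V) (restrict (\<lambda>x\<in>U. f x * g x) V \<circ> \<phi>')"
    by (rule holomorphic_model_cong) (use inv V(2) in auto)
  then have "restrict (\<lambda>x\<in>U. f x * g x) V \<in> hol X V"
    unfolding c4[OF V(1,3)] by (simp only: mem_Collect_eq restrict_extensional)
  with V show "\<exists>V. openin (tsp X) V \<and> x \<in> V \<and> V \<subseteq> U \<and> restrict (\<lambda>x\<in>U. f x * g x) V \<in> hol X V"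
    by blast
qed simp

lemma multiplicative_structure_sheaf:
  assumes "complex_space X"
  shows "multiplicative_presheaf (tsp X) (structure_sheaf X)"
  by (intro multiplicative_presheaf.intro presheaf_on_structure_sheaf[OF assms]
      multiplicative_presheaf_axioms.intro)
    (simp add: hol_mult[OF assms], auto simp: fun_eq_iff restrict_def)

section \<open>Normalizations of locally irreducible spaces\<close>

text \<open>The hypothesis \<open>ring_Y\<close> is discharged in the final theorem by the analytic
  sheaf on \<open>Y\<close>, whose module structure contains the ring structure of the
  sections.\<close>

locale irreducible_normalization =
  fixes X :: "'p fspace" and Y :: "'q fspace" and \<psi> :: "'q \<Rightarrow> 'p"
  assumes X: "complex_space X" and irreducible: "locally_irreducible X"
    and normalization: "normalization Y X \<psi>"
    and ring_Y: "ring_presheaf (tsp Y) (structure_sheaf Y)"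
begin

sublocale OY: ring_presheaf "tsp Y" "structure_sheaf Y" by (fact ring_Y)
sublocale OX: multiplicative_presheaf "tsp X" "structure_sheaf X"
  using X by (rule multiplicative_structure_sheaf)

abbreviation "pre \<equiv> preim Y \<psi>"

abbreviation "DS \<equiv> direct_structure Y \<psi>"

lemma Y: "complex_space Y" and holomorphic_map: "holomorphic_map Y X \<psi>"
  and finite_map: "finite_map Y X \<psi>"
  using normalization unfolding normalization_def by auto

lemma domain_X: "x \<in> pts X \<Longrightarrow> domain (local_ring X x)"
  using irreducible unfolding locally_irreducible_def by blast

lemma psi_pts: "y \<in> pts Y \<Longrightarrow> \<psi> y \<in> pts X"
  using holomorphic_map unfolding holomorphic_map_def continuous_map_def by auto

lemma preim_open: "openin (tsp X) U \<Longrightarrow> openin (tsp Y) (pre U)"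
  using holomorphic_map unfolding holomorphic_map_def continuous_map_def preim_def by auto

lemma preim_mono: "V \<subseteq> U \<Longrightarrow> pre V \<subseteq> pre U"
  unfolding preim_def by auto

lemma preim_iff: "y \<in> pre U \<longleftrightarrow> y \<in> pts Y \<and> \<psi> y \<in> U"
  unfolding preim_def by auto

lemma pull_closed: "\<lbrakk>openin (tsp X) U; f \<in> hol X U\<rbrakk> \<Longrightarrow> pull Y \<psi> U f \<in> hol Y (pre U)"
  using holomorphic_map unfolding holomorphic_map_def by blast

lemma pull_restrict: "V \<subseteq> U \<Longrightarrow> restrict (pull Y \<psi> U f) (pre V) = pull Y \<psi> V (restrict f V)"
  unfolding pull_def preim_def by (auto simp: fun_eq_iff restrict_def)

lemma direct_structure_simps:
  "sect (DS) U = sect (structure_sheaf Y) (pre U)"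
  "res (DS) U V f = restrict f (pre V)"
  by (simp_all add: direct_structure_def)

sublocale D: ring_presheaf "tsp X" "DS"
proof -
  have ds: "sect (DS) U = sect (structure_sheaf Y) (pre U)"
    "res (DS) U V = res (structure_sheaf Y) (pre U) (pre V)" for U V
    by (simp_all add: direct_structure_def)
  show "ring_presheaf (tsp X) (DS)"
    by (intro ring_presheaf.intro additive_presheaf.intro multiplicative_presheaf.intro
        presheaf_on.intro additive_presheaf_axioms.intro multiplicative_presheaf_axioms.intro
        ring_presheaf_axioms.intro; unfold ds;
        rule OY.res_closed OY.res_res OY.abelian_sect OY.res_add OY.mult_sect_closed OY.res_mult
          OY.cring_sect OY.res_one; (assumption | (rule preim_open preim_mono; assumption)))
qed

section \<open>Comorphisms and the stalks of the direct image of the structure sheaf\<close>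

lemma comorphism_germ:
  assumes "openin (tsp X) U" "\<psi> y \<in> U" "y \<in> pts Y" "f \<in> hol X U"
  shows "comorphism Y \<psi> y (germ_fun X (\<psi> y) U f) = germ_fun Y y (pre U) (pull Y \<psi> U f)"
  unfolding comorphism_def using assms preim_open preim_mono pull_closed pull_restrict
    OX.presheaf_on_axioms OY.presheaf_on_axioms
  by (intro germ_map[where p = "pre" and k = "pull Y \<psi>"]) (auto simp: preim_iff)

lemma direct_comorphism_germ:
  assumes "openin (tsp X) U" "x \<in> U" "f \<in> hol X U"
  shows "direct_comorphism Y X \<psi> x (germ_fun X x U f) =
    germ (tsp X) (DS) x U (pull Y \<psi> U f)"
  unfolding direct_comorphism_def using assms pull_closed pull_restrict
    OX.presheaf_on_axioms D.presheaf_on_axioms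
  by (intro germ_map[where p = "\<lambda>U. U" and k = "pull Y \<psi>"]) (auto simp: direct_structure_simps)

lemma comorphism_closed:
  assumes "y \<in> pts Y" "a \<in> carrier (local_ring X (\<psi> y))"
  shows "comorphism Y \<psi> y a \<in> carrier (local_ring Y y)"
proof -
  obtain U f where U: "openin (tsp X) U" "\<psi> y \<in> U" "f \<in> hol X U" "a = germ_fun X (\<psi> y) U f"
    using assms(2) by (rule OX.stalk_cases) simp
  have "germ_fun Y y (pre U) (pull Y \<psi> U f) \<in> carrier (local_ring Y y)"
    using U assms(1) preim_open[OF U(1)] pull_closed[OF U(1,3)]
    by (intro OY.germ_closed) (simp_all add: preim_iff)
  then show ?thesis
    using U assms(1) by (simp add: comorphism_germ)
qed

abbreviation direct_ring :: "'p \<Rightarrow> ('p set \<times> ('q \<Rightarrow> complex)) set ring" where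
  "direct_ring x \<equiv> stalk (tsp X) (DS) x"

lemma direct_comorphism_closed:
  assumes "a \<in> carrier (local_ring X x)"
  shows "direct_comorphism Y X \<psi> x a \<in> carrier (direct_ring x)"
proof -
  obtain U f where U: "openin (tsp X) U" "x \<in> U" "f \<in> hol X U" "a = germ_fun X x U f"
    using assms by (rule OX.stalk_cases) simp
  then show ?thesis
    using D.germ_closed[OF U(1,2), of "pull Y \<psi> U f"] pull_closed[OF U(1,3)]
    by (simp add: direct_comorphism_germ direct_structure_simps)
qed

text \<open>The isomorphism \<theta> in \<open>normalization\<close> enters the rest of the argument
  through these three consequences: absence of zero divisors, injectivity of the comorphism and
  existence of denominators.\<close>

lemma
  assumes x: "x \<in> pts X"
  shows direct_ring_integral: "\<lbrakk>a \<in> carrier (direct_ring x); b \<in> carrier (direct_ring x);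
      a \<otimes>\<^bsub>direct_ring x\<^esub> b = \<zero>\<^bsub>direct_ring x\<^esub>\<rbrakk> \<Longrightarrow> a = \<zero>\<^bsub>direct_ring x\<^esub> \<or> b = \<zero>\<^bsub>direct_ring x\<^esub>"
    and direct_comorphism_inj: "\<lbrakk>c \<in> carrier (local_ring X x);
      direct_comorphism Y X \<psi> x c = \<zero>\<^bsub>direct_ring x\<^esub>\<rbrakk> \<Longrightarrow> c = \<zero>\<^bsub>local_ring X x\<^esub>"
    and direct_ring_denominator: "a \<in> carrier (direct_ring x) \<Longrightarrow>
      \<exists>c \<in> carrier (local_ring X x). \<exists>d \<in> carrier (local_ring X x) - {\<zero>\<^bsub>local_ring X x\<^esub>}.
        direct_comorphism Y X \<psi> x d \<otimes>\<^bsub>direct_ring x\<^esub> a = direct_comorphism Y X \<psi> x c"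
proof -
  obtain \<theta> where \<theta>: "\<theta> \<in> ring_iso (direct_ring x)
      ((total_fractions (local_ring X x))\<lparr>carrier := integral_closure (local_ring X x)\<rparr>)"
    "\<And>a. a \<in> carrier (local_ring X x) \<Longrightarrow>
      \<theta> (direct_comorphism Y X \<psi> x a) = to_fraction (local_ring X x) a"
    using normalization x unfolding normalization_def by blast
  note props = domain_X[OF x] cring.axioms(1)[OF D.stalk_cring[OF x]] \<theta>(1) direct_comorphism_closed \<theta>(2)
  show "\<lbrakk>a \<in> carrier (direct_ring x); b \<in> carrier (direct_ring x);
      a \<otimes>\<^bsub>direct_ring x\<^esub> b = \<zero>\<^bsub>direct_ring x\<^esub>\<rbrakk> \<Longrightarrow> a = \<zero>\<^bsub>direct_ring x\<^esub> \<or> b = \<zero>\<^bsub>direct_ring x\<^esub>"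
    by (rule integral_extension_integral[OF props])
  show "\<lbrakk>c \<in> carrier (local_ring X x); direct_comorphism Y X \<psi> x c = \<zero>\<^bsub>direct_ring x\<^esub>\<rbrakk> \<Longrightarrow>
      c = \<zero>\<^bsub>local_ring X x\<^esub>"
    by (rule integral_extension_inj[OF props])
  show "a \<in> carrier (direct_ring x) \<Longrightarrow>
      \<exists>c \<in> carrier (local_ring X x). \<exists>d \<in> carrier (local_ring X x) - {\<zero>\<^bsub>local_ring X x\<^esub>}.
        direct_comorphism Y X \<psi> x d \<otimes>\<^bsub>direct_ring x\<^esub> a = direct_comorphism Y X \<psi> x c"
    by (rule integral_extension_denominator[OF props])
qed

text \<open>The usual property of closed maps: \<open>U\<close> is the complement of the closed
  image of \<open>pts Y - W\<close>, and it contains \<open>x\<close> because the fibre avoids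
  \<open>pts Y - W\<close>.\<close>

lemma fibre_neighbourhood:
  assumes "openin (tsp Y) W" and fibre: "pre {x} \<subseteq> W" and x: "x \<in> pts X"
  obtains U where "openin (tsp X) U" "x \<in> U" "pre U \<subseteq> W"
proof -
  have "closedin (tsp X) (\<psi> ` (pts Y - W))"
    using finite_map assms(1) unfolding finite_map_def closed_map_def by auto
  then have "openin (tsp X) (pts X - \<psi> ` (pts Y - W))"
    by auto
  moreover have "x \<in> pts X - \<psi> ` (pts Y - W)"
    using fibre x unfolding preim_def by auto
  moreover have "pre (pts X - \<psi> ` (pts Y - W)) \<subseteq> W"
    unfolding preim_def by auto
  ultimately show ?thesis by (rule that)
qed

lemma constant_hol:
  assumes "openin (tsp Y) W"
  shows "(\<lambda>z\<in>W. 0) \<in> hol Y W" "(\<lambda>z\<in>W. 1) \<in> hol Y W"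
  using OY.zero_sect_closed[OF assms] OY.one_sect_closed[OF assms] by simp_all

text \<open>If two points lay over \<open>x\<close>, the indicator functions of disjoint neighbourhoods of the two
  parts of the fibre would be zero divisors in the domain \<open>(\<psi>\<^sub>*\<O>\<^sub>Y)\<^sub>x\<close>.\<close>

lemma psi_inj:
  assumes "y1 \<in> pts Y" "y2 \<in> pts Y" "\<psi> y1 = \<psi> y2"
  shows "y1 = y2"
proof (rule ccontr)
  assume ne: "y1 \<noteq> y2"
  define x where "x = \<psi> y1"
  have x: "x \<in> pts X" using assms psi_pts by (simp add: x_def)
  have fin: "finite (pre {x})" using finite_map x unfolding finite_map_def by blast
  \<comment> \<open>The fibre is finite, so both of its parts are compact and can be separated in
    the Hausdorff space \<open>Y\<close>.\<close>
  obtain A B where AB: "openin (tsp Y) A" "openin (tsp Y) B" "{y1} \<subseteq> A" "pre {x} - {y1} \<subseteq> B"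
    "disjnt A B"
    by (rule Hausdorff_space_compact_separation[OF complex_space_Hausdorff[OF Y],
          of "{y1}" "pre {x} - {y1}"])
      (use fin assms(1) in \<open>auto intro!: finite_imp_compactin simp: preim_def\<close>)
  obtain U where U: "openin (tsp X) U" "x \<in> U" "pre U \<subseteq> A \<union> B"
    using fibre_neighbourhood[of "A \<union> B" x] AB x by blast
  let ?P = "pre U"
  have P: "openin (tsp Y) ?P" using U(1) by (rule preim_open)
  have y: "y1 \<in> A" "y2 \<in> B" "y2 \<notin> A" "A \<inter> B = {}"
    using AB assms ne by (auto simp: preim_def x_def disjnt_def)
  define e where "e C = (\<lambda>z\<in>?P. if z \<in> C then 1 else 0 :: complex)" for C
  \<comment> \<open>On the two open pieces \<open>?P \<inter> C\<close> and
    \<open>?P \<inter> C'\<close>, which cover \<open>?P\<close>, the indicator is the constant 1 or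
    0. Holomorphy therefore follows by gluing.\<close>
  have e: "e C \<in> hol Y ?P" if "openin (tsp Y) C" "openin (tsp Y) C'" "C \<inter> C' = {}" "?P \<subseteq> C \<union> C'" for C C'
  proof (rule hol_local[OF Y P])
    fix z assume z: "z \<in> ?P"
    have "openin (tsp Y) (?P \<inter> C)" "openin (tsp Y) (?P \<inter> C')" using P that by auto
    moreover have "restrict (e C) (?P \<inter> C) = (\<lambda>z\<in>?P \<inter> C. 1)" "restrict (e C) (?P \<inter> C') = (\<lambda>z\<in>?P \<inter> C'. 0)"
      using that by (auto simp: e_def fun_eq_iff restrict_def)
    ultimately have "restrict (e C) (?P \<inter> C) \<in> hol Y (?P \<inter> C)" "restrict (e C) (?P \<inter> C') \<in> hol Y (?P \<inter> C')"
      using constant_hol by metis+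
    with z that(4) \<open>openin (tsp Y) (?P \<inter> C)\<close> \<open>openin (tsp Y) (?P \<inter> C')\<close>
    show "\<exists>V. openin (tsp Y) V \<and> z \<in> V \<and> V \<subseteq> ?P \<and> restrict (e C) V \<in> hol Y V"
      by (metis Int_iff Un_iff inf_le1 subsetD)
  qed (simp add: e_def)
  have eA: "e A \<in> carrier (sect (DS) U)" and eB: "e B \<in> carrier (sect (DS) U)"
    using e[of A B] e[of B A] AB U y by (auto simp: direct_structure_simps)
  have "e A \<otimes>\<^bsub>sect (DS) U\<^esub> e B = \<zero>\<^bsub>sect (DS) U\<^esub>"
    using y(4) by (auto simp: direct_structure_simps e_def fun_eq_iff restrict_def)
  then have "germ (tsp X) (DS) x U (e A) \<otimes>\<^bsub>direct_ring x\<^esub>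
      germ (tsp X) (DS) x U (e B) = \<zero>\<^bsub>direct_ring x\<^esub>"
    using D.germ_mult[OF U(1,2) eA eB] D.germ_zero[OF U(1,2)] by simp
  then consider "germ (tsp X) (DS) x U (e A) = \<zero>\<^bsub>direct_ring x\<^esub>"
    | "germ (tsp X) (DS) x U (e B) = \<zero>\<^bsub>direct_ring x\<^esub>"
    using direct_ring_integral[OF x D.germ_closed[OF U(1,2) eA] D.germ_closed[OF U(1,2) eB]] by blast
  \<comment> \<open>Every neighbourhood of \<open>x\<close> has both points in its preimage. As
    \<open>e A\<close> is 1 at \<open>y1\<close> and \<open>e B\<close> is 1 at \<open>y2\<close>,
    neither germ can vanish.\<close>
  then show False
  proof cases
    case 1
    then obtain W where W: "openin (tsp X) W" "x \<in> W" "W \<subseteq> U"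
      "res (DS) U W (e A) = \<zero>\<^bsub>sect (DS) W\<^esub>"
      using U(1,2) eA by (rule D.germ_eq_zeroD)
    have "y1 \<in> pre W" "y1 \<in> ?P" using assms W by (auto simp: preim_def x_def)
    then show False
      using W(4) y(1) by (auto simp: direct_structure_simps e_def dest: fun_cong[of _ _ y1])
  next
    case 2
    then obtain W where W: "openin (tsp X) W" "x \<in> W" "W \<subseteq> U"
      "res (DS) U W (e B) = \<zero>\<^bsub>sect (DS) W\<^esub>"
      using U(1,2) eB by (rule D.germ_eq_zeroD)
    have "y2 \<in> pre W" "y2 \<in> ?P" using assms W by (auto simp: preim_def x_def)
    then show False
      using W(4) y(2) by (auto simp: direct_structure_simps e_def dest: fun_cong[of _ _ y2])
  qed
qed

lemma preim_neighbourhood: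
  assumes "openin (tsp Y) W" "y \<in> W"
  obtains U where "openin (tsp X) U" "\<psi> y \<in> U" "pre U \<subseteq> W"
proof -
  have y: "y \<in> pts Y" using assms openin_subset by blast
  then have "pre {\<psi> y} \<subseteq> W"
    using assms(2) psi_inj unfolding preim_def by blast
  then show ?thesis
    using fibre_neighbourhood[OF assms(1) _ psi_pts[OF y]] that by blast
qed

text \<open>The germ identity supplied by \<open>direct_ring_denominator\<close> holds as an
  identity of functions on a whole set \<open>pre U\<close>. This is what later allows denominators
  to be cleared at all nearby points, although \<open>b\<close> is known to be a nonzero germ at
  \<open>\<psi> y\<close> alone.\<close>

lemma denominator:
  assumes "openin (tsp Y) W" "y \<in> W" "a \<in> hol Y W"
  obtains U b c where "openin (tsp X) U" "\<psi> y \<in> U" "pre U \<subseteq> W" "b \<in> hol X U" "c \<in> hol X U"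
    "germ_fun X (\<psi> y) U b \<noteq> \<zero>\<^bsub>local_ring X (\<psi> y)\<^esub>"
    "\<And>z. z \<in> pre U \<Longrightarrow> b (\<psi> z) * a z = c (\<psi> z)"
proof -
  have y: "y \<in> pts Y" using assms openin_subset by blast
  let ?x = "\<psi> y" and ?D = DS
  have x: "?x \<in> pts X" using y by (rule psi_pts)
  obtain U0 where U0: "openin (tsp X) U0" "?x \<in> U0" "pre U0 \<subseteq> W"
    using assms(1,2) by (rule preim_neighbourhood)
  \<comment> \<open>Sections of \<open>DS\<close> are functions on sets of the form
    \<open>pre U\<close>, so \<open>a\<close> is cut down to such a set before its germ in
    \<open>direct_ring\<close> is formed.\<close>
  define a0 where "a0 = restrict a (pre U0)"
  have a0: "a0 \<in> carrier (sect ?D U0)"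
    using hol_restrict[OF Y assms(1) preim_open[OF U0(1)] U0(3) assms(3)]
    by (simp add: a0_def direct_structure_simps)
  obtain \<gamma> \<beta> where cb: "\<gamma> \<in> carrier (local_ring X ?x)" "\<beta> \<in> carrier (local_ring X ?x)"
    "\<beta> \<noteq> \<zero>\<^bsub>local_ring X ?x\<^esub>"
    "direct_comorphism Y X \<psi> ?x \<beta> \<otimes>\<^bsub>direct_ring ?x\<^esub> germ (tsp X) ?D ?x U0 a0 =
      direct_comorphism Y X \<psi> ?x \<gamma>"
    using direct_ring_denominator[OF x D.germ_closed[OF U0(1,2) a0]] by blast
  obtain U1 b1 c1 where 1: "openin (tsp X) U1" "?x \<in> U1" "b1 \<in> hol X U1" "c1 \<in> hol X U1"
    "\<beta> = germ_fun X ?x U1 b1" "\<gamma> = germ_fun X ?x U1 c1"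
    using cb(2,1) by (rule OX.stalk_cases2) simp
  define U2 where "U2 = U0 \<inter> U1"
  have U2: "openin (tsp X) U2" "?x \<in> U2" "U2 \<subseteq> U0" "U2 \<subseteq> U1" using U0 1 by (auto simp: U2_def)
  define b2 c2 a2 where "b2 = restrict b1 U2" and "c2 = restrict c1 U2" and "a2 = restrict a (pre U2)"
  have h2: "b2 \<in> hol X U2" "c2 \<in> hol X U2"
    using hol_restrict[OF X 1(1) U2(1,4)] 1 by (simp_all add: b2_def c2_def)
  have g2: "\<beta> = germ_fun X ?x U2 b2" "\<gamma> = germ_fun X ?x U2 c2"
    using OX.germ_res[OF 1(1) U2(1,4,2)] 1 by (simp_all add: b2_def c2_def)
  have a2: "a2 = res ?D U0 U2 a0"
    using preim_mono[OF U2(3)] by (simp add: a2_def a0_def direct_structure_simps Int_absorb1)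
  then have a2c: "a2 \<in> carrier (sect ?D U2)" and ga: "germ (tsp X) ?D ?x U0 a0 = germ (tsp X) ?D ?x U2 a2"
    using D.res_closed[OF U0(1) U2(1,3) a0] D.germ_res[OF U0(1) U2(1,3,2) a0] by simp_all
  have p2: "pull Y \<psi> U2 b2 \<in> carrier (sect ?D U2)" "pull Y \<psi> U2 c2 \<in> carrier (sect ?D U2)"
    using pull_closed[OF U2(1)] h2 by (simp_all add: direct_structure_simps)
  have "germ (tsp X) ?D ?x U2 (pull Y \<psi> U2 b2 \<otimes>\<^bsub>sect ?D U2\<^esub> a2) = germ (tsp X) ?D ?x U2 (pull Y \<psi> U2 c2)"
    using cb(4) U2 h2 p2 a2c by (simp add: g2 ga direct_comorphism_germ D.germ_mult)
  then obtain U where U: "openin (tsp X) U" "?x \<in> U" "U \<subseteq> U2"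
    "res ?D U2 U (pull Y \<psi> U2 b2 \<otimes>\<^bsub>sect ?D U2\<^esub> a2) = res ?D U2 U (pull Y \<psi> U2 c2)"
    using D.germ_eqD[OF U2(1,2) p2(2)] by metis
  have eq: "b1 (\<psi> z) * a z = c1 (\<psi> z)" if z: "z \<in> pre U" for z
  proof -
    have "z \<in> pre U2" "\<psi> z \<in> U2" using z U(3) by (auto simp: preim_iff)
    then show ?thesis
      using fun_cong[OF U(4), of z] z
      by (simp add: direct_structure_simps pull_def a2_def b2_def c2_def)
  qed
  have sub: "U \<subseteq> U1" using U U2 by blast
  show ?thesis
  proof (rule that[of U "restrict b1 U" "restrict c1 U"])
    show "germ_fun X ?x U (restrict b1 U) \<noteq> \<zero>\<^bsub>local_ring X ?x\<^esub>"
      using OX.germ_res[OF 1(1) U(1) sub U(2)] 1 cb(3) by simp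
    show "pre U \<subseteq> W"
      using preim_mono[of U U0] U U2 U0 by blast
    show "restrict b1 U (\<psi> z) * a z = restrict c1 U (\<psi> z)" if "z \<in> pre U" for z
      using that eq[OF that] by (simp add: preim_iff)
  qed (use hol_restrict[OF X 1(1) U(1) sub] 1 U in auto)
qed

text \<open>An annihilating germ on \<open>Y\<close> is carried into \<open>direct_ring\<close> by
  shrinking its domain to some \<open>pre V\<close>. There the pullback of \<open>b\<close> is
  nonzero, since the comorphism is injective, and the ring has no zero divisors.\<close>

lemma pull_nonzerodivisor:
  assumes "openin (tsp X) U" "\<psi> y \<in> U" "y \<in> pts Y" "b \<in> hol X U"
    and nz: "germ_fun X (\<psi> y) U b \<noteq> \<zero>\<^bsub>local_ring X (\<psi> y)\<^esub>"
  shows "germ_fun Y y (pre U) (pull Y \<psi> U b) \<in> nonzerodivisors (local_ring Y y)"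
proof -
  let ?x = "\<psi> y" and ?D = DS
  have x: "?x \<in> pts X" using assms(3) by (rule psi_pts)
  have P: "openin (tsp Y) (pre U)" "y \<in> pre U"
    using assms preim_open by (auto simp: preim_iff)
  have pb: "pull Y \<psi> U b \<in> hol Y (pre U)" using assms by (intro pull_closed)
  have "a = \<zero>\<^bsub>local_ring Y y\<^esub>" if a: "a \<in> carrier (local_ring Y y)"
    and ab: "a \<otimes>\<^bsub>local_ring Y y\<^esub> germ_fun Y y (pre U) (pull Y \<psi> U b) = \<zero>\<^bsub>local_ring Y y\<^esub>" for a
  proof -
    obtain W f where W: "openin (tsp Y) W" "y \<in> W" "W \<subseteq> pre U" "f \<in> hol Y W" "a = germ_fun Y y W f"
      using a P by (rule OY.stalk_cases_within) simp
    define b' where "b' = restrict (pull Y \<psi> U b) W"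
    have b': "b' \<in> hol Y W" "germ_fun Y y (pre U) (pull Y \<psi> U b) = germ_fun Y y W b'"
      using OY.res_closed[OF P(1) W(1,3)] OY.germ_res[OF P(1) W(1,3,2)] pb by (simp_all add: b'_def)
    have "germ_fun Y y W (f \<otimes>\<^bsub>sect (structure_sheaf Y) W\<^esub> b') = \<zero>\<^bsub>local_ring Y y\<^esub>"
      using ab OY.germ_mult[OF W(1,2), of f b'] W b' by simp
    moreover have "f \<otimes>\<^bsub>sect (structure_sheaf Y) W\<^esub> b' \<in> carrier (sect (structure_sheaf Y) W)"
      using OY.mult_sect_closed[OF W(1), of f b'] W b' by simp
    ultimately obtain W' where W': "openin (tsp Y) W'" "y \<in> W'" "W' \<subseteq> W"
      "res (structure_sheaf Y) W W' (f \<otimes>\<^bsub>sect (structure_sheaf Y) W\<^esub> b') = \<zero>\<^bsub>sect (structure_sheaf Y) W'\<^esub>"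
      using OY.germ_eq_zeroD W(1,2) by metis
    obtain V0 where V0: "openin (tsp X) V0" "?x \<in> V0" "pre V0 \<subseteq> W'"
      using W'(1,2) by (rule preim_neighbourhood)
    define V where "V = V0 \<inter> U"
    have V: "openin (tsp X) V" "?x \<in> V" "pre V \<subseteq> W'" "V \<subseteq> U" "pre V \<subseteq> W"
      using V0 assms W' preim_mono[of V V0] by (auto simp: V_def)
    define bV fV where "bV = restrict b V" and "fV = restrict f (pre V)"
    have bV: "bV \<in> hol X V" "germ_fun X ?x V bV = germ_fun X ?x U b"
      using hol_restrict[OF X assms(1) V(1,4)] OX.germ_res[OF assms(1) V(1,4,2)] assms(4)
      by (simp_all add: bV_def)
    have fV: "fV \<in> carrier (sect ?D V)" "a = germ_fun Y y (pre V) fV"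
      using OY.res_closed[OF W(1) preim_open[OF V(1)] V(5)]
        OY.germ_res[OF W(1) preim_open[OF V(1)] V(5), of y f] W V assms(3)
      by (simp_all add: fV_def direct_structure_simps preim_iff)
    have pV: "pull Y \<psi> V bV \<in> carrier (sect ?D V)"
      using pull_closed[OF V(1) bV(1)] by (simp add: direct_structure_simps)
    have "fV \<otimes>\<^bsub>sect ?D V\<^esub> pull Y \<psi> V bV = \<zero>\<^bsub>sect ?D V\<^esub>"
    proof
      fix z
      show "(fV \<otimes>\<^bsub>sect ?D V\<^esub> pull Y \<psi> V bV) z = \<zero>\<^bsub>sect ?D V\<^esub> z"
      proof (cases "z \<in> pre V")
        case True
        then have "z \<in> W'" "z \<in> W" "z \<in> pre U" "\<psi> z \<in> V" using V W by (auto simp: preim_iff)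
        then show ?thesis
          using fun_cong[OF W'(4), of z] True
          by (simp add: direct_structure_simps fV_def bV_def b'_def pull_def)
      qed (simp add: direct_structure_simps)
    qed
    then have "germ (tsp X) ?D ?x V fV \<otimes>\<^bsub>direct_ring ?x\<^esub> germ (tsp X) ?D ?x V (pull Y \<psi> V bV) =
        \<zero>\<^bsub>direct_ring ?x\<^esub>"
      using D.germ_mult[OF V(1,2) fV(1) pV] D.germ_zero[OF V(1,2)] by simp
    moreover have "germ (tsp X) ?D ?x V (pull Y \<psi> V bV) \<noteq> \<zero>\<^bsub>direct_ring ?x\<^esub>"
      using direct_comorphism_inj[OF x, of "germ_fun X ?x V bV"] nz OX.germ_closed[OF V(1,2), of bV] bV
        direct_comorphism_germ[OF V(1,2) bV(1)] by auto
    ultimately have "germ (tsp X) ?D ?x V fV = \<zero>\<^bsub>direct_ring ?x\<^esub>"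
      using direct_ring_integral[OF x D.germ_closed[OF V(1,2) fV(1)] D.germ_closed[OF V(1,2) pV]] by blast
    then obtain V' where V': "openin (tsp X) V'" "?x \<in> V'" "V' \<subseteq> V" "res ?D V V' fV = \<zero>\<^bsub>sect ?D V'\<^esub>"
      using V(1,2) fV(1) by (rule D.germ_eq_zeroD)
    \<comment> \<open>Vanishing of the germ at \<open>\<psi> y\<close> means vanishing on all of
      \<open>pre V'\<close>, which is a neighbourhood of \<open>y\<close>.\<close>
    have "a = germ_fun Y y (pre V') (restrict fV (pre V'))"
      using OY.germ_res[OF preim_open[OF V(1)] preim_open[OF V'(1)] preim_mono[OF V'(3)], of y fV]
        fV V' assms(3) by (simp add: direct_structure_simps preim_iff)
    also have "\<dots> = \<zero>\<^bsub>local_ring Y y\<^esub>"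
      using V'(4) OY.germ_zero[OF preim_open[OF V'(1)], of y] V' assms(3)
      by (simp add: direct_structure_simps preim_iff)
    finally show ?thesis .
  qed
  then show ?thesis
    unfolding nonzerodivisors_def using OY.germ_closed[OF P, of "pull Y \<psi> U b"] pb by simp
qed

end

section \<open>The canonical morphism\<close>

lemma direct_image_simps:
  "carrier (sect (direct_image Y \<psi> F) U) = carrier (sect F (preim Y \<psi> U))"
  "add (sect (direct_image Y \<psi> F) U) = add (sect F (preim Y \<psi> U))"
  "\<zero>\<^bsub>sect (direct_image Y \<psi> F) U\<^esub> = \<zero>\<^bsub>sect F (preim Y \<psi> U)\<^esub>"
  "f \<odot>\<^bsub>sect (direct_image Y \<psi> F) U\<^esub> s = pull Y \<psi> U f \<odot>\<^bsub>sect F (preim Y \<psi> U)\<^esub> s"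
  "res (direct_image Y \<psi> F) U V = res F (preim Y \<psi> U) (preim Y \<psi> V)"
  by (simp_all add: direct_image_def Let_def)

section \<open>The direct image and the canonical map on stalks\<close>

locale sheaf_on_normalization = irreducible_normalization X Y \<psi> + F: module_sheaf Y F
  for X :: "'p fspace" and Y :: "'q fspace" and \<psi> :: "'q \<Rightarrow> 'p" and F :: "('q, 's) apresheaf"
begin

abbreviation DF :: "('p, 's) apresheaf" where "DF \<equiv> direct_image Y \<psi> F"

abbreviation IF where "IF \<equiv> inverse_image Y X \<psi> DF"

text \<open>\<open>module_presheaf\<close> would include a \<open>ring_presheaf\<close> of scalars
  on \<open>X\<close>. The scalar action on the direct image is instead provided by
  \<open>DF_germ_smult\<close> and \<open>DF_smult_closed\<close>.\<close>

sublocale DF: additive_presheaf "tsp X" DF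
proof -
  have "abelian_group (sect DF U)" if "openin (tsp X) U" for U
    by (rule abelian_group_cong[OF _ _ _ F.abelian_sect[OF preim_open[OF that]]])
      (simp_all add: direct_image_simps)
  then show "additive_presheaf (tsp X) DF"
    by (intro additive_presheaf.intro additive_presheaf_axioms.intro presheaf_on.intro)
      (simp_all add: direct_image_simps F.res_closed F.res_res F.res_add preim_open preim_mono)
qed

lemma DF_germ_smult:
  assumes "openin (tsp X) U" "x \<in> U" "f \<in> hol X U" "s \<in> carrier (sect DF U)"
  shows "germ_fun X x U f \<odot>\<^bsub>stalk_mod X DF x\<^esub> germ (tsp X) DF x U s =
    germ (tsp X) DF x U (f \<odot>\<^bsub>sect DF U\<^esub> s)"
  using OX.presheaf_on_axioms DF.presheaf_on_axioms assms
proof (rule germ_smult_gen)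
  fix V W g t assume V: "openin (tsp X) V" "g \<in> hol X V" "t \<in> carrier (sect DF V)"
  show "g \<odot>\<^bsub>sect DF V\<^esub> t \<in> carrier (sect DF V)"
    using V F.smult_sect_closed[OF preim_open[OF V(1)] pull_closed[OF V(1,2)]]
    by (simp add: direct_image_simps)
  assume W: "openin (tsp X) W" "W \<subseteq> V"
  show "res DF V W (g \<odot>\<^bsub>sect DF V\<^esub> t) = restrict g W \<odot>\<^bsub>sect DF W\<^esub> res DF V W t"
    using V W F.res_smult[OF preim_open[OF V(1)] preim_open[OF W(1)] preim_mono[OF W(2)] pull_closed[OF V(1,2)]]
    by (simp add: direct_image_simps pull_restrict)
qed

lemma DF_smult_closed:
  assumes "openin (tsp X) U" "f \<in> hol X U" "s \<in> carrier (sect DF U)"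
  shows "f \<odot>\<^bsub>sect DF U\<^esub> s \<in> carrier (sect DF U)"
  using assms F.smult_sect_closed[OF preim_open[OF assms(1)] pull_closed[OF assms(1,2)]]
  by (simp add: direct_image_simps)

lemma DF_ring_module_stalk_cases:
  assumes "r \<in> carrier (local_ring X x)" "m \<in> carrier (stalk (tsp X) DF x)"
  obtains U f s where "openin (tsp X) U" "x \<in> U" "f \<in> hol X U" "s \<in> carrier (sect DF U)"
    "r = germ_fun X x U f" "m = germ (tsp X) DF x U s"
proof -
  obtain V f where V: "openin (tsp X) V" "x \<in> V" "f \<in> hol X V" "r = germ_fun X x V f"
    using assms(1) by (rule OX.stalk_cases) simp
  obtain U s where U: "openin (tsp X) U" "x \<in> U" "U \<subseteq> V" "s \<in> carrier (sect DF U)"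
    "m = germ (tsp X) DF x U s"
    using assms(2) V(1,2) by (rule DF.stalk_cases_within)
  show ?thesis
    using that[of U "restrict f U" s] U V OX.germ_res[of V U x f] OX.res_closed[of V U f] by auto
qed

lemma direct_stalk_map_germ:
  assumes "openin (tsp X) U" "\<psi> y \<in> U" "y \<in> pts Y" "s \<in> carrier (sect DF U)"
  shows "direct_stalk_map Y \<psi> F y (germ (tsp X) DF (\<psi> y) U s) = germ (tsp Y) F y (pre U) s"
  unfolding direct_stalk_map_def using assms preim_open preim_mono
    DF.presheaf_on_axioms F.presheaf_on_axioms
  by (intro germ_map[where p = "pre" and k = "\<lambda>_ s. s"])
    (auto simp: preim_iff direct_image_simps)

abbreviation "can_stalk \<equiv> canonical_stalk Y \<psi> F"

abbreviation "can_mor \<equiv> canonical_morphism Y \<psi> F"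

abbreviation "dmap \<equiv> direct_stalk_map Y \<psi> F"

abbreviation "modD \<equiv> stalk_mod X DF"

abbreviation "modF \<equiv> stalk_mod Y F"

abbreviation "comor \<equiv> comorphism Y \<psi>"

abbreviation "stalkD \<equiv> stalk (tsp X) DF"

abbreviation "stalkF \<equiv> stalk (tsp Y) F"

abbreviation "germD \<equiv> germ (tsp X) DF"

abbreviation "germF \<equiv> germ (tsp Y) F"

abbreviation "tstalk \<equiv> inv_stalk Y X \<psi> DF"

abbreviation "tclass \<equiv> inv_class Y X \<psi> DF"

text \<open>\<open>dmap y\<close> is semilinear over the comorphism, because over \<open>U\<close> a
  scalar \<open>f\<close> acts on the direct image through its pullback to \<open>pre U\<close>. The
  canonical stalk map is the induced map on the tensor product.\<close>

lemma scalar_extension_lift: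
  assumes y: "y \<in> pts Y"
  shows "scalar_extension_lift (local_ring X (\<psi> y)) (local_ring Y y) (comor y)
    (modD (\<psi> y)) (modF y) (dmap y)"
proof -
  have x: "\<psi> y \<in> pts X" using y by (rule psi_pts)
  interpret S: cring "local_ring Y y" using y by (rule OY.stalk_cring)
  interpret M: abelian_group "stalkD (\<psi> y)" using x by (rule DF.stalk_abelian)
  interpret N: module "local_ring Y y" "modF y" using y by (rule F.stalk_module)
  show ?thesis
  proof (intro scalar_extension_lift.intro scalar_extension.intro scalar_extension_axioms.intro
      scalar_extension_lift_axioms.intro S.cring_axioms N.module_axioms comorphism_closed[OF y])
    fix m m' assume m: "m \<in> carrier (modD (\<psi> y))" and m': "m' \<in> carrier (modD (\<psi> y))"
    then obtain U s t where U: "openin (tsp X) U" "\<psi> y \<in> U" "s \<in> carrier (sect DF U)"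
      "t \<in> carrier (sect DF U)" "m = germD (\<psi> y) U s" "m' = germD (\<psi> y) U t"
      unfolding stalk_mod_simps by (rule DF.stalk_cases2)
    show "m \<oplus>\<^bsub>modD (\<psi> y)\<^esub> m' \<in> carrier (modD (\<psi> y))"
      using m m' by simp
    have P: "openin (tsp Y) (pre U)" "y \<in> pre U"
      using U y by (auto simp: preim_open preim_iff)
    show "dmap y (m \<oplus>\<^bsub>modD (\<psi> y)\<^esub> m') =
        dmap y m \<oplus>\<^bsub>modF y\<^esub> dmap y m'"
      using U y P DF.add_sect_closed[OF U(1,3,4)]
      by (simp add: DF.germ_add direct_stalk_map_germ F.germ_add direct_image_simps)
  next
    fix r m assume "r \<in> carrier (local_ring X (\<psi> y))" "m \<in> carrier (modD (\<psi> y))"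
    then obtain U f s where U: "openin (tsp X) U" "\<psi> y \<in> U" "f \<in> hol X U" "s \<in> carrier (sect DF U)"
      "r = germ_fun X (\<psi> y) U f" "m = germD (\<psi> y) U s"
      unfolding stalk_mod_simps by (rule DF_ring_module_stalk_cases)
    have P: "openin (tsp Y) (pre U)" "y \<in> pre U"
      using U y by (auto simp: preim_open preim_iff)
    show "r \<odot>\<^bsub>modD (\<psi> y)\<^esub> m \<in> carrier (modD (\<psi> y))"
      using U DF_smult_closed[OF U(1,3,4)] by (simp add: DF_germ_smult DF.germ_closed)
    show "dmap y (r \<odot>\<^bsub>modD (\<psi> y)\<^esub> m) =
        comor y r \<odot>\<^bsub>modF y\<^esub> dmap y m"
      unfolding U(5,6) DF_germ_smult[OF U(1-4)] direct_stalk_map_germ[OF U(1,2) y DF_smult_closed[OF U(1,3,4)]]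
        direct_stalk_map_germ[OF U(1,2) y U(4)] comorphism_germ[OF U(1,2) y U(3)]
      using F.germ_smult[OF P pull_closed[OF U(1,3)]] U(4) by (simp add: direct_image_simps)
  next
    fix m assume "m \<in> carrier (modD (\<psi> y))"
    then obtain U s where U: "openin (tsp X) U" "\<psi> y \<in> U" "s \<in> carrier (sect DF U)"
      "m = germD (\<psi> y) U s"
      unfolding stalk_mod_simps by (rule DF.stalk_cases)
    then show "dmap y m \<in> carrier (modF y)"
      using y F.germ_closed[OF preim_open[OF U(1)], of y s]
      by (simp add: direct_stalk_map_germ preim_iff direct_image_simps)
  qed
qed

lemmas scalar_extension = scalar_extension_lift[THEN scalar_extension_lift.axioms(1)]

abbreviation "lift_free_at y \<equiv> scalar_extension_lift.lift_free (modF y) (dmap y)"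

abbreviation "tensors_at y \<equiv> scalar_extension.tensors (local_ring Y y) (modD (\<psi> y))"

lemma
  assumes y: "y \<in> pts Y"
  shows canonical_stalk_hom: "can_stalk y \<in> mod_hom (local_ring Y y) (tstalk y) (modF y)"
    and canonical_stalk_class: "f \<in> tensors_at y \<Longrightarrow> can_stalk y (tclass y f) = lift_free_at y f"
proof -
  interpret L: scalar_extension_lift "local_ring X (\<psi> y)" "local_ring Y y" "comor y"
    "modD (\<psi> y)" "modF y" "dmap y"
    using y by (rule scalar_extension_lift)
  have "can_stalk y = L.lift"
    by (rule ext) (simp add: canonical_stalk_def Let_def L.lift_def L.lift_free_def[abs_def])
  then show "can_stalk y \<in> mod_hom (local_ring Y y) (tstalk y) (modF y)"
    "f \<in> tensors_at y \<Longrightarrow> can_stalk y (tclass y f) = lift_free_at y f"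
    using L.lift_hom L.lift_cls by (simp_all add: inv_stalk_def inv_class_def)
qed

lemma inv_stalk_module: "y \<in> pts Y \<Longrightarrow> Module.module (local_ring Y y) (tstalk y)"
  unfolding inv_stalk_def using scalar_extension by (rule scalar_extension.base_change_module)

section \<open>Local sections of the inverse image as finite sums of tensors\<close>

definition gens where
  "gens U W gas z = (\<Sum>(g, a) \<leftarrow> gas. frag_of (germD (\<psi> z) U g, germ_fun Y z W a))"

definition admissible where
  "admissible U W gas \<longleftrightarrow> openin (tsp X) U \<and> openin (tsp Y) W \<and> W \<subseteq> pre U \<and>
     set gas \<subseteq> carrier (sect DF U) \<times> hol Y W"

text \<open>The set is spelled out as in \<open>inverse_image\<close>, so that \<open>IF_eq\<close>
  holds by unfolding. For open \<open>W\<close> it is reformulated with \<open>admissible\<close> in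
  \<open>gen_sections_iff\<close>.\<close>

definition "gen_sections W = {\<lambda>z. tclass z
    (\<Sum>(g, a) \<leftarrow> gas. frag_of (germD (\<psi> z) U g, germ_fun Y z W a)) | U gas.
      openin (tsp X) U \<and> W \<subseteq> pre U \<and> set gas \<subseteq> carrier (sect DF U) \<times> hol Y W}"

lemma IF_eq: "IF = section_sheaf Y (tstalk) gen_sections"
  unfolding inverse_image_def gen_sections_def[abs_def] ..

lemma gen_sections_iff:
  "openin (tsp Y) W \<Longrightarrow> t \<in> gen_sections W \<longleftrightarrow>
    (\<exists>U gas. admissible U W gas \<and> t = (\<lambda>z. tclass z (gens U W gas z)))"
  unfolding admissible_def gens_def[abs_def] gen_sections_def by blast

lemma gen_sectionsI:
  "admissible U W gas \<Longrightarrow> (\<lambda>z. tclass z (gens U W gas z)) \<in> gen_sections W"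
  using gen_sections_iff[of W] unfolding admissible_def by blast

lemma gens_simps:
  "gens U W [] z = 0"
  "gens U W ((g, a) # gas) z = frag_of (germD (\<psi> z) U g, germ_fun Y z W a) + gens U W gas z"
  "gens U W (gas @ gas') z = gens U W gas z + gens U W gas' z"
  by (simp_all add: gens_def)

lemma admissible_simps:
  "admissible U W ((g, a) # gas) \<longleftrightarrow> g \<in> carrier (sect DF U) \<and> a \<in> hol Y W \<and> admissible U W gas"
  "admissible U W (gas @ gas') \<longleftrightarrow> admissible U W gas \<and> admissible U W gas'"
  by (auto simp: admissible_def)

lemma admissible_point:
  assumes "admissible U W gas" "z \<in> W"
  shows "openin (tsp X) U" "openin (tsp Y) W" "\<psi> z \<in> U" "z \<in> pts Y"
  using assms by (auto simp: admissible_def preim_iff)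

lemma gens_tensors:
  assumes "admissible U W gas" "z \<in> W"
  shows "gens U W gas z \<in> tensors_at z"
  using assms
proof (induction gas)
  case Nil
  then show ?case
    using scalar_extension.tensors_closed(1)[OF scalar_extension] admissible_point by (simp add: gens_simps)
next
  case (Cons p gas)
  obtain g a where p: "p = (g, a)" by force
  note a = Cons.prems[unfolded p admissible_simps]
  note z = admissible_point[OF Cons.prems]
  show ?case
    using a Cons.IH OY.germ_closed[OF z(2) Cons.prems(2), of a] DF.germ_closed[OF z(1,3), of g]
    unfolding p gens_simps
    by (intro scalar_extension.tensors_closed(3,5)[OF scalar_extension[OF z(4)]]) simp_all
qed

text \<open>Restricting a section does not change its germs, so the formal sums agree in the free
  group, even before classes are taken. Shrinking \<open>U\<close> independently of \<open>W\<close>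
  is needed to bring two sums over a common open set of \<open>X\<close>.\<close>

lemma gens_restrict:
  assumes "admissible U W gas" "openin (tsp X) U'" "U' \<subseteq> U" "openin (tsp Y) W'" "W' \<subseteq> W" "W' \<subseteq> pre U'"
  shows "admissible U' W' (map (\<lambda>(g, a). (res DF U U' g, restrict a W')) gas)"
    and "z \<in> W' \<Longrightarrow> gens U' W' (map (\<lambda>(g, a). (res DF U U' g, restrict a W')) gas) z = gens U W gas z"
  using assms(1)
proof (induction gas)
  case Nil
  { case 1 then show ?case using assms by (simp add: admissible_def) }
  { case 2 then show ?case by (simp add: gens_simps) }
next
  case (Cons p gas)
  obtain g a where p: "p = (g, a)" by force
  {
    case 1
    then have a: "g \<in> carrier (sect DF U)" "a \<in> hol Y W" "admissible U W gas" "openin (tsp X) U" "openin (tsp Y) W"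
      unfolding p by (auto simp: admissible_simps) (auto simp: admissible_def)
    then show ?case
      using Cons.IH(1) DF.res_closed[OF a(4) assms(2,3) a(1)] OY.res_closed[OF a(5) assms(4,5), of a]
      by (simp add: p admissible_simps del: restrict_apply)
  next
    case 2
    then have a: "g \<in> carrier (sect DF U)" "a \<in> hol Y W" "admissible U W gas" "openin (tsp X) U" "openin (tsp Y) W"
      unfolding p by (auto simp: admissible_simps) (auto simp: admissible_def)
    have "\<psi> z \<in> U'" using 2(1) assms(6) by (auto simp: preim_iff)
    then show ?case
      using Cons.IH(2)[OF 2(1) a(3)] DF.germ_res[OF a(4) assms(2,3) _ a(1)]
        OY.germ_res[OF a(5) assms(4,5) 2(1), of a] a(2)
      by (simp add: p gens_simps del: restrict_apply)
  }
qed

lemma gens_mult: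
  assumes "admissible U W gas" "f \<in> hol Y W"
  shows "admissible U W (map (\<lambda>(g, a). (g, \<lambda>x\<in>W. f x * a x)) gas)"
    and "z \<in> W \<Longrightarrow> gens U W (map (\<lambda>(g, a). (g, \<lambda>x\<in>W. f x * a x)) gas) z =
      frag_extend (\<lambda>(x, s). frag_of (x, germ_fun Y z W f \<otimes>\<^bsub>local_ring Y z\<^esub> s)) (gens U W gas z)"
  using assms(1)
proof (induction gas)
  case Nil
  { case 1 then show ?case by simp }
  { case 2 then show ?case by (simp add: gens_simps) }
next
  case (Cons p gas)
  obtain g a where p: "p = (g, a)" by force
  {
    case 1
    then have a: "g \<in> carrier (sect DF U)" "a \<in> hol Y W" "admissible U W gas" "openin (tsp Y) W"
      unfolding p by (auto simp: admissible_simps) (auto simp: admissible_def)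
    then show ?case
      using Cons.IH(1) OY.mult_sect_closed[OF a(4), of f a] assms(2)
      by (simp add: p admissible_simps del: restrict_apply)
  next
    case 2
    then have a: "g \<in> carrier (sect DF U)" "a \<in> hol Y W" "admissible U W gas" "openin (tsp Y) W"
      unfolding p by (auto simp: admissible_simps) (auto simp: admissible_def)
    show ?case
      using Cons.IH(2)[OF 2(1) a(3)] OY.germ_mult[OF a(4) 2(1), of f a] a(2) assms(2)
      by (simp add: p gens_simps frag_extend_add del: restrict_apply)
  }
qed

text \<open>A section \<open>g\<close> of the direct image over \<open>U\<close> is a section of
  \<open>F\<close> over \<open>pre U\<close>, which contains \<open>W\<close>. The required
  \<open>r\<close> is the linear combination of the restrictions of the \<open>g\<close> with the
  coefficients \<open>a\<close>.\<close>

lemma gens_lift: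
  assumes "admissible U W gas" "openin (tsp Y) W"
  shows "\<exists>r \<in> carrier (sect F W). \<forall>z \<in> W. germF z W r = lift_free_at z (gens U W gas z)"
  using assms(1)
proof (induction gas)
  case Nil
  have "lift_free_at z 0 = \<zero>\<^bsub>stalkF z\<^esub>" if "z \<in> W" for z
    using scalar_extension_lift.lift_free_zero[OF scalar_extension_lift] admissible_point[OF Nil that]
    by simp
  then show ?case
    using assms(2) F.germ_zero F.zero_sect_closed
    by (intro bexI[of _ "\<zero>\<^bsub>sect F W\<^esub>"]) (simp_all add: gens_simps)
next
  case (Cons p gas)
  obtain g a where p: "p = (g, a)" by force
  note a = Cons.prems[unfolded p admissible_simps]
  obtain r where r: "r \<in> carrier (sect F W)" "\<forall>z \<in> W. germF z W r = lift_free_at z (gens U W gas z)"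
    using Cons.IH a by blast
  have U: "openin (tsp X) U" "W \<subseteq> pre U" using Cons.prems by (auto simp: admissible_def)
  have g: "g \<in> carrier (sect F (pre U))" using a by (simp add: direct_image_simps)
  define g' where "g' = res F (pre U) W g"
  have g': "g' \<in> carrier (sect F W)"
    unfolding g'_def using F.res_closed[OF preim_open[OF U(1)] assms(2) U(2) g] .
  have "germF z W (a \<odot>\<^bsub>sect F W\<^esub> g' \<oplus>\<^bsub>sect F W\<^esub> r) = lift_free_at z (gens U W (p # gas) z)"
    if z: "z \<in> W" for z
  proof -
    note zz = admissible_point[OF Cons.prems z]
    interpret L: scalar_extension_lift "local_ring X (\<psi> z)" "local_ring Y z" "comor z"
      "modD (\<psi> z)" "modF z" "dmap z"
      using zz(4) by (rule scalar_extension_lift)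
    have c: "germD (\<psi> z) U g \<in> carrier (modD (\<psi> z))"
      "germ_fun Y z W a \<in> carrier (local_ring Y z)"
      using a OY.germ_closed[OF zz(2) z, of a] DF.germ_closed[OF zz(1,3), of g] by simp_all
    have "germF z W g' = dmap z (germD (\<psi> z) U g)"
      using F.germ_res[OF preim_open[OF U(1)] assms(2) U(2) z g] direct_stalk_map_germ[OF zz(1,3,4)] a
      by (simp add: g'_def)
    then have "germF z W (a \<odot>\<^bsub>sect F W\<^esub> g' \<oplus>\<^bsub>sect F W\<^esub> r) =
        lift_free_at z (frag_of (germD (\<psi> z) U g, germ_fun Y z W a)) \<oplus>\<^bsub>modF z\<^esub>
        lift_free_at z (gens U W gas z)"
      using r a g' z assms(2) L.lift_free_of[OF c]
      by (simp add: F.germ_add[symmetric] F.germ_smult[symmetric] F.smult_sect_closed)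
    also have "\<dots> = lift_free_at z (gens U W (p # gas) z)"
      using L.lift_free_add[OF L.tensors_closed(5)[OF c] gens_tensors[OF _ z]] a by (simp add: p gens_simps)
    finally show ?thesis .
  qed
  then show ?case
    using F.add_sect_closed[OF assms(2) F.smult_sect_closed[OF assms(2) _ g'] r(1)] a by blast
qed

lemma gen_sections_lift:
  assumes "openin (tsp Y) W" "t \<in> gen_sections W" "y \<in> W"
  shows "\<exists>W' r. openin (tsp Y) W' \<and> y \<in> W' \<and> W' \<subseteq> W \<and> r \<in> carrier (sect F W') \<and>
      (\<forall>z \<in> W'. germF z W' r = can_stalk z (t z))"
proof -
  obtain U gas where a: "admissible U W gas" and t: "t = (\<lambda>z. tclass z (gens U W gas z))"
    using assms(2) unfolding gen_sections_iff[OF assms(1)] by blast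
  obtain r where r: "r \<in> carrier (sect F W)" "\<forall>z \<in> W. germF z W r = lift_free_at z (gens U W gas z)"
    using gens_lift[OF a assms(1)] by blast
  have "germF z W r = can_stalk z (t z)" if "z \<in> W" for z
    using r that canonical_stalk_class[OF admissible_point(4)[OF a that] gens_tensors[OF a that]]
    by (simp add: t)
  then show ?thesis using assms r(1) by blast
qed

lemma canonical_morphism_hom: "sheaf_hom Y IF F (can_mor)"
    and canonical_morphism_germ: "\<lbrakk>openin (tsp Y) V; s \<in> carrier (sect IF V)\<rbrakk> \<Longrightarrow> can_mor V s \<in> carrier (sect F V) \<and>
      (\<forall>y \<in> V. germF y V (can_mor V s) = can_stalk y (s y))"
    and canonical_morphism_eqI: "\<lbrakk>openin (tsp Y) V; t \<in> carrier (sect F V);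
      \<And>y. y \<in> V \<Longrightarrow> germF y V t = can_stalk y (s y)\<rbrakk> \<Longrightarrow>
      can_mor V s = t"
proof -
  have c: "can_mor = (\<lambda>V s. THE t. t \<in> carrier (sect F V) \<and>
      (\<forall>y \<in> V. germF y V t = can_stalk y (s y)))"
    by (intro ext) (simp add: canonical_morphism_def)
  show "sheaf_hom Y IF F (can_mor)"
    unfolding IF_eq c by (rule F.sheaf_hom_of_stalk_maps(1)) (fact canonical_stalk_hom gen_sections_lift)+
  show "can_mor V s \<in> carrier (sect F V) \<and>
      (\<forall>y \<in> V. germF y V (can_mor V s) = can_stalk y (s y))"
    if "openin (tsp Y) V" "s \<in> carrier (sect IF V)"
    unfolding c
    by (rule F.sheaf_hom_of_stalk_maps(2)[where \<Gamma> = gen_sections and E = "tstalk"])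
      (fact canonical_stalk_hom gen_sections_lift that(1) that(2)[unfolded IF_eq])+
  show "can_mor V s = t" if "openin (tsp Y) V" "t \<in> carrier (sect F V)"
    "\<And>y. y \<in> V \<Longrightarrow> germF y V t = can_stalk y (s y)"
    unfolding c
    by (rule F.sheaf_hom_of_stalk_maps(3)[where \<Gamma> = gen_sections]) (fact canonical_stalk_hom gen_sections_lift that)+
qed

lemma inv_class_ops:
  assumes "z \<in> pts Y" "f \<in> tensors_at z"
  shows "g \<in> tensors_at z \<Longrightarrow> tclass z f \<oplus>\<^bsub>tstalk z\<^esub> tclass z g =
      tclass z (f + g)"
    and "t \<in> carrier (local_ring Y z) \<Longrightarrow> t \<odot>\<^bsub>tstalk z\<^esub> tclass z f =
      tclass z (frag_extend (\<lambda>(x, s). frag_of (x, t \<otimes>\<^bsub>local_ring Y z\<^esub> s)) f)"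
    and "tclass z f \<in> carrier (tstalk z)"
  using scalar_extension.base_change_add[OF scalar_extension[OF assms(1)] assms(2)]
    scalar_extension.base_change_smult[OF scalar_extension[OF assms(1)] _ assms(2)]
    scalar_extension.base_change_carrier[OF scalar_extension[OF assms(1)]] assms(2)
  unfolding inv_stalk_def inv_class_def by blast+

lemma inv_class_zero: "z \<in> pts Y \<Longrightarrow> tclass z 0 = \<zero>\<^bsub>tstalk z\<^esub>"
  using scalar_extension.base_change_zero[OF scalar_extension] unfolding inv_stalk_def inv_class_def by simp

sublocale IF: module_presheaf Y IF
  unfolding IF_eq
proof (rule module_presheaf_section_sheaf[OF ring_Y inv_stalk_module])
  fix W W' t assume W: "openin (tsp Y) W" "openin (tsp Y) W'" "W' \<subseteq> W" "t \<in> gen_sections W"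
  obtain U gas where a: "admissible U W gas" and t: "t = (\<lambda>z. tclass z (gens U W gas z))"
    using W(4) unfolding gen_sections_iff[OF W(1)] by blast
  have "openin (tsp X) U" "W' \<subseteq> pre U" using a W(3) by (auto simp: admissible_def)
  note r = gens_restrict[OF a this(1) subset_refl W(2,3) this(2)]
  show "\<exists>t' \<in> gen_sections W'. \<forall>z \<in> W'. t' z = t z"
    using r(2) by (intro bexI[OF _ gen_sectionsI[OF r(1)]]) (simp add: t)
next
  fix W assume W: "openin (tsp Y) W"
  then have a: "admissible (pts X) W []"
    using openin_subset[OF W] psi_pts by (auto simp: admissible_def preim_iff)
  have "tclass z (gens (pts X) W [] z) = \<zero>\<^bsub>tstalk z\<^esub>" if "z \<in> W" for z
    using inv_class_zero[of z] subsetD[OF openin_subset[OF W] that] by (simp add: gens_simps)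
  then show "\<exists>t \<in> gen_sections W. \<forall>z \<in> W. t z = \<zero>\<^bsub>tstalk z\<^esub>"
    by (intro bexI[OF _ gen_sectionsI[OF a]]) blast
next
  fix W s t assume W: "openin (tsp Y) W" "s \<in> gen_sections W" "t \<in> gen_sections W"
  obtain U gas where a: "admissible U W gas" and s: "s = (\<lambda>z. tclass z (gens U W gas z))"
    using W(2) unfolding gen_sections_iff[OF W(1)] by blast
  obtain U' gas' where a': "admissible U' W gas'" and t: "t = (\<lambda>z. tclass z (gens U' W gas' z))"
    using W(3) unfolding gen_sections_iff[OF W(1)] by blast
  \<comment> \<open>The two sums may use different open sets of \<open>X\<close>. Over
    \<open>U \<inter> U'\<close> their lists can be concatenated, which is addition in the free
    group.\<close>
  have U: "openin (tsp X) (U \<inter> U')" "W \<subseteq> pre (U \<inter> U')"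
    using a a' by (auto simp: admissible_def preim_def)
  note r = gens_restrict[OF a U(1) Int_lower1 W(1) subset_refl U(2)]
  note r' = gens_restrict[OF a' U(1) Int_lower2 W(1) subset_refl U(2)]
  let ?gas = "map (\<lambda>(g, a). (res DF U (U \<inter> U') g, restrict a W)) gas @
    map (\<lambda>(g, a). (res DF U' (U \<inter> U') g, restrict a W)) gas'"
  have adm: "admissible (U \<inter> U') W ?gas"
    using r(1) r'(1) by (simp add: admissible_simps(2))
  have "tclass z (gens (U \<inter> U') W ?gas z) = s z \<oplus>\<^bsub>tstalk z\<^esub> t z" if z: "z \<in> W" for z
    using r(2)[OF z] r'(2)[OF z] inv_class_ops(1)[OF admissible_point(4)[OF a z] gens_tensors[OF a z] gens_tensors[OF a' z]]
    by (simp add: s t gens_simps)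
  then show "\<exists>r \<in> gen_sections W. \<forall>z \<in> W. r z = s z \<oplus>\<^bsub>tstalk z\<^esub> t z"
    by (intro bexI[OF _ gen_sectionsI[OF adm]]) blast
next
  fix W f t assume W: "openin (tsp Y) W" "f \<in> hol Y W" "t \<in> gen_sections W"
  obtain U gas where a: "admissible U W gas" and t: "t = (\<lambda>z. tclass z (gens U W gas z))"
    using W(3) unfolding gen_sections_iff[OF W(1)] by blast
  let ?gas = "map (\<lambda>(g, a). (g, \<lambda>x\<in>W. f x * a x)) gas"
  have "tclass z (gens U W ?gas z) = germ_fun Y z W f \<odot>\<^bsub>tstalk z\<^esub> t z" if z: "z \<in> W" for z
    using gens_mult(2)[OF a W(2) z] OY.germ_closed[OF W(1) z, of f] W(2)
      inv_class_ops(2)[OF admissible_point(4)[OF a z] gens_tensors[OF a z]]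
    by (simp add: t)
  then show "\<exists>r \<in> gen_sections W. \<forall>z \<in> W. r z = germ_fun Y z W f \<odot>\<^bsub>tstalk z\<^esub> t z"
    by (intro bexI[OF _ gen_sectionsI[OF gens_mult(1)[OF a W(2)]]]) blast
qed

lemma gens_section:
  assumes "admissible U W gas"
  shows "(\<lambda>z\<in>W. tclass z (gens U W gas z)) \<in> carrier (sect IF W)"
proof -
  have W: "openin (tsp Y) W" using assms by (simp add: admissible_def)
  show ?thesis
    unfolding IF_eq section_sheaf_carrier
  proof (intro conjI ballI)
    show "(\<lambda>z\<in>W. tclass z (gens U W gas z)) y \<in> carrier (tstalk y)" if "y \<in> W" for y
      using that inv_class_ops(3)[OF admissible_point(4)[OF assms that] gens_tensors[OF assms that]] by simp
    show "\<exists>V t. openin (tsp Y) V \<and> y \<in> V \<and> V \<subseteq> W \<and> t \<in> gen_sections V \<and>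
        (\<forall>z \<in> V. (\<lambda>z\<in>W. tclass z (gens U W gas z)) z = t z)" if "y \<in> W" for y
      using that W gen_sectionsI[OF assms] by (intro exI[of _ W] exI conjI) auto
  qed simp
qed

lemma canonical_morphism_locally_surj:
  assumes "openin (tsp Y) V" "r \<in> carrier (sect F V)" "y \<in> V"
  shows "\<exists>W s. openin (tsp Y) W \<and> y \<in> W \<and> W \<subseteq> V \<and> s \<in> carrier (sect IF W) \<and>
    can_mor W s = res F V W r"
proof -
  obtain U where U: "openin (tsp X) U" "\<psi> y \<in> U" "pre U \<subseteq> V"
    using assms(1,3) by (rule preim_neighbourhood)
  \<comment> \<open>Choosing \<open>W\<close> to be a full preimage lets the same \<open>g\<close>
    serve as a section of \<open>F\<close> over \<open>W\<close> and as a section of the direct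
    image over \<open>U\<close>.\<close>
  define W where "W = pre U"
  have W: "openin (tsp Y) W" "y \<in> W" "W \<subseteq> V"
    using U preim_open openin_subset[OF assms(1)] assms(3) by (auto simp: W_def preim_iff)
  define g where "g = res F V W r"
  have g: "g \<in> carrier (sect F W)" "g \<in> carrier (sect DF U)"
    using F.res_closed[OF assms(1) W(1,3) assms(2)] by (simp_all add: g_def direct_image_simps W_def)
  let ?gas = "[(g, \<lambda>z\<in>W. 1)]"
  have a: "admissible U W ?gas"
    using U W g constant_hol(2)[OF W(1)] by (simp add: admissible_def W_def)
  define s where "s = (\<lambda>z\<in>W. tclass z (gens U W ?gas z))"
  have "germF z W g = can_stalk z (s z)" if z: "z \<in> W" for z
  proof -
    note zz = admissible_point[OF a z]
    interpret L: scalar_extension_lift "local_ring X (\<psi> z)" "local_ring Y z" "comor z"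
      "modD (\<psi> z)" "modF z" "dmap z"
      using zz(4) by (rule scalar_extension_lift)
    have 1: "germ_fun Y z W (\<lambda>z\<in>W. 1) = \<one>\<^bsub>local_ring Y z\<^esub>"
      using OY.germ_one[OF W(1) z] by simp
    have c: "germD (\<psi> z) U g \<in> carrier (modD (\<psi> z))"
      using DF.germ_closed[OF zz(1,3) g(2)] by simp
    have "can_stalk z (s z) = lift_free_at z (gens U W ?gas z)"
      using z canonical_stalk_class[OF zz(4) gens_tensors[OF a z]] by (simp add: s_def)
    also have "\<dots> = dmap z (germD (\<psi> z) U g)"
      using L.lift_free_of[OF c L.S.one_closed] L.D_closed[OF c] by (simp add: gens_simps 1)
    also have "\<dots> = germF z W g"
      unfolding W_def using zz g(2) by (intro direct_stalk_map_germ)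
    finally show ?thesis by simp
  qed
  then have "can_mor W s = g"
    using W(1) g(1) by (intro canonical_morphism_eqI)
  moreover have "s \<in> carrier (sect IF W)"
    unfolding s_def by (rule gens_section[OF a])
  ultimately show ?thesis
    using W unfolding g_def by (intro exI conjI)
qed

end

section \<open>The kernel of the canonical morphism\<close>

context sheaf_on_normalization
begin

lemma inv_class_frag:
  assumes z: "z \<in> pts Y" and m: "m \<in> carrier (stalkD (\<psi> z))" and s: "s \<in> carrier (local_ring Y z)"
  shows "r \<in> carrier (local_ring X (\<psi> z)) \<Longrightarrow>
      tclass z (frag_of (r \<odot>\<^bsub>modD (\<psi> z)\<^esub> m, s)) =
      tclass z (frag_of (m, comor z r \<otimes>\<^bsub>local_ring Y z\<^esub> s))"
    and "m' \<in> carrier (stalkD (\<psi> z)) \<Longrightarrow>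
      tclass z (frag_of (m \<oplus>\<^bsub>stalkD (\<psi> z)\<^esub> m', s)) =
      tclass z (frag_of (m, s)) \<oplus>\<^bsub>tstalk z\<^esub> tclass z (frag_of (m', s))"
    and "t \<in> carrier (local_ring Y z) \<Longrightarrow>
      t \<odot>\<^bsub>tstalk z\<^esub> tclass z (frag_of (m, s)) =
      tclass z (frag_of (m, t \<otimes>\<^bsub>local_ring Y z\<^esub> s))"
    and "tclass z (frag_of (\<zero>\<^bsub>stalkD (\<psi> z)\<^esub>, s)) = \<zero>\<^bsub>tstalk z\<^esub>"
proof -
  interpret L: scalar_extension "local_ring X (\<psi> z)" "local_ring Y z" "comor z"
    "modD (\<psi> z)"
    using z by (rule scalar_extension)
  interpret M: abelian_group "stalkD (\<psi> z)" using psi_pts[OF z] by (rule DF.stalk_abelian)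
  interpret E: module "local_ring Y z" "tstalk z" using z by (rule inv_stalk_module)
  have t: "frag_of (m, s) \<in> L.tensors" if "m \<in> carrier (stalkD (\<psi> z))"
    "s \<in> carrier (local_ring Y z)" for m s
    using that by (intro L.tensors_closed(5)) simp_all
  show "tclass z (frag_of (r \<odot>\<^bsub>modD (\<psi> z)\<^esub> m, s)) =
      tclass z (frag_of (m, comor z r \<otimes>\<^bsub>local_ring Y z\<^esub> s))"
    if r: "r \<in> carrier (local_ring X (\<psi> z))"
    unfolding inv_class_def
    using tensor_rel.balanced[OF r, of m "modD (\<psi> z)" s] m s t L.smult_closed[OF r, of m]
    by (subst L.cls_eq_iff) simp_all
  have add: "tclass z (frag_of (m \<oplus>\<^bsub>stalkD (\<psi> z)\<^esub> m', s)) =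
      tclass z (frag_of (m, s)) \<oplus>\<^bsub>tstalk z\<^esub> tclass z (frag_of (m', s))"
    if m: "m \<in> carrier (stalkD (\<psi> z))" and m': "m' \<in> carrier (stalkD (\<psi> z))" for m m'
    unfolding inv_class_ops(1)[OF z t[OF m s] t[OF m' s]]
    unfolding inv_class_def
    using tensor_rel.add_left[of m "modD (\<psi> z)" m' s] m m' s t
    by (subst L.cls_eq_iff) (simp_all add: diff_diff_eq)
  show "tclass z (frag_of (m \<oplus>\<^bsub>stalkD (\<psi> z)\<^esub> m', s)) =
      tclass z (frag_of (m, s)) \<oplus>\<^bsub>tstalk z\<^esub> tclass z (frag_of (m', s))"
    if "m' \<in> carrier (stalkD (\<psi> z))"
    using m that by (rule add)
  show "t \<odot>\<^bsub>tstalk z\<^esub> tclass z (frag_of (m, s)) =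
      tclass z (frag_of (m, t \<otimes>\<^bsub>local_ring Y z\<^esub> s))" if "t \<in> carrier (local_ring Y z)" for t
    using inv_class_ops(2)[OF z t[OF m s] that] by simp
  have c: "tclass z (frag_of (\<zero>\<^bsub>stalkD (\<psi> z)\<^esub>, s)) \<in> carrier (tstalk z)"
    using z t[OF M.zero_closed s] by (rule inv_class_ops(3))
  \<comment> \<open>Additivity in the first factor makes this class idempotent under addition, hence
    zero.\<close>
  show "tclass z (frag_of (\<zero>\<^bsub>stalkD (\<psi> z)\<^esub>, s)) = \<zero>\<^bsub>tstalk z\<^esub>"
    using add[OF M.zero_closed M.zero_closed] c by (metis E.M.add.r_cancel_one M.r_zero M.zero_closed)
qed

text \<open>Multiplication by a common denominator turns a section of \<open>\<psi>\<^sup>*\<psi>\<^sub>*F\<close> into a single tensor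
  \<open>g \<otimes> 1\<close>.\<close>

lemma clear_denominators:
  assumes "admissible U W gas" "y \<in> W"
  shows "\<exists>V b g. openin (tsp X) V \<and> \<psi> y \<in> V \<and> pre V \<subseteq> W \<and> b \<in> hol X V \<and>
    germ_fun X (\<psi> y) V b \<noteq> \<zero>\<^bsub>local_ring X (\<psi> y)\<^esub> \<and> g \<in> carrier (sect DF V) \<and>
    (\<forall>z \<in> pre V.
      germ_fun Y z (pre V) (pull Y \<psi> V b) \<odot>\<^bsub>tstalk z\<^esub> tclass z (gens U W gas z) =
      tclass z (frag_of (germD (\<psi> z) V g, \<one>\<^bsub>local_ring Y z\<^esub>)))"
  using assms(1)
proof (induction gas)
  case Nil
  have W: "openin (tsp Y) W" using Nil by (simp add: admissible_def)
  have y: "y \<in> pts Y" using W assms(2) openin_subset by blast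
  interpret R: domain "local_ring X (\<psi> y)" using psi_pts[OF y] by (rule domain_X)
  obtain V0 where V0: "openin (tsp X) V0" "\<psi> y \<in> V0" "pre V0 \<subseteq> W"
    using W assms(2) by (rule preim_neighbourhood)
  \<comment> \<open>The denominator of the empty sum is 1. It is taken as a representative of the
    unit of the local ring at \<open>\<psi> y\<close>, which is a domain, so that its germ is
    nonzero.\<close>
  obtain V b where V: "openin (tsp X) V" "\<psi> y \<in> V" "V \<subseteq> V0" "b \<in> hol X V"
    "\<one>\<^bsub>local_ring X (\<psi> y)\<^esub> = germ_fun X (\<psi> y) V b"
    using R.one_closed V0(1,2) by (rule OX.stalk_cases_within) simp
  have "germ_fun Y z (pre V) (pull Y \<psi> V b) \<odot>\<^bsub>tstalk z\<^esub> tclass z (gens U W [] z) =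
      tclass z (frag_of (germD (\<psi> z) V \<zero>\<^bsub>sect DF V\<^esub>, \<one>\<^bsub>local_ring Y z\<^esub>))"
    if z: "z \<in> pre V" for z
  proof -
    have zz: "z \<in> pts Y" "\<psi> z \<in> V" using z by (auto simp: preim_iff)
    interpret E: module "local_ring Y z" "tstalk z" using zz(1) by (rule inv_stalk_module)
    have "germ_fun Y z (pre V) (pull Y \<psi> V b) \<in> carrier (local_ring Y z)"
      using OY.germ_closed[OF preim_open[OF V(1)] z] pull_closed[OF V(1,4)] by simp
    moreover have "germD (\<psi> z) V \<zero>\<^bsub>sect DF V\<^esub> = \<zero>\<^bsub>stalkD (\<psi> z)\<^esub>"
      using V(1) zz(2) by (rule DF.germ_zero)
    moreover have "\<zero>\<^bsub>stalkD (\<psi> z)\<^esub> \<in> carrier (stalkD (\<psi> z))"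
      using DF.germ_closed[OF V(1) zz(2) DF.zero_sect_closed[OF V(1)]] DF.germ_zero[OF V(1) zz(2)] by simp
    ultimately show ?thesis
      using inv_class_frag(4)[OF zz(1) _ E.R.one_closed] by (simp add: gens_simps inv_class_zero[OF zz(1)])
  qed
  moreover have "germ_fun X (\<psi> y) V b \<noteq> \<zero>\<^bsub>local_ring X (\<psi> y)\<^esub>"
    using V(5) R.one_not_zero by simp
  moreover have "pre V \<subseteq> W"
    using V0(3) preim_mono[OF V(3)] by blast
  ultimately show ?case
    using V(1,2,4) DF.zero_sect_closed[OF V(1)] by blast
next
  case (Cons p gas)
  obtain g a where p: "p = (g, a)" by force
  note a = Cons.prems[unfolded p admissible_simps]
  have U: "openin (tsp X) U" "openin (tsp Y) W" "W \<subseteq> pre U" "\<psi> y \<in> U"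
    using Cons.prems assms(2) by (auto simp: admissible_def preim_iff)
  have y: "y \<in> pts Y" using U(2) assms(2) openin_subset by blast
  interpret R: domain "local_ring X (\<psi> y)" using psi_pts[OF y] by (rule domain_X)
  obtain V1 b1 g1 where 1: "openin (tsp X) V1" "\<psi> y \<in> V1" "pre V1 \<subseteq> W" "b1 \<in> hol X V1"
    "germ_fun X (\<psi> y) V1 b1 \<noteq> \<zero>\<^bsub>local_ring X (\<psi> y)\<^esub>" "g1 \<in> carrier (sect DF V1)"
    "\<And>z. z \<in> pre V1 \<Longrightarrow>
      germ_fun Y z (pre V1) (pull Y \<psi> V1 b1) \<odot>\<^bsub>tstalk z\<^esub> tclass z (gens U W gas z) =
      tclass z (frag_of (germD (\<psi> z) V1 g1, \<one>\<^bsub>local_ring Y z\<^esub>))"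
    using Cons.IH a by metis
  obtain V2 b2 c2 where 2: "openin (tsp X) V2" "\<psi> y \<in> V2" "pre V2 \<subseteq> W" "b2 \<in> hol X V2" "c2 \<in> hol X V2"
    "germ_fun X (\<psi> y) V2 b2 \<noteq> \<zero>\<^bsub>local_ring X (\<psi> y)\<^esub>"
    "\<And>z. z \<in> pre V2 \<Longrightarrow> b2 (\<psi> z) * a z = c2 (\<psi> z)"
    using denominator[OF U(2) assms(2), of a] a by metis
  define V where "V = V1 \<inter> V2 \<inter> U"
  have V: "openin (tsp X) V" "\<psi> y \<in> V" "V \<subseteq> V1" "V \<subseteq> V2" "V \<subseteq> U"
    using 1 2 U by (auto simp: V_def)
  define P where "P = pre V"
  have P: "openin (tsp Y) P" "P \<subseteq> W" "P \<subseteq> pre V1" "P \<subseteq> pre V2"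
    using preim_open[OF V(1)] preim_mono[OF V(3)] preim_mono[OF V(4)] 1(3) by (auto simp: P_def)
  define b1' b2' c2' where "b1' = restrict b1 V" and "b2' = restrict b2 V" and "c2' = restrict c2 V"
  define g' g1' where "g' = res DF U V g" and "g1' = res DF V1 V g1"
  have h: "b1' \<in> hol X V" "b2' \<in> hol X V" "c2' \<in> hol X V"
    using hol_restrict[OF X 1(1) V(1,3)] hol_restrict[OF X 2(1) V(1,4)] 1 2
    by (simp_all add: b1'_def b2'_def c2'_def)
  have g': "g' \<in> carrier (sect DF V)" "g1' \<in> carrier (sect DF V)"
    using DF.res_closed[OF U(1) V(1,5)] DF.res_closed[OF 1(1) V(1,3)] 1 a by (simp_all add: g'_def g1'_def)
  \<comment> \<open>Let \<open>b1\<close> turn the remaining sum into \<open>g1 \<otimes> 1\<close>,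
    and let \<open>b2 a = c2\<close> for the coefficient of the new summand
    \<open>g \<otimes> a\<close>. Then \<open>b1 b2\<close> turns the whole sum into
    \<open>(b1 c2 g + b2 g1) \<otimes> 1\<close>, which dictates \<open>b\<close>, \<open>k\<close>
    and \<open>g2\<close>.\<close>
  define b where "b = (\<lambda>x\<in>V. b1' x * b2' x)"
  define k where "k = (\<lambda>x\<in>V. b1' x * c2' x)"
  have bk: "b \<in> hol X V" "k \<in> hol X V"
    using hol_mult[OF X V(1)] h by (simp_all add: b_def k_def)
  define g2 where "g2 = (k \<odot>\<^bsub>sect DF V\<^esub> g') \<oplus>\<^bsub>sect DF V\<^esub> (b2' \<odot>\<^bsub>sect DF V\<^esub> g1')"
  have g2: "g2 \<in> carrier (sect DF V)"
    unfolding g2_def using g' bk h by (intro DF.add_sect_closed DF_smult_closed V(1))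
  have nz: "germ_fun X (\<psi> y) V b \<noteq> \<zero>\<^bsub>local_ring X (\<psi> y)\<^esub>"
  proof -
    have e: "germ_fun X (\<psi> y) V b1' = germ_fun X (\<psi> y) V1 b1" "germ_fun X (\<psi> y) V b2' = germ_fun X (\<psi> y) V2 b2"
      using OX.germ_res[OF 1(1) V(1,3,2)] OX.germ_res[OF 2(1) V(1,4,2)] 1 2 by (simp_all add: b1'_def b2'_def)
    have "germ_fun X (\<psi> y) V b = germ_fun X (\<psi> y) V b1' \<otimes>\<^bsub>local_ring X (\<psi> y)\<^esub> germ_fun X (\<psi> y) V b2'"
      using OX.germ_mult[OF V(1,2), of b1' b2'] h by (simp add: b_def)
    then show ?thesis
      using R.integral_iff[of "germ_fun X (\<psi> y) V b1'" "germ_fun X (\<psi> y) V b2'"] e 1(5) 2(6)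
        OX.germ_closed[OF V(1,2), of b1'] OX.germ_closed[OF V(1,2), of b2'] h by simp
  qed
  have "germ_fun Y z P (pull Y \<psi> V b) \<odot>\<^bsub>tstalk z\<^esub> tclass z (gens U W (p # gas) z) =
      tclass z (frag_of (germD (\<psi> z) V g2, \<one>\<^bsub>local_ring Y z\<^esub>))"
    if z: "z \<in> P" for z
  proof -
    have zz: "z \<in> pts Y" "\<psi> z \<in> V" "z \<in> W" "z \<in> pre V1" "z \<in> pre V2"
      using z P by (auto simp: P_def preim_iff)
    let ?E = "tstalk z" and ?S = "local_ring Y z" and ?cl = "tclass z"
    interpret E: module ?S ?E using zz(1) by (rule inv_stalk_module)
    interpret L: scalar_extension "local_ring X (\<psi> z)" ?S "comor z" "modD (\<psi> z)"
      using zz(1) by (rule scalar_extension)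
    define \<beta>1 \<beta>2 \<kappa> \<alpha> where "\<beta>1 = germ_fun Y z P (pull Y \<psi> V b1')" and "\<beta>2 = germ_fun Y z P (pull Y \<psi> V b2')"
      and "\<kappa> = germ_fun Y z P (pull Y \<psi> V c2')" and "\<alpha> = germ_fun Y z W a"
    define \<gamma> \<gamma>1 where "\<gamma> = germD (\<psi> z) U g" and "\<gamma>1 = germD (\<psi> z) V1 g1"
    have \<gamma>: "\<gamma> = germD (\<psi> z) V g'" "\<gamma>1 = germD (\<psi> z) V g1'"
      using DF.germ_res[OF U(1) V(1,5) zz(2)] DF.germ_res[OF 1(1) V(1,3) zz(2)] a 1(6)
      by (simp_all add: \<gamma>_def \<gamma>1_def g'_def g1'_def)
    have pc: "pull Y \<psi> V f \<in> hol Y P" if "f \<in> hol X V" for f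
      using pull_closed[OF V(1) that] by (simp add: P_def)
    have aP: "restrict a P \<in> hol Y P" "\<alpha> = germ_fun Y z P (restrict a P)"
      using OY.res_closed[OF U(2) P(1,2), of a] OY.germ_res[OF U(2) P(1,2) z, of a] a by (simp_all add: \<alpha>_def)
    have c: "\<beta>1 \<in> carrier ?S" "\<beta>2 \<in> carrier ?S" "\<kappa> \<in> carrier ?S" "\<alpha> \<in> carrier ?S"
      "\<gamma> \<in> carrier (stalkD (\<psi> z))" "\<gamma>1 \<in> carrier (stalkD (\<psi> z))"
      using OY.germ_closed[OF P(1) z] pc h aP DF.germ_closed[OF V(1) zz(2)] g' \<gamma>
      by (simp_all add: \<beta>1_def \<beta>2_def \<kappa>_def)
    have com: "comor z (germ_fun X (\<psi> z) V f) = germ_fun Y z P (pull Y \<psi> V f)" if "f \<in> hol X V" for f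
      unfolding P_def using V(1) zz(2,1) that by (rule comorphism_germ)
    have bb: "germ_fun Y z P (pull Y \<psi> V b) = \<beta>1 \<otimes>\<^bsub>?S\<^esub> \<beta>2"
    proof -
      have "pull Y \<psi> V b = pull Y \<psi> V b1' \<otimes>\<^bsub>sect (structure_sheaf Y) P\<^esub> pull Y \<psi> V b2'"
        by (auto simp: pull_def b_def P_def preim_def fun_eq_iff restrict_def)
      then show ?thesis
        using OY.germ_mult[OF P(1) z] pc[OF h(1)] pc[OF h(2)] by (simp add: \<beta>1_def \<beta>2_def)
    qed
    have kk: "germ_fun Y z P (pull Y \<psi> V k) = \<beta>1 \<otimes>\<^bsub>?S\<^esub> \<kappa>"
    proof -
      have "pull Y \<psi> V k = pull Y \<psi> V b1' \<otimes>\<^bsub>sect (structure_sheaf Y) P\<^esub> pull Y \<psi> V c2'"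
        by (auto simp: pull_def k_def P_def preim_def fun_eq_iff restrict_def)
      then show ?thesis
        using OY.germ_mult[OF P(1) z] pc[OF h(1)] pc[OF h(3)] by (simp add: \<beta>1_def \<kappa>_def)
    qed
    have ba: "\<beta>2 \<otimes>\<^bsub>?S\<^esub> \<alpha> = \<kappa>"
    proof -
      have "pull Y \<psi> V b2' \<otimes>\<^bsub>sect (structure_sheaf Y) P\<^esub> restrict a P = pull Y \<psi> V c2'"
      proof
        fix w
        show "(pull Y \<psi> V b2' \<otimes>\<^bsub>sect (structure_sheaf Y) P\<^esub> restrict a P) w = pull Y \<psi> V c2' w"
        proof (cases "w \<in> P")
          case True
          then have "w \<in> pre V" "\<psi> w \<in> V" "w \<in> pre V2"
            using P(4) by (auto simp: P_def preim_iff)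
          then show ?thesis
            using 2(7)[of w] True by (simp add: pull_def b2'_def c2'_def)
        qed (simp add: pull_def P_def)
      qed
      then show ?thesis
        using OY.germ_mult[OF P(1) z, of "pull Y \<psi> V b2'" "restrict a P"] pc[OF h(2)] aP
        by (simp add: \<beta>2_def \<kappa>_def)
    qed
    have ih: "\<beta>1 \<odot>\<^bsub>?E\<^esub> ?cl (gens U W gas z) = ?cl (frag_of (\<gamma>1, \<one>\<^bsub>?S\<^esub>))"
    proof -
      have "germ_fun Y z (pre V1) (pull Y \<psi> V1 b1) = \<beta>1"
        using OY.germ_res[OF preim_open[OF 1(1)] P(1,3) z, of "pull Y \<psi> V1 b1"] pull_closed[OF 1(1,4)]
          pull_restrict[OF V(3), of b1]
        by (simp add: \<beta>1_def b1'_def P_def)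
      then show ?thesis using 1(7)[OF zz(4)] by (simp add: \<gamma>1_def)
    qed
    have t: "frag_of (\<gamma>, \<alpha>) \<in> L.tensors" "gens U W gas z \<in> L.tensors"
      using c L.tensors_closed(5)[of \<gamma> \<alpha>] gens_tensors[OF _ zz(3), of U gas] a by simp_all
    note cc = inv_class_ops(3)[OF zz(1) t(1)] inv_class_ops(3)[OF zz(1) t(2)]
    \<comment> \<open>After multiplication the coefficient \<open>\<alpha>\<close> has become
      \<open>\<beta>1 \<kappa>\<close>, the image of the germ of \<open>k\<close> on
      \<open>X\<close>. A scalar coming from \<open>X\<close> can be moved through the tensor
      product onto \<gamma>.\<close>
    have k1: "(\<beta>1 \<otimes>\<^bsub>?S\<^esub> \<beta>2) \<odot>\<^bsub>?E\<^esub> ?cl (frag_of (\<gamma>, \<alpha>)) =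
        ?cl (frag_of (germ_fun X (\<psi> z) V k \<odot>\<^bsub>modD (\<psi> z)\<^esub> \<gamma>, \<one>\<^bsub>?S\<^esub>))"
    proof -
      have "(\<beta>1 \<otimes>\<^bsub>?S\<^esub> \<beta>2) \<odot>\<^bsub>?E\<^esub> ?cl (frag_of (\<gamma>, \<alpha>)) = ?cl (frag_of (\<gamma>, (\<beta>1 \<otimes>\<^bsub>?S\<^esub> \<kappa>) \<otimes>\<^bsub>?S\<^esub> \<one>\<^bsub>?S\<^esub>))"
        using inv_class_frag(3)[OF zz(1) c(5,4), of "\<beta>1 \<otimes>\<^bsub>?S\<^esub> \<beta>2"] c ba by (simp add: E.R.m_assoc)
      then show ?thesis
        using inv_class_frag(1)[OF zz(1) c(5) E.R.one_closed, of "germ_fun X (\<psi> z) V k"]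
          OX.germ_closed[OF V(1) zz(2), of k] bk(2) com[OF bk(2)] kk by simp
    qed
    \<comment> \<open>The factor \<beta>1 is absorbed by the induction hypothesis; \<beta>2 comes
      from \<open>X\<close> and moves to the first factor.\<close>
    have k2: "(\<beta>1 \<otimes>\<^bsub>?S\<^esub> \<beta>2) \<odot>\<^bsub>?E\<^esub> ?cl (gens U W gas z) =
        ?cl (frag_of (germ_fun X (\<psi> z) V b2' \<odot>\<^bsub>modD (\<psi> z)\<^esub> \<gamma>1, \<one>\<^bsub>?S\<^esub>))"
    proof -
      have "(\<beta>1 \<otimes>\<^bsub>?S\<^esub> \<beta>2) \<odot>\<^bsub>?E\<^esub> ?cl (gens U W gas z) = \<beta>2 \<odot>\<^bsub>?E\<^esub> ?cl (frag_of (\<gamma>1, \<one>\<^bsub>?S\<^esub>))"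
        using c cc(2) ih by (simp add: E.R.m_comm[of \<beta>1] E.smult_assoc1)
      then show ?thesis
        using inv_class_frag(3)[OF zz(1) c(6) E.R.one_closed c(2)] com[OF h(2)]
          inv_class_frag(1)[OF zz(1) c(6) E.R.one_closed, of "germ_fun X (\<psi> z) V b2'"]
          OX.germ_closed[OF V(1) zz(2), of b2'] h(2)
        by (simp add: \<beta>2_def)
    qed
    have d: "germ_fun X (\<psi> z) V k \<odot>\<^bsub>modD (\<psi> z)\<^esub> \<gamma> = germD (\<psi> z) V (k \<odot>\<^bsub>sect DF V\<^esub> g')"
      "germ_fun X (\<psi> z) V b2' \<odot>\<^bsub>modD (\<psi> z)\<^esub> \<gamma>1 = germD (\<psi> z) V (b2' \<odot>\<^bsub>sect DF V\<^esub> g1')"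
      unfolding \<gamma> using DF_germ_smult[OF V(1) zz(2)] bk h g' by simp_all
    have dc: "k \<odot>\<^bsub>sect DF V\<^esub> g' \<in> carrier (sect DF V)" "b2' \<odot>\<^bsub>sect DF V\<^esub> g1' \<in> carrier (sect DF V)"
      using DF_smult_closed[OF V(1)] bk h g' by simp_all
    have "?cl (gens U W (p # gas) z) = ?cl (frag_of (\<gamma>, \<alpha>)) \<oplus>\<^bsub>?E\<^esub> ?cl (gens U W gas z)"
      using inv_class_ops(1)[OF zz(1) t] by (simp add: p gens_simps \<gamma>_def \<alpha>_def)
    then have "germ_fun Y z P (pull Y \<psi> V b) \<odot>\<^bsub>?E\<^esub> ?cl (gens U W (p # gas) z) =
        ?cl (frag_of (germD (\<psi> z) V (k \<odot>\<^bsub>sect DF V\<^esub> g'), \<one>\<^bsub>?S\<^esub>)) \<oplus>\<^bsub>?E\<^esub>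
        ?cl (frag_of (germD (\<psi> z) V (b2' \<odot>\<^bsub>sect DF V\<^esub> g1'), \<one>\<^bsub>?S\<^esub>))"
      using c cc k1 k2 d by (simp add: bb E.smult_r_distr)
    also have "\<dots> = ?cl (frag_of (germD (\<psi> z) V g2, \<one>\<^bsub>?S\<^esub>))"
      using inv_class_frag(2)[OF zz(1) DF.germ_closed[OF V(1) zz(2) dc(1)] E.R.one_closed
          DF.germ_closed[OF V(1) zz(2) dc(2)]] DF.germ_add[OF V(1) zz(2) dc]
      by (simp add: g2_def)
    finally show ?thesis .
  qed
  then show ?case
    using V(1,2) bk(1) nz g2 P(2) unfolding P_def by (intro exI conjI ballI)
qed

text \<open>\<open>torsion_sub\<close> refers to germs of sections of \<open>IF\<close>, while
  \<open>can_stalk\<close> acts on the tensor products \<open>tstalk\<close>. Both inclusions pass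
  between the two: a relation of germs holds on a neighbourhood and can be evaluated at a point, and
  conversely relations at all points of a neighbourhood give one of germs.\<close>

lemma canonical_morphism_kernel:
  assumes tf: "torsion_free Y F" and V: "openin (tsp Y) V"
  shows "torsion_sub Y IF V = {s \<in> carrier (sect IF V). can_mor V s = \<zero>\<^bsub>sect F V\<^esub>}"
proof (intro equalityI subsetI)
  fix s assume "s \<in> torsion_sub Y IF V"
  then have s: "s \<in> carrier (sect IF V)"
    and tor: "\<And>y. y \<in> V \<Longrightarrow> germ (tsp Y) IF y V s \<in> torsion_elems (local_ring Y y) (stalk_mod Y IF y)"
    unfolding torsion_sub_def by auto
  note can = canonical_morphism_germ[OF V s]
  have "germF y V (can_mor V s) = \<zero>\<^bsub>stalkF y\<^esub>" if y: "y \<in> V" for y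
  proof -
    have yp: "y \<in> pts Y" using y V openin_subset by blast
    obtain \<alpha> where \<alpha>: "\<alpha> \<in> nonzerodivisors (local_ring Y y)"
      "\<alpha> \<odot>\<^bsub>stalk_mod Y IF y\<^esub> germ (tsp Y) IF y V s = \<zero>\<^bsub>stalk (tsp Y) IF y\<^esub>"
      using tor[OF y] unfolding torsion_elems_def by auto
    then have \<alpha>c: "\<alpha> \<in> carrier (local_ring Y y)" unfolding nonzerodivisors_def by blast
    obtain W f where W: "openin (tsp Y) W" "y \<in> W" "W \<subseteq> V" "f \<in> hol Y W" "\<alpha> = germ_fun Y y W f"
      using \<alpha>c V y by (rule OY.stalk_cases_within) simp
    define s' where "s' = res IF V W s"
    have s': "s' \<in> carrier (sect IF W)" "germ (tsp Y) IF y V s = germ (tsp Y) IF y W s'" "s' y = s y"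
      using IF.res_closed[OF V W(1,3) s] IF.germ_res[OF V W(1,3,2) s] W(2)
      by (simp_all add: s'_def IF_eq)
    have "germ (tsp Y) IF y W (f \<odot>\<^bsub>sect IF W\<^esub> s') = \<zero>\<^bsub>stalk (tsp Y) IF y\<^esub>"
      using \<alpha>(2) IF.germ_smult[OF W(1,2,4) s'(1)] W(5) s'(2) by simp
    then obtain W' where W': "openin (tsp Y) W'" "y \<in> W'" "W' \<subseteq> W"
      "res IF W W' (f \<odot>\<^bsub>sect IF W\<^esub> s') = \<zero>\<^bsub>sect IF W'\<^esub>"
      using W(1,2) IF.smult_sect_closed[OF W(1,4) s'(1)] by (rule IF.germ_eq_zeroD)
    \<comment> \<open>Evaluating the vanishing section at \<open>y\<close> turns the relation
      between germs into a relation in the tensor product, to which \<open>can_stalk y\<close> can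
      be applied.\<close>
    have "\<alpha> \<odot>\<^bsub>tstalk y\<^esub> s y = \<zero>\<^bsub>tstalk y\<^esub>"
      using fun_cong[OF W'(4), of y] W'(2) W(2,5) s'(3) by (simp add: IF_eq)
    moreover have sy: "s y \<in> carrier (tstalk y)"
      using s y unfolding IF_eq section_sheaf_carrier by blast
    moreover have "can_stalk y \<zero>\<^bsub>tstalk y\<^esub> = \<zero>\<^bsub>stalkF y\<^esub>"
      using canonical_stalk_class[OF yp scalar_extension.tensors_closed(1)[OF scalar_extension[OF yp]]]
        inv_class_zero[OF yp] scalar_extension_lift.lift_free_zero[OF scalar_extension_lift[OF yp]] by simp
    ultimately have "\<alpha> \<odot>\<^bsub>modF y\<^esub> can_stalk y (s y) = \<zero>\<^bsub>stalkF y\<^esub>"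
      using canonical_stalk_hom[OF yp] \<alpha>c unfolding mod_hom_def by fastforce
    then have "can_stalk y (s y) \<in> torsion_elems (local_ring Y y) (modF y)"
      using canonical_stalk_hom[OF yp] sy \<alpha>(1) unfolding torsion_elems_def mod_hom_def by auto
    then have "can_stalk y (s y) = \<zero>\<^bsub>stalkF y\<^esub>"
      using tf yp unfolding torsion_free_def by auto
    then show ?thesis using can y by simp
  qed
  then have "can_mor V s = \<zero>\<^bsub>sect F V\<^esub>"
    using can V by (intro F.section_eqI[of V]) (simp_all add: F.zero_sect_closed F.germ_zero)
  with s show "s \<in> {s \<in> carrier (sect IF V). can_mor V s = \<zero>\<^bsub>sect F V\<^esub>}" by blast
next
  fix s assume "s \<in> {s \<in> carrier (sect IF V). can_mor V s = \<zero>\<^bsub>sect F V\<^esub>}"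
  then have s: "s \<in> carrier (sect IF V)" and "can_mor V s = \<zero>\<^bsub>sect F V\<^esub>" by auto
  then have zero: "can_stalk z (s z) = \<zero>\<^bsub>stalkF z\<^esub>" if "z \<in> V" for z
    using canonical_morphism_germ[OF V s] F.germ_zero[OF V that] that by metis
  have "germ (tsp Y) IF y V s \<in> torsion_elems (local_ring Y y) (stalk_mod Y IF y)" if y: "y \<in> V" for y
  proof -
    have yp: "y \<in> pts Y" using y V openin_subset by blast
    obtain W t where W: "openin (tsp Y) W" "y \<in> W" "W \<subseteq> V" "t \<in> gen_sections W" "\<forall>z \<in> W. s z = t z"
      using s y unfolding IF_eq section_sheaf_carrier by blast
    obtain U gas where a: "admissible U W gas" and t: "t = (\<lambda>z. tclass z (gens U W gas z))"
      using W(4) unfolding gen_sections_iff[OF W(1)] by blast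
    obtain V' b g where V': "openin (tsp X) V'" "\<psi> y \<in> V'" "pre V' \<subseteq> W" "b \<in> hol X V'"
      "germ_fun X (\<psi> y) V' b \<noteq> \<zero>\<^bsub>local_ring X (\<psi> y)\<^esub>" "g \<in> carrier (sect DF V')"
      and eq: "\<And>z. z \<in> pre V' \<Longrightarrow>
        germ_fun Y z (pre V') (pull Y \<psi> V' b) \<odot>\<^bsub>tstalk z\<^esub> tclass z (gens U W gas z) =
        tclass z (frag_of (germD (\<psi> z) V' g, \<one>\<^bsub>local_ring Y z\<^esub>))"
      using clear_denominators[OF a W(2)] by metis
    let ?P = "pre V'" and ?b = "pull Y \<psi> V' b"
    have P: "openin (tsp Y) ?P" "y \<in> ?P" "?P \<subseteq> V"
      using preim_open[OF V'(1)] V'(2,3) W(3) yp by (auto simp: preim_iff)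
    have pb: "?b \<in> hol Y ?P" using V'(1,4) by (rule pull_closed)
    have gF: "g \<in> carrier (sect F ?P)" using V'(6) by (simp add: direct_image_simps)
    have sz: "s z = tclass z (gens U W gas z)" if "z \<in> ?P" for z
      using that V'(3) W(5) t by auto
    \<comment> \<open>Applying \<open>can_stalk z\<close> to \<open>b s = g \<otimes> 1\<close>
      shows that the germ of \<open>g\<close> at \<open>z\<close> is \<open>b\<close> times the
      image of \<open>s z\<close>, which is zero. As this holds at every point of \<open>?P\<close>,
      the section \<open>g\<close> itself vanishes, and with it \<open>b s\<close>.\<close>
    have g0: "g = \<zero>\<^bsub>sect F ?P\<^esub>"
    proof (rule F.section_eqI[OF P(1) gF F.zero_sect_closed[OF P(1)]])
      fix z assume z: "z \<in> ?P"
      then have zz: "z \<in> pts Y" "\<psi> z \<in> V'" "z \<in> W" "z \<in> V" using V'(3) W(3) by (auto simp: preim_iff)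
      interpret L: scalar_extension_lift "local_ring X (\<psi> z)" "local_ring Y z" "comor z"
        "modD (\<psi> z)" "modF z" "dmap z"
        using zz(1) by (rule scalar_extension_lift)
      have m: "germD (\<psi> z) V' g \<in> carrier (modD (\<psi> z))"
        using DF.germ_closed[OF V'(1) zz(2) V'(6)] by simp
      have bc: "germ_fun Y z ?P ?b \<in> carrier (local_ring Y z)"
        using OY.germ_closed[OF P(1) z, of ?b] pb by simp
      have "germF z ?P g = can_stalk z
          (tclass z (frag_of (germD (\<psi> z) V' g, \<one>\<^bsub>local_ring Y z\<^esub>)))"
        using canonical_stalk_class[OF zz(1) L.tensors_closed(5)[OF m L.S.one_closed]] L.lift_free_of[OF m L.S.one_closed]
          L.D_closed[OF m] direct_stalk_map_germ[OF V'(1) zz(2,1) V'(6)] by simp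
      also have "\<dots> = germ_fun Y z ?P ?b \<odot>\<^bsub>modF z\<^esub> can_stalk z (s z)"
        unfolding eq[OF z, symmetric] sz[OF z]
        using bc canonical_stalk_hom[OF zz(1)] inv_class_ops(3)[OF zz(1) gens_tensors[OF a zz(3)]]
        unfolding mod_hom_def by blast
      also have "\<dots> = \<zero>\<^bsub>stalkF z\<^esub>"
        using L.N.smult_r_null[OF bc] zero[OF zz(4)] by simp
      finally show "germF z ?P g = germF z ?P \<zero>\<^bsub>sect F ?P\<^esub>"
        using F.germ_zero[OF P(1) z] by simp
    qed
    define s' where "s' = res IF V ?P s"
    have s': "s' \<in> carrier (sect IF ?P)" "germ (tsp Y) IF y V s = germ (tsp Y) IF y ?P s'"
      using IF.res_closed[OF V P(1,3) s] IF.germ_res[OF V P(1,3,2) s] by (simp_all add: s'_def)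
    have "?b \<odot>\<^bsub>sect IF ?P\<^esub> s' = \<zero>\<^bsub>sect IF ?P\<^esub>"
    proof -
      have "germ_fun Y z ?P ?b \<odot>\<^bsub>tstalk z\<^esub> s z = \<zero>\<^bsub>tstalk z\<^esub>" if z: "z \<in> ?P" for z
      proof -
        have zz: "z \<in> pts Y" "\<psi> z \<in> V'" using z by (auto simp: preim_iff)
        have g: "germD (\<psi> z) V' g = \<zero>\<^bsub>stalkD (\<psi> z)\<^esub>"
          using DF.germ_zero[OF V'(1) zz(2)] g0 by (simp add: direct_image_simps)
        then have "\<zero>\<^bsub>stalkD (\<psi> z)\<^esub> \<in> carrier (stalkD (\<psi> z))"
          using DF.germ_closed[OF V'(1) zz(2) V'(6)] by simp
        then show ?thesis
          using eq[OF z] sz[OF z] g inv_class_frag(4)[OF zz(1), of "\<zero>\<^bsub>stalkD (\<psi> z)\<^esub>" "\<one>\<^bsub>local_ring Y z\<^esub>"]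
            cring.cring_simprules(6)[OF OY.stalk_cring[OF zz(1)]] by simp
      qed
      then show ?thesis
        by (auto simp: IF_eq s'_def fun_eq_iff restrict_def)
    qed
    then have "germ_fun Y y ?P ?b \<odot>\<^bsub>stalk_mod Y IF y\<^esub> germ (tsp Y) IF y V s = \<zero>\<^bsub>stalk (tsp Y) IF y\<^esub>"
      using IF.germ_smult[OF P(1,2) pb s'(1)] IF.germ_zero[OF P(1,2)] s'(2) by simp
    moreover have "germ_fun Y y ?P ?b \<in> nonzerodivisors (local_ring Y y)"
      using V'(1,2) yp V'(4,5) by (rule pull_nonzerodivisor)
    ultimately show ?thesis
      unfolding torsion_elems_def using IF.germ_closed[OF V y s] by auto
  qed
  with s show "s \<in> torsion_sub Y IF V" unfolding torsion_sub_def by blast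
qed

end

theorem theorem4p5:
  fixes X :: "'p fspace" and Xh :: "'q fspace" and \<psi> :: "'q \<Rightarrow> 'p"
    and F :: "('q, 's) apresheaf"
  assumes "complex_space X" and "locally_irreducible X"
    and "normalization Xh X \<psi>"
    and "coherent_sheaf Xh F" and "torsion_free Xh F"
  shows "sheaf_hom Xh (inverse_image Xh X \<psi> (direct_image Xh \<psi> F)) F (canonical_morphism Xh \<psi> F) \<and>
    (\<exists>h. sheaf_iso Xh (tf_preimage Xh X \<psi> (direct_image Xh \<psi> F)) F h \<and>
       (\<forall>V s. openin (tsp Xh) V \<and>
          s \<in> carrier (sect (inverse_image Xh X \<psi> (direct_image Xh \<psi> F)) V) \<longrightarrow>
          h V (tf_proj Xh X \<psi> (direct_image Xh \<psi> F) V s) = canonical_morphism Xh \<psi> F V s))"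
proof -
  have "complex_space Xh" using assms(3) unfolding normalization_def by blast
  moreover have "analytic_sheaf Xh F" using assms(4) unfolding coherent_sheaf_def by blast
  ultimately interpret F: module_sheaf Xh F by (rule analytic_sheaf_imp_module_sheaf)
  \<comment> \<open>The module structure of \<open>F\<close> provides the rings of sections on
    \<open>Xh\<close>, that is, the hypothesis \<open>ring_Y\<close> of the locale.\<close>
  interpret sheaf_on_normalization X Xh \<psi> F
    using assms(1-3) F.O.ring_presheaf_axioms F.module_sheaf_axioms
    by (intro sheaf_on_normalization.intro irreducible_normalization.intro)
  show ?thesis
    unfolding tf_preimage_def tf_proj_def
    by (intro conjI canonical_morphism_hom F.quot_sheaf_iso IF.module_presheaf_axioms
        canonical_morphism_kernel[OF assms(5)] canonical_morphism_locally_surj)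
qed

end
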